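(* The category $\mathbf{Set}$ of sets and the category $\mathbf{Pro}$ of profinite spaces (with continuous maps) are Bass--Serre categories.
   Context: For a category $\mathbf{C}$ with finite limits (terminal object $*$), $\mathrm{Grp}(\mathbf{C})$ is the category of group objects in $\mathbf{C}$. Action Barr-exactness. In a regular category $\mathbf{D}$, if $H\in\mathrm{Grp}(\mathbf{D})$ acts on $Y\in\mathbf{D}$ (with action map $a\colon H\times Y\to Y$), then the image $R\hookrightarrow Y\times Y$ in the (regular epi)-mono factorisation of $(a,\mathrm{pr}_Y)\colon H\times Y\to Y\times Y$ is a congruence (internal equivalence relation) on $Y$. A regular category $\mathbf{D}$ is action Barr-exact if every such congruence is effective (has a coequaliser and is the kernel pair of it). $\mathbf{C}$ is locally action Barr-exact if every slice $\mathbf{C}_{/Y}$ is action Barr-exact. Bass--Serre category. A category $\mathbf{C}$ is Bass--Serre if: (1) $\mathbf{C}$ is locally action Barr-exact, has a terminal object, and has coequalisers, which are preserved by $C\times(-)$ for every $C\in\mathbf{C}$; (2) $\mathrm{Grp}(\mathbf{C})$ has coequalisers and $\mathbf{C}$-internal coproducts, i.e. for each $C\in\mathbf{C}$ the functor $\mathrm{Grp}(\mathbf{C})\to\mathrm{Grp}(\mathbf{C}_{/C})$, $K\mapsto K\times C$, has a left adjoint $\operatorname{colim}_{C^\delta}$; moreover for every $C$ and $H\in\mathrm{Grp}(\mathbf{C}_{/C})$, $H$ generates $\operatorname{colim}_{C^\delta}H$, meaning that $(\operatorname{colim}_{C^\delta}H)\times H\rightrightarrows\operatorname{colim}_{C^\delta}H\to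 *$ is a coequaliser in $\mathbf{C}$, where the two maps are the projection and the map (canonical map $H\to\operatorname{colim}_{C^\delta}H$ on the second factor, followed by multiplication). Here the canonical map is the unit $H\to(\operatorname{colim}_{C^\delta}H)\times C$ followed by the projection. *)

theory Defs
  imports "HOL-Analysis.Analysis"
begin

section \<open>Categories\<close>

text \<open>Hom-sets need not be disjoint, so an arrow does not determine its source and target;
  these are passed explicitly wherever they matter.  In exchange, slices and categories of group
  objects have the same type of arrows as the category they are built from.\<close>

record ('o, 'm) cat =
  Ob :: "'o set"
  Hom :: "'o \<Rightarrow> 'o \<Rightarrow> 'm set"
  Id :: "'o \<Rightarrow> 'm"
  Comp :: "'m \<Rightarrow> 'm \<Rightarrow> 'm"  (infixr "\<odot>\<index>" 70)

locale category =
  fixes C :: "('o, 'm) cat" (structure)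
  assumes Id_in_Hom: "X \<in> Ob C \<Longrightarrow> Id C X \<in> Hom C X X"
    and Comp_in_Hom: "\<lbrakk>X \<in> Ob C; Y \<in> Ob C; Z \<in> Ob C; f \<in> Hom C X Y; g \<in> Hom C Y Z\<rbrakk>
      \<Longrightarrow> g \<odot> f \<in> Hom C X Z"
    and Comp_Id: "\<lbrakk>X \<in> Ob C; Y \<in> Ob C; f \<in> Hom C X Y\<rbrakk> \<Longrightarrow> f \<odot> Id C X = f"
    and Id_Comp: "\<lbrakk>X \<in> Ob C; Y \<in> Ob C; f \<in> Hom C X Y\<rbrakk> \<Longrightarrow> Id C Y \<odot> f = f"
    and Comp_assoc: "\<lbrakk>W \<in> Ob C; X \<in> Ob C; Y \<in> Ob C; Z \<in> Ob C;
        f \<in> Hom C W X; g \<in> Hom C X Y; h \<in> Hom C Y Z\<rbrakk>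
      \<Longrightarrow> (h \<odot> g) \<odot> f = h \<odot> (g \<odot> f)"

text \<open>An object of the slice over \<open>B\<close> is a pair consisting of the total object and its
  structure map.\<close>

definition slice_cat :: "('o, 'm) cat \<Rightarrow> 'o \<Rightarrow> ('o \<times> 'm, 'm) cat" where
  "slice_cat C B = \<lparr>Ob = {(X, p). X \<in> Ob C \<and> p \<in> Hom C X B},
     Hom = (\<lambda>(X, p) (Y, q). {f \<in> Hom C X Y. q \<odot>\<^bsub>C\<^esub> f = p}),
     Id = (\<lambda>(X, p). Id C X),
     Comp = Comp C\<rparr>"

section \<open>Limits and colimits\<close>

definition is_terminal :: "('o, 'm) cat \<Rightarrow> 'o \<Rightarrow> bool" where
  "is_terminal C T \<longleftrightarrow> T \<in> Ob C \<and> (\<forall>X\<in>Ob C. \<exists>!f. f \<in> Hom C X T)"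

definition is_product :: "('o, 'm) cat \<Rightarrow> 'o \<Rightarrow> 'o \<Rightarrow> 'o \<Rightarrow> 'm \<Rightarrow> 'm \<Rightarrow> bool" where
  "is_product C A B P p q \<longleftrightarrow>
     A \<in> Ob C \<and> B \<in> Ob C \<and> P \<in> Ob C \<and> p \<in> Hom C P A \<and> q \<in> Hom C P B \<and>
     (\<forall>X\<in>Ob C. \<forall>f\<in>Hom C X A. \<forall>g\<in>Hom C X B.
        \<exists>!h. h \<in> Hom C X P \<and> p \<odot>\<^bsub>C\<^esub> h = f \<and> q \<odot>\<^bsub>C\<^esub> h = g)"

definition is_pullback ::
  "('o, 'm) cat \<Rightarrow> 'o \<Rightarrow> 'o \<Rightarrow> 'o \<Rightarrow> 'm \<Rightarrow> 'm \<Rightarrow> 'o \<Rightarrow> 'm \<Rightarrow> 'm \<Rightarrow> bool" where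
  "is_pullback C A B Z f g P p q \<longleftrightarrow>
     A \<in> Ob C \<and> B \<in> Ob C \<and> Z \<in> Ob C \<and> f \<in> Hom C A Z \<and> g \<in> Hom C B Z \<and>
     P \<in> Ob C \<and> p \<in> Hom C P A \<and> q \<in> Hom C P B \<and> f \<odot>\<^bsub>C\<^esub> p = g \<odot>\<^bsub>C\<^esub> q \<and>
     (\<forall>X\<in>Ob C. \<forall>u\<in>Hom C X A. \<forall>v\<in>Hom C X B. f \<odot>\<^bsub>C\<^esub> u = g \<odot>\<^bsub>C\<^esub> v \<longrightarrow>
        (\<exists>!h. h \<in> Hom C X P \<and> p \<odot>\<^bsub>C\<^esub> h = u \<and> q \<odot>\<^bsub>C\<^esub> h = v))"

definition is_coequaliser ::
  "('o, 'm) cat \<Rightarrow> 'o \<Rightarrow> 'o \<Rightarrow> 'm \<Rightarrow> 'm \<Rightarrow> 'o \<Rightarrow> 'm \<Rightarrow> bool" where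
  "is_coequaliser C X Y f g Q q \<longleftrightarrow>
     X \<in> Ob C \<and> Y \<in> Ob C \<and> f \<in> Hom C X Y \<and> g \<in> Hom C X Y \<and>
     Q \<in> Ob C \<and> q \<in> Hom C Y Q \<and> q \<odot>\<^bsub>C\<^esub> f = q \<odot>\<^bsub>C\<^esub> g \<and>
     (\<forall>Z\<in>Ob C. \<forall>h\<in>Hom C Y Z. h \<odot>\<^bsub>C\<^esub> f = h \<odot>\<^bsub>C\<^esub> g \<longrightarrow>
        (\<exists>!k. k \<in> Hom C Q Z \<and> k \<odot>\<^bsub>C\<^esub> q = h))"

definition has_coequalisers :: "('o, 'm) cat \<Rightarrow> bool" where
  "has_coequalisers C \<longleftrightarrow>
     (\<forall>X\<in>Ob C. \<forall>Y\<in>Ob C. \<forall>f\<in>Hom C X Y. \<forall>g\<in>Hom C X Y. \<exists>Q q. is_coequaliser C X Y f g Q q)"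

definition is_mono :: "('o, 'm) cat \<Rightarrow> 'o \<Rightarrow> 'o \<Rightarrow> 'm \<Rightarrow> bool" where
  "is_mono C X Y f \<longleftrightarrow> X \<in> Ob C \<and> Y \<in> Ob C \<and> f \<in> Hom C X Y \<and>
     (\<forall>W\<in>Ob C. \<forall>g\<in>Hom C W X. \<forall>h\<in>Hom C W X. f \<odot>\<^bsub>C\<^esub> g = f \<odot>\<^bsub>C\<^esub> h \<longrightarrow> g = h)"

definition is_regular_epi :: "('o, 'm) cat \<Rightarrow> 'o \<Rightarrow> 'o \<Rightarrow> 'm \<Rightarrow> bool" where
  "is_regular_epi C Y Q q \<longleftrightarrow> (\<exists>X f g. is_coequaliser C X Y f g Q q)"

text \<open>Chosen terminal object and binary products.  They are meaningful only if the category has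
  the limits in question; all notions below are independent of the choice.\<close>

definition terminal_obj :: "('o, 'm) cat \<Rightarrow> 'o" where
  "terminal_obj C = (SOME T. is_terminal C T)"

definition to_terminal :: "('o, 'm) cat \<Rightarrow> 'o \<Rightarrow> 'm" where
  "to_terminal C X = (THE f. f \<in> Hom C X (terminal_obj C))"

definition prod_cone :: "('o, 'm) cat \<Rightarrow> 'o \<Rightarrow> 'o \<Rightarrow> 'o \<times> 'm \<times> 'm" where
  "prod_cone C A B = (SOME (P, p, q). is_product C A B P p q)"

definition prod_obj :: "('o, 'm) cat \<Rightarrow> 'o \<Rightarrow> 'o \<Rightarrow> 'o" where
  "prod_obj C A B = fst (prod_cone C A B)"

definition proj1 :: "('o, 'm) cat \<Rightarrow> 'o \<Rightarrow> 'o \<Rightarrow> 'm" where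
  "proj1 C A B = fst (snd (prod_cone C A B))"

definition proj2 :: "('o, 'm) cat \<Rightarrow> 'o \<Rightarrow> 'o \<Rightarrow> 'm" where
  "proj2 C A B = snd (snd (prod_cone C A B))"

text \<open>\<open>pairing C X A B f g\<close> is the arrow \<open>X \<rightarrow> A \<times> B\<close> with components \<open>f\<close> and \<open>g\<close>.\<close>

definition pairing :: "('o, 'm) cat \<Rightarrow> 'o \<Rightarrow> 'o \<Rightarrow> 'o \<Rightarrow> 'm \<Rightarrow> 'm \<Rightarrow> 'm" where
  "pairing C X A B f g = (THE h. h \<in> Hom C X (prod_obj C A B) \<and>
     proj1 C A B \<odot>\<^bsub>C\<^esub> h = f \<and> proj2 C A B \<odot>\<^bsub>C\<^esub> h = g)"

text \<open>\<open>times_map C A X Y f\<close> is \<open>A \<times> f : A \<times> X \<rightarrow> A \<times> Y\<close> for \<open>f : X \<rightarrow> Y\<close>.\<close>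

definition times_map :: "('o, 'm) cat \<Rightarrow> 'o \<Rightarrow> 'o \<Rightarrow> 'o \<Rightarrow> 'm \<Rightarrow> 'm" where
  "times_map C A X Y f =
     pairing C (prod_obj C A X) A Y (proj1 C A X) (f \<odot>\<^bsub>C\<^esub> proj2 C A X)"

definition products_preserve_coequalisers :: "('o, 'm) cat \<Rightarrow> bool" where
  "products_preserve_coequalisers C \<longleftrightarrow>
     (\<forall>A\<in>Ob C. \<forall>X Y f g Q q. is_coequaliser C X Y f g Q q \<longrightarrow>
        is_coequaliser C (prod_obj C A X) (prod_obj C A Y)
          (times_map C A X Y f) (times_map C A X Y g) (prod_obj C A Q) (times_map C A Y Q q))"

section \<open>Group objects and actions\<close>

record ('o, 'm) grp_obj =
  gcar :: 'o
  gmul :: 'm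
  gunit :: 'm
  ginv :: 'm

definition group_object :: "('o, 'm) cat \<Rightarrow> ('o, 'm) grp_obj \<Rightarrow> bool" where
  "group_object C G \<longleftrightarrow>
    (let K = gcar G; m = gmul G; e = gunit G; i = ginv G;
         KK = prod_obj C K K; KKK = prod_obj C KK K;
         a = proj1 C K K \<odot>\<^bsub>C\<^esub> proj1 C KK K;
         b = proj2 C K K \<odot>\<^bsub>C\<^esub> proj1 C KK K;
         c = proj2 C KK K;
         u = e \<odot>\<^bsub>C\<^esub> to_terminal C K
     in K \<in> Ob C \<and> m \<in> Hom C KK K \<and> e \<in> Hom C (terminal_obj C) K \<and> i \<in> Hom C K K \<and>
        m \<odot>\<^bsub>C\<^esub> pairing C KKK K K (m \<odot>\<^bsub>C\<^esub> pairing C KKK K K a b) c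
          = m \<odot>\<^bsub>C\<^esub> pairing C KKK K K a (m \<odot>\<^bsub>C\<^esub> pairing C KKK K K b c) \<and>
        m \<odot>\<^bsub>C\<^esub> pairing C K K K u (Id C K) = Id C K \<and>
        m \<odot>\<^bsub>C\<^esub> pairing C K K K (Id C K) u = Id C K \<and>
        m \<odot>\<^bsub>C\<^esub> pairing C K K K i (Id C K) = u \<and>
        m \<odot>\<^bsub>C\<^esub> pairing C K K K (Id C K) i = u)"

definition Grp :: "('o, 'm) cat \<Rightarrow> (('o, 'm) grp_obj, 'm) cat" where
  "Grp C = \<lparr>Ob = {G. group_object C G},
     Hom = (\<lambda>G H. let K = gcar G; L = gcar H; KK = prod_obj C K K in
       {f \<in> Hom C K L. f \<odot>\<^bsub>C\<^esub> gmul G =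
          gmul H \<odot>\<^bsub>C\<^esub> pairing C KK L L (f \<odot>\<^bsub>C\<^esub> proj1 C K K) (f \<odot>\<^bsub>C\<^esub> proj2 C K K)}),
     Id = (\<lambda>G. Id C (gcar G)),
     Comp = Comp C\<rparr>"

definition is_action :: "('o, 'm) cat \<Rightarrow> ('o, 'm) grp_obj \<Rightarrow> 'o \<Rightarrow> 'm \<Rightarrow> bool" where
  "is_action C H Y act \<longleftrightarrow>
    (let K = gcar H; KK = prod_obj C K K; KKY = prod_obj C KK Y;
         a = proj1 C K K \<odot>\<^bsub>C\<^esub> proj1 C KK Y;
         b = proj2 C K K \<odot>\<^bsub>C\<^esub> proj1 C KK Y;
         y = proj2 C KK Y
     in Y \<in> Ob C \<and> act \<in> Hom C (prod_obj C K Y) Y \<and>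
        act \<odot>\<^bsub>C\<^esub> pairing C Y K Y (gunit H \<odot>\<^bsub>C\<^esub> to_terminal C Y) (Id C Y) = Id C Y \<and>
        act \<odot>\<^bsub>C\<^esub> pairing C KKY K Y (gmul H \<odot>\<^bsub>C\<^esub> pairing C KKY K K a b) y
          = act \<odot>\<^bsub>C\<^esub> pairing C KKY K Y a (act \<odot>\<^bsub>C\<^esub> pairing C KKY K Y b y))"

section \<open>Action Barr-exactness\<close>

definition regular_category :: "('o, 'm) cat \<Rightarrow> bool" where
  "regular_category C \<longleftrightarrow> category C \<and>
     (\<exists>T. is_terminal C T) \<and>
     (\<forall>A\<in>Ob C. \<forall>B\<in>Ob C. \<forall>Z\<in>Ob C. \<forall>f\<in>Hom C A Z. \<forall>g\<in>Hom C B Z.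
        \<exists>P p q. is_pullback C A B Z f g P p q) \<and>
     (\<forall>X Y f R r s. is_pullback C X X Y f f R r s \<longrightarrow> (\<exists>Q q. is_coequaliser C R X r s Q q)) \<and>
     (\<forall>A B Z f g P p q. is_regular_epi C A Z f \<and> is_pullback C A B Z f g P p q
        \<longrightarrow> is_regular_epi C P B q)"

text \<open>\<open>r, s : R \<rightarrow> Y\<close> are the two legs of a congruence on \<open>Y\<close>.\<close>

definition effective :: "('o, 'm) cat \<Rightarrow> 'o \<Rightarrow> 'o \<Rightarrow> 'm \<Rightarrow> 'm \<Rightarrow> bool" where
  "effective C R Y r s \<longleftrightarrow>
     (\<exists>Q q. is_coequaliser C R Y r s Q q \<and> is_pullback C Y Y Q q q R r s)"

definition action_Barr_exact :: "('o, 'm) cat \<Rightarrow> bool" where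
  "action_Barr_exact C \<longleftrightarrow> regular_category C \<and>
     (\<forall>H Y act R e j.
        group_object C H \<and> is_action C H Y act \<and>
        is_regular_epi C (prod_obj C (gcar H) Y) R e \<and> is_mono C R (prod_obj C Y Y) j \<and>
        j \<odot>\<^bsub>C\<^esub> e = pairing C (prod_obj C (gcar H) Y) Y Y act (proj2 C (gcar H) Y)
        \<longrightarrow> effective C R Y (proj1 C Y Y \<odot>\<^bsub>C\<^esub> j) (proj2 C Y Y \<odot>\<^bsub>C\<^esub> j))"

definition locally_action_Barr_exact :: "('o, 'm) cat \<Rightarrow> bool" where
  "locally_action_Barr_exact C \<longleftrightarrow> (\<forall>B\<in>Ob C. action_Barr_exact (slice_cat C B))"

section \<open>Adjunctions\<close>

record ('o, 'm, 'p, 'n) ftor =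
  FOb :: "'o \<Rightarrow> 'p"
  FHom :: "'o \<Rightarrow> 'o \<Rightarrow> 'm \<Rightarrow> 'n"

definition is_ftor :: "('o, 'm) cat \<Rightarrow> ('p, 'n) cat \<Rightarrow> ('o, 'm, 'p, 'n) ftor \<Rightarrow> bool" where
  "is_ftor C D F \<longleftrightarrow>
     (\<forall>X\<in>Ob C. FOb F X \<in> Ob D) \<and>
     (\<forall>X\<in>Ob C. \<forall>Y\<in>Ob C. \<forall>f\<in>Hom C X Y. FHom F X Y f \<in> Hom D (FOb F X) (FOb F Y)) \<and>
     (\<forall>X\<in>Ob C. FHom F X X (Id C X) = Id D (FOb F X)) \<and>
     (\<forall>X\<in>Ob C. \<forall>Y\<in>Ob C. \<forall>Z\<in>Ob C. \<forall>f\<in>Hom C X Y. \<forall>g\<in>Hom C Y Z.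
        FHom F X Z (g \<odot>\<^bsub>C\<^esub> f) = FHom F Y Z g \<odot>\<^bsub>D\<^esub> FHom F X Y f)"

text \<open>\<open>L : D \<rightarrow> C\<close> is left adjoint to \<open>R : C \<rightarrow> D\<close> with unit \<open>\<eta>\<close>.\<close>

definition is_left_adjoint ::
  "('o, 'm) cat \<Rightarrow> ('p, 'n) cat \<Rightarrow> ('p, 'n, 'o, 'm) ftor \<Rightarrow> ('o, 'm, 'p, 'n) ftor
     \<Rightarrow> ('p \<Rightarrow> 'n) \<Rightarrow> bool" where
  "is_left_adjoint C D L R \<eta> \<longleftrightarrow>
     is_ftor D C L \<and> is_ftor C D R \<and>
     (\<forall>X\<in>Ob D. \<eta> X \<in> Hom D X (FOb R (FOb L X))) \<and>
     (\<forall>X\<in>Ob D. \<forall>Y\<in>Ob D. \<forall>f\<in>Hom D X Y.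
        FHom R (FOb L X) (FOb L Y) (FHom L X Y f) \<odot>\<^bsub>D\<^esub> \<eta> X = \<eta> Y \<odot>\<^bsub>D\<^esub> f) \<and>
     (\<forall>X\<in>Ob D. \<forall>K\<in>Ob C.
        bij_betw (\<lambda>f. FHom R (FOb L X) K f \<odot>\<^bsub>D\<^esub> \<eta> X)
          (Hom C (FOb L X) K) (Hom D X (FOb R K)))"

section \<open>Bass--Serre categories\<close>

text \<open>The group object \<open>K \<times> B\<close> over \<open>B\<close>, with the structure of \<open>K\<close> in each fibre.  Objects of
  the slice \<open>S\<close> are pairs, hence the \<open>fst\<close> and \<open>snd\<close>.\<close>

definition const_grp :: "('o, 'm) cat \<Rightarrow> 'o \<Rightarrow> ('o, 'm) grp_obj \<Rightarrow> ('o \<times> 'm, 'm) grp_obj" where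
  "const_grp C B G =
    (let S = slice_cat C B; K = gcar G;
         p = proj1 C K B; q = proj2 C K B;
         E = (prod_obj C K B, q);
         EE = prod_obj S E E; T = terminal_obj S
     in \<lparr>gcar = E,
         gmul = pairing C (fst EE) K B
           (gmul G \<odot>\<^bsub>C\<^esub> pairing C (fst EE) K K (p \<odot>\<^bsub>C\<^esub> proj1 S E E) (p \<odot>\<^bsub>C\<^esub> proj2 S E E))
           (snd EE),
         gunit = pairing C (fst T) K B (gunit G \<odot>\<^bsub>C\<^esub> to_terminal C (fst T)) (snd T),
         ginv = pairing C (fst E) K B (ginv G \<odot>\<^bsub>C\<^esub> p) q\<rparr>)"

definition const_grp_ftor ::
  "('o, 'm) cat \<Rightarrow> 'o \<Rightarrow> (('o, 'm) grp_obj, 'm, ('o \<times> 'm, 'm) grp_obj, 'm) ftor" where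
  "const_grp_ftor C B = \<lparr>FOb = const_grp C B,
     FHom = (\<lambda>G H f. pairing C (prod_obj C (gcar G) B) (gcar H) B
       (f \<odot>\<^bsub>C\<^esub> proj1 C (gcar G) B) (proj2 C (gcar G) B))\<rparr>"

text \<open>For an arrow \<open>k : X \<rightarrow> G\<close> to a group object: \<open>G\<close> is generated by \<open>k\<close>, i.e.
  \<open>G \<times> X \<rightrightarrows> G \<rightarrow> *\<close> is a coequaliser.\<close>

definition generated_by :: "('o, 'm) cat \<Rightarrow> ('o, 'm) grp_obj \<Rightarrow> 'o \<Rightarrow> 'm \<Rightarrow> bool" where
  "generated_by C G X k \<longleftrightarrow>
    (let K = gcar G; KX = prod_obj C K X in
     is_coequaliser C KX K
       (proj1 C K X)
       (gmul G \<odot>\<^bsub>C\<^esub> pairing C KX K K (proj1 C K X) (k \<odot>\<^bsub>C\<^esub> proj2 C K X))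
       (terminal_obj C) (to_terminal C K))"

definition Bass_Serre :: "('o, 'm) cat \<Rightarrow> bool" where
  "Bass_Serre C \<longleftrightarrow> category C \<and>
     locally_action_Barr_exact C \<and> (\<exists>T. is_terminal C T) \<and>
     has_coequalisers C \<and> products_preserve_coequalisers C \<and>
     has_coequalisers (Grp C) \<and>
     (\<forall>B\<in>Ob C. \<exists>L \<eta>.
        is_left_adjoint (Grp C) (Grp (slice_cat C B)) L (const_grp_ftor C B) \<eta> \<and>
        (\<forall>H\<in>Ob (Grp (slice_cat C B)).
           generated_by C (FOb L H) (fst (gcar H)) (proj1 C (gcar (FOb L H)) B \<odot>\<^bsub>C\<^esub> \<eta> H)))"

section \<open>Sets and profinite spaces\<close>

text \<open>HOL has no type of all sets, so ``set'' means ``element of a universe'' \<open>U\<close> of subsets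
  of some type: closed under passing to sets of at most the same cardinality, closed under power
  sets up to cardinality, and containing an infinite set.  Every Grothendieck universe with an
  infinite element is of this form, the underlying type being the universe itself, and so are
  the sets of cardinality less than an uncountable strong limit cardinal.\<close>

definition set_universe :: "'u set set \<Rightarrow> bool" where
  "set_universe U \<longleftrightarrow>
     (\<exists>A\<in>U. infinite A) \<and>
     (\<forall>A\<in>U. \<forall>B. B \<lesssim> A \<longrightarrow> B \<in> U) \<and>
     (\<forall>A\<in>U. \<exists>B\<in>U. Pow A \<lesssim> B)"

text \<open>A function \<open>A \<rightarrow> B\<close> is represented by the partial function with domain exactly \<open>A\<close>, so
  that functions are determined by their values on \<open>A\<close> and compose by map composition.\<close>

definition Set_cat :: "'u set set \<Rightarrow> ('u set, 'u \<rightharpoonup> 'u) cat" where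
  "Set_cat U = \<lparr>Ob = U,
     Hom = (\<lambda>A B. {f. dom f = A \<and> ran f \<subseteq> B}),
     Id = (\<lambda>A. Some |` A),
     Comp = (\<circ>\<^sub>m)\<rparr>"

definition profinite_space :: "'u topology \<Rightarrow> bool" where
  "profinite_space X \<longleftrightarrow> compact_space X \<and> Hausdorff_space X \<and>
     (\<forall>x\<in>topspace X. connected_component_of_set X x = {x})"

definition Pro_cat :: "'u set set \<Rightarrow> ('u topology, 'u \<rightharpoonup> 'u) cat" where
  "Pro_cat U = \<lparr>Ob = {X. topspace X \<in> U \<and> profinite_space X},
     Hom = (\<lambda>X Y. {f. dom f = topspace X \<and> continuous_map X Y (\<lambda>x. the (f x))}),
     Id = (\<lambda>X. Some |` topspace X),
     Comp = (\<circ>\<^sub>m)\<rparr>"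

end

theory Submission
  imports Defs
begin

text \<open>Discrete spaces and profinite spaces have the following in common: clopen sets separate points,
  continuous surjections are quotient maps, and a quotient is again of the same kind as soon as
  saturated clopen sets separate its classes.  Hence in both categories, and in their slices, regular
  epimorphisms are surjections and the coequaliser of \<open>f\<close> and \<open>g\<close> identifies the points that are
  not separated by any clopen \<open>V\<close> with \<open>f\<^sup>-\<^sup>1 V = g\<^sup>-\<^sup>1 V\<close>.

  For action Barr-exactness over a profinite base, the orbit space is compact Hausdorff, its connected
  components lie in fibres over the base, and in a fibre orbits are separated because the saturation
  of a clopen set under a group of homeomorphisms is clopen.

  Coequalisers of groups and internal coproducts are instances of one construction, the universal
  group on a space \<open>X\<close> subject to relations \<open>x y = z\<close>.  A group in which \<open>X\<close> generates a dense
  subgroup \<open>D\<close> has at most as many points as \<open>Pow (Pow D)\<close>, so the closed subgroup generated by \<open>X\<close> in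
  a small product of such groups is universal.  Density of \<open>D\<close> also gives the generation condition,
  since a map on the group that is invariant under \<open>X\<close> is constant on \<open>D\<close>.\<close>

section \<open>Discrete and profinite spaces\<close>

text \<open>A quotient of a profinite space by a closed equivalence relation need not be totally
  disconnected (the Cantor set maps onto an interval), so congruences on profinite spaces are not
  effective in general and exactness has to use the action. Over a base the acting object is a
  family of groups, one element acts on one fibre only, and it need not extend to a continuous
  choice of elements over nearby base points. The saturation of a clopen set is therefore controlled
  inside a fibre and not globally, which is why components have to be confined to fibres. For the
  same reason coequalisers are not taken modulo the generated equivalence relation: clopen sets are
  the maps to a two-point space, and those that equalise the two given maps cut out the largest
  quotient that is still profinite. For the universal group the obstacle is size: the groups of the
  universe receiving a map from the space need not form a small family, and a cardinality bound on
  densely generated groups leaves a small family of representatives. Relations of the shape x y = z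
  are enough, since they express multiplicativity on prescribed pairs and, with a unit as factor,
  equality of two elements.\<close>

definition clopenin :: "'a topology \<Rightarrow> 'a set \<Rightarrow> bool" where
  "clopenin X V \<longleftrightarrow> closedin X V \<and> openin X V"

text \<open>Phrased with clopen sets instead of components because a clopen set can be pulled back
  along a continuous map and, when saturated, pushed down to a quotient.\<close>

definition clopen_separated :: "'a topology \<Rightarrow> bool" where
  "clopen_separated X \<longleftrightarrow>
     (\<forall>x\<in>topspace X. \<forall>y\<in>topspace X. x \<noteq> y \<longrightarrow> (\<exists>V. clopenin X V \<and> x \<in> V \<and> y \<notin> V))"

text \<open>The half of \<open>tame\<close> without separation, which is all that is asked of the
  source of a quotient map; separation becomes a condition on the target.\<close>

definition pretame :: "bool \<Rightarrow> 'a topology \<Rightarrow> bool" where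
  "pretame d X \<longleftrightarrow> (if d then \<forall>S\<subseteq>topspace X. openin X S else compact_space X)"

text \<open>The flag \<open>d\<close> selects between sets (discrete spaces) and profinite spaces, so that the two
  categories can be treated by the same arguments.\<close>

definition tame :: "bool \<Rightarrow> 'a topology \<Rightarrow> bool" where
  "tame d X \<longleftrightarrow> pretame d X \<and> clopen_separated X"

lemma clopenin_Compl: "clopenin X V \<Longrightarrow> clopenin X (topspace X - V)"
  by (auto simp: clopenin_def closedin_diff openin_diff)

lemma clopenin_preimage:
  "continuous_map X Y f \<Longrightarrow> clopenin Y V \<Longrightarrow> clopenin X {x \<in> topspace X. f x \<in> V}"
  by (auto simp: clopenin_def intro: openin_continuous_map_preimage closedin_continuous_map_preimage)

lemma clopenin_discrete: "V \<subseteq> S \<Longrightarrow> clopenin (discrete_topology S) V"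
  by (simp add: clopenin_def)

lemma clopen_separated_Hausdorff: "clopen_separated X \<Longrightarrow> Hausdorff_space X"
  unfolding Hausdorff_space_def clopen_separated_def
  by (metis DiffD2 DiffI clopenin_Compl clopenin_def disjnt_iff)

lemma clopen_separated_discrete: "clopen_separated (discrete_topology S)"
  unfolding clopen_separated_def by (auto intro!: exI[of _ "{_}"] clopenin_discrete)

lemma tame_discrete: "tame True X \<longleftrightarrow> X = discrete_topology (topspace X)"
proof
  assume "tame True X"
  then have "\<forall>S\<subseteq>topspace X. openin X S" by (simp add: tame_def pretame_def)
  then show "X = discrete_topology (topspace X)"
    by (intro discrete_topology_unique[THEN iffD2, symmetric]) auto
next
  assume X: "X = discrete_topology (topspace X)"
  have "tame True (discrete_topology (topspace X))"
    by (simp add: tame_def pretame_def clopen_separated_discrete)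
  then show "tame True X" by (subst X)
qed

text \<open>In a compact Hausdorff space quasi-components and components coincide, and a
  quasi-component consists of the points that no clopen set separates from a given one.\<close>

lemma clopen_separated_profinite:
  assumes "compact_space X" "Hausdorff_space X"
  shows "clopen_separated X \<longleftrightarrow> (\<forall>x\<in>topspace X. connected_component_of_set X x = {x})"
proof -
  have "quasi_component_of X x = connected_component_of X x" for x
    by (rule quasi_eq_connected_component_of) (use assms in auto)
  then have "(\<forall>x\<in>topspace X. connected_component_of_set X x = {x}) \<longleftrightarrow>
      (\<forall>x\<in>topspace X. \<forall>y. quasi_component_of X x y \<longleftrightarrow> y = x)"
    by (auto simp: set_eq_iff)
  also have "\<dots> \<longleftrightarrow> clopen_separated X"
  proof -
    have "quasi_component_of X x y \<longleftrightarrow> x \<in> topspace X \<and> y \<in> topspace X \<and>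
        \<not> (\<exists>V. clopenin X V \<and> x \<in> V \<and> y \<notin> V)" for x y
      unfolding quasi_component_of clopenin_def by blast
    then show ?thesis unfolding clopen_separated_def by metis
  qed
  finally show ?thesis by simp
qed

lemma tame_profinite: "tame False X \<longleftrightarrow> profinite_space X"
  unfolding tame_def pretame_def profinite_space_def
  using clopen_separated_Hausdorff clopen_separated_profinite by auto

lemma tame_Hausdorff: "tame d X \<Longrightarrow> Hausdorff_space X"
  by (simp add: tame_def clopen_separated_Hausdorff)

lemma tame_discrete_continuous:
  "tame True X \<Longrightarrow> f ` topspace X \<subseteq> topspace Y \<Longrightarrow> continuous_map X Y f"
  by (auto simp: tame_def pretame_def continuous_map_def)

lemma tame_discrete_clopenin: "tame True X \<Longrightarrow> S \<subseteq> topspace X \<Longrightarrow> clopenin X S"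
  by (auto simp: tame_def pretame_def clopenin_def closedin_def)

text \<open>Compactness passes to every continuous image, but a continuous image of a discrete space
  need not be discrete; hence the quotient hypothesis in the case \<open>d\<close>.\<close>

lemma tame_image:
  assumes "pretame d X" "continuous_map X Y f" "f ` topspace X = topspace Y"
    "clopen_separated Y" "d \<Longrightarrow> quotient_map X Y f"
  shows "tame d Y"
proof (cases d)
  case True
  then have "openin Y S" if "S \<subseteq> topspace Y" for S
    using that assms(1,5) unfolding quotient_map_def pretame_def
    by (metis (no_types, lifting) mem_Collect_eq subsetI)
  then show ?thesis using True assms by (auto simp: tame_def pretame_def)
next
  case False
  then show ?thesis using assms unfolding tame_def pretame_def
    by (metis compact_space_def image_compactin)
qed

text \<open>A continuous map from a compact to a Hausdorff space is closed, and between discrete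
  spaces every surjection is a quotient map. Maps constant on the fibres of a surjection therefore
  descend to continuous maps, so factorisations only have to be found on points.\<close>

lemma pretame_surj_quotient:
  assumes "pretame d X" "tame d Y" "continuous_map X Y f" "f ` topspace X = topspace Y"
  shows "quotient_map X Y f"
proof (cases d)
  case True
  then have "openin X S \<longleftrightarrow> S \<subseteq> topspace X" "openin Y S' \<longleftrightarrow> S' \<subseteq> topspace Y" for S S'
    using assms by (auto simp: pretame_def tame_def dest: openin_subset)
  then show ?thesis using assms by (auto simp: quotient_map_def)
next
  case False
  then show ?thesis using assms continuous_imp_quotient_map tame_Hausdorff
    by (metis pretame_def)
qed

lemma tame_bij_homeomorphic:
  assumes "pretame d X" "tame d Y" "continuous_map X Y f" "bij_betw f (topspace X) (topspace Y)"
  shows "homeomorphic_map X Y f"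
  using pretame_surj_quotient[OF assms(1-3)] assms(4) injective_quotient_map[of f X Y]
  by (simp add: bij_betw_def bijective_open_imp_homeomorphic_map)

lemma clopen_separate_preimage:
  assumes "continuous_map X Y f" "clopen_separated Y" "x \<in> topspace X" "y \<in> topspace X" "f x \<noteq> f y"
  shows "\<exists>V. clopenin X V \<and> x \<in> V \<and> y \<notin> V"
proof -
  have "f x \<in> topspace Y" "f y \<in> topspace Y"
    using assms by (auto simp: continuous_map_def)
  then obtain V where V: "clopenin Y V" "f x \<in> V" "f y \<notin> V"
    using assms unfolding clopen_separated_def by blast
  show ?thesis
    by (rule exI[of _ "{x \<in> topspace X. f x \<in> V}"])
      (use V assms clopenin_preimage[OF assms(1) V(1)] in simp)
qed

lemma clopen_separated_inj:
  assumes "continuous_map X Y f" "inj_on f (topspace X)" "clopen_separated Y"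
  shows "clopen_separated X"
  unfolding clopen_separated_def
  using clopen_separate_preimage[OF assms(1,3)] inj_onD[OF assms(2)] by metis

lemma tame_closed_subtopology:
  assumes "tame d X" "closedin X S"
  shows "tame d (subtopology X S)"
proof -
  have "clopen_separated (subtopology X S)"
  proof (rule clopen_separated_inj[where Y=X and f="\<lambda>x. x"])
    show "continuous_map (subtopology X S) X (\<lambda>x. x)"
      using continuous_map_from_subtopology[OF continuous_map_id[of X]] by (simp add: id_def)
    show "clopen_separated X" using assms by (simp add: tame_def)
  qed (simp add: inj_on_def)
  moreover have "pretame d (subtopology X S)"
  proof (cases d)
    case True
    then have "openin (subtopology X S) T" if "T \<subseteq> topspace X \<inter> S" for T
      using assms that unfolding tame_def pretame_def by (metis inf.absorb_iff1 le_infE openin_subtopology)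
    then show ?thesis using True by (simp add: pretame_def)
  next
    case False
    then show ?thesis using assms unfolding tame_def pretame_def
      by (simp add: closedin_compact_space compact_space_subtopology)
  qed
  ultimately show ?thesis by (simp add: tame_def)
qed

lemma tame_prod:
  assumes "tame d X" "tame d Y"
  shows "tame d (prod_topology X Y)"
proof -
  have "clopen_separated (prod_topology X Y)"
    unfolding clopen_separated_def
  proof (intro ballI impI)
    fix x y assume x: "x \<in> topspace (prod_topology X Y)" and y: "y \<in> topspace (prod_topology X Y)"
      and "x \<noteq> y"
    then consider "fst x \<noteq> fst y" "fst x \<in> topspace X" "fst y \<in> topspace X"
      | "snd x \<noteq> snd y" "snd x \<in> topspace Y" "snd y \<in> topspace Y"
      by (metis mem_Times_iff prod_eqI topspace_prod_topology)
    then show "\<exists>V. clopenin (prod_topology X Y) V \<and> x \<in> V \<and> y \<notin> V"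
    proof cases
      case 1
      then show ?thesis
        using clopen_separate_preimage[OF continuous_map_fst _ x y] assms by (auto simp: tame_def)
    next
      case 2
      then show ?thesis
        using clopen_separate_preimage[OF continuous_map_snd _ x y] assms by (auto simp: tame_def)
    qed
  qed
  moreover have "pretame d (prod_topology X Y)"
  proof (cases d)
    case True
    have "openin (prod_topology X Y) T" if T: "T \<subseteq> topspace X \<times> topspace Y" for T
      unfolding openin_prod_topology_alt
    proof (intro allI impI)
      fix x y assume "(x, y) \<in> T"
      then have "openin X {x}" "openin Y {y}" "{x} \<times> {y} \<subseteq> T"
        using T assms True by (auto simp: tame_def pretame_def)
      then show "\<exists>U V. openin X U \<and> openin Y V \<and> x \<in> U \<and> y \<in> V \<and> U \<times> V \<subseteq> T" by blast
    qed
    then show ?thesis using True by (simp add: pretame_def)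
  next
    case False
    then show ?thesis using assms unfolding tame_def pretame_def
      by (simp add: compact_space_prod_topology)
  qed
  ultimately show ?thesis by (simp add: tame_def)
qed

section \<open>Quotient topologies and transport along injections\<close>

lemma ex_quotient_topology:
  obtains Z where "topspace Z = q ` topspace Y" "quotient_map Y Z q"
proof -
  let ?P = "\<lambda>S. S \<subseteq> q ` topspace Y \<and> openin Y {y \<in> topspace Y. q y \<in> S}"
  have ist: "istopology ?P"
    unfolding istopology_def
  proof (intro conjI allI impI)
    fix S T assume "?P S" "?P T"
    moreover have "{y \<in> topspace Y. q y \<in> S \<inter> T} =
        {y \<in> topspace Y. q y \<in> S} \<inter> {y \<in> topspace Y. q y \<in> T}" by auto
    ultimately show "S \<inter> T \<subseteq> q ` topspace Y" "openin Y {y \<in> topspace Y. q y \<in> S \<inter> T}"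
      by (auto simp: openin_Int)
  next
    fix K assume K: "\<forall>S\<in>K. ?P S"
    moreover have "{y \<in> topspace Y. q y \<in> \<Union>K} = (\<Union>S\<in>K. {y \<in> topspace Y. q y \<in> S})" by auto
    ultimately show "\<Union>K \<subseteq> q ` topspace Y" "openin Y {y \<in> topspace Y. q y \<in> \<Union>K}"
      by (auto intro!: openin_Union)
  qed
  let ?Z = "topology ?P"
  have op: "openin ?Z = ?P" by (rule topology_inverse'[OF ist])
  have "{y \<in> topspace Y. q y \<in> q ` topspace Y} = topspace Y" by auto
  then have ts: "topspace ?Z = q ` topspace Y"
    unfolding topspace_def[of ?Z] op by auto
  show ?thesis
    by (rule that[OF ts]) (simp add: quotient_map_def ts op)
qed

text \<open>Spaces built on pairs or on functions become objects of the categories only after being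
  copied along an injection into the point type of the universe.\<close>

lemma tame_transport:
  assumes "tame d X" "inj_on f (topspace X)"
  obtains Z where "topspace Z = f ` topspace X" "homeomorphic_map X Z f" "tame d Z"
proof -
  obtain Z where Z: "topspace Z = f ` topspace X" "quotient_map X Z f"
    using ex_quotient_topology by blast
  then have h: "homeomorphic_map X Z f"
    using injective_quotient_map[OF assms(2), of Z] assms(2)
    by (simp add: bijective_open_imp_homeomorphic_map)
  then obtain g where g: "homeomorphic_maps X Z f g"
    by (meson homeomorphic_map_maps)
  have "clopen_separated Z"
  proof (rule clopen_separated_inj)
    show "continuous_map Z X g" "inj_on g (topspace Z)" "clopen_separated X"
      using g assms by (auto simp: homeomorphic_maps_def tame_def intro: inj_on_inverseI[of _ f])
  qed
  then have "tame d Z"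
    using Z assms by (intro tame_image[of d X Z f])
      (auto simp: tame_def quotient_imp_continuous_map)
  with Z h show ?thesis using that by blast
qed

text \<open>A clopen set is a continuous map to a two-point space, and \<open>P\<close> selects the
  admissible ones, such as those equalising two given maps or those invariant under an
  action.\<close>

definition clopen_sep_by :: "'a topology \<Rightarrow> ('a set \<Rightarrow> bool) \<Rightarrow> 'a \<Rightarrow> 'a \<Rightarrow> bool" where
  "clopen_sep_by Y P y y' \<longleftrightarrow> (\<exists>V. clopenin Y V \<and> P V \<and> (y \<in> V) \<noteq> (y' \<in> V))"

text \<open>Not being separated is an equivalence relation whatever \<open>P\<close> is, and every
  admissible clopen set is saturated for it. These sets therefore descend to clopen sets, and by
  construction they separate the points of the quotient.\<close>

lemma tame_quotient:
  assumes Y: "tame d Y"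
  obtains Z q where "topspace Z \<subseteq> topspace Y" "tame d Z" "quotient_map Y Z q"
    "\<And>y y'. y \<in> topspace Y \<Longrightarrow> y' \<in> topspace Y \<Longrightarrow> q y = q y' \<longleftrightarrow> \<not> clopen_sep_by Y P y y'"
proof -
  define R where "R y = {y' \<in> topspace Y. \<not> clopen_sep_by Y P y y'}" for y
  \<comment> \<open>Classes are represented by chosen points of \<open>Y\<close>, so the quotient
    stays in the same type and on a subset of \<open>topspace Y\<close>, which later makes it
    small.\<close>
  define q where "q y = (SOME y'. y' \<in> R y)" for y
  have Rself: "y \<in> R y" if "y \<in> topspace Y" for y
    using that by (simp add: R_def clopen_sep_by_def)
  have qR: "q y \<in> R y" if "y \<in> topspace Y" for y
    unfolding q_def using Rself[OF that] by (rule someI)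
  have Req: "R y = R y'" if "\<not> clopen_sep_by Y P y y'" for y y'
    using that unfolding R_def clopen_sep_by_def by blast
  have q_iff: "q y = q y' \<longleftrightarrow> \<not> clopen_sep_by Y P y y'" if y: "y \<in> topspace Y" "y' \<in> topspace Y" for y y'
  proof
    assume "q y = q y'"
    then have "\<not> clopen_sep_by Y P y (q y)" "\<not> clopen_sep_by Y P y' (q y)"
      using qR[OF y(1)] qR[OF y(2)] by (auto simp: R_def)
    then show "\<not> clopen_sep_by Y P y y'" unfolding clopen_sep_by_def by blast
  next
    assume "\<not> clopen_sep_by Y P y y'"
    then show "q y = q y'" using Req by (simp add: q_def)
  qed
  obtain Z where Z: "topspace Z = q ` topspace Y" "quotient_map Y Z q"
    using ex_quotient_topology by blast
  have "clopen_separated Z"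
    unfolding clopen_separated_def
  proof (intro ballI impI)
    fix z z' assume "z \<in> topspace Z" "z' \<in> topspace Z" "z \<noteq> z'"
    then obtain y y' where y: "y \<in> topspace Y" "y' \<in> topspace Y" "z = q y" "z' = q y'"
      using Z by blast
    then obtain V where V: "clopenin Y V" "P V" "(y \<in> V) \<noteq> (y' \<in> V)"
      using q_iff \<open>z \<noteq> z'\<close> by (metis clopen_sep_by_def)
    have sat: "w \<in> V \<longleftrightarrow> w' \<in> V" if "w \<in> topspace Y" "w' \<in> topspace Y" "q w = q w'" for w w'
      using q_iff[OF that(1,2)] that(3) V(1,2) by (auto simp: clopen_sep_by_def)
    have VY: "V \<subseteq> topspace Y" using V(1) by (simp add: clopenin_def closedin_subset)
    have pre: "{w \<in> topspace Y. q w \<in> q ` V} = V"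
      using sat VY by blast
    have qV: "q ` V \<subseteq> topspace Z" using VY Z(1) by blast
    have "openin Z (q ` V) \<longleftrightarrow> openin Y {w \<in> topspace Y. q w \<in> q ` V}"
      using Z(2) qV by (simp add: quotient_map_def)
    moreover have "closedin Z (q ` V) \<longleftrightarrow> closedin Y {w \<in> topspace Y. q w \<in> q ` V}"
      using Z(2) qV by (simp add: quotient_map_closedin)
    ultimately have clo: "clopenin Z (q ` V)"
      using V(1) unfolding pre clopenin_def by blast
    have "w \<in> V \<longleftrightarrow> q w \<in> q ` V" if "w \<in> topspace Y" for w
    proof -
      have "w \<in> V \<longleftrightarrow> w \<in> {w \<in> topspace Y. q w \<in> q ` V}" by (simp only: pre)
      then show ?thesis using that by simp
    qed
    then have "(z \<in> q ` V) \<noteq> (z' \<in> q ` V)" using V(3) y by metis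
    with clo show "\<exists>V. clopenin Z V \<and> z \<in> V \<and> z' \<notin> V"
      using clopenin_Compl[of Z "q ` V"] \<open>z \<in> topspace Z\<close> by (cases "z \<in> q ` V") auto
  qed
  then have "tame d Z"
    using Z Y by (intro tame_image[of d Y Z q]) (auto simp: tame_def quotient_imp_continuous_map)
  moreover have "topspace Z \<subseteq> topspace Y"
    using Z qR by (auto simp: R_def)
  ultimately show ?thesis using that Z(2) q_iff by blast
qed

text \<open>Compactness: the clopen sets missing \<open>y\<close> cover \<open>S\<close>, and the
  complement of the union of a finite subcover is the set wanted. In the discrete case the
  complement of \<open>S\<close> itself will do.\<close>

lemma clopen_separate_closed:
  assumes "tame d Y" "closedin Y S" "y \<in> topspace Y" "y \<notin> S"
  obtains V where "clopenin Y V" "y \<in> V" "V \<inter> S = {}"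
proof (cases d)
  case True
  have "clopenin Y (topspace Y - S)"
    using assms True by (intro tame_discrete_clopenin) auto
  then show ?thesis using that assms by blast
next
  case False
  then have "compact_space Y" using assms by (auto simp: tame_def pretame_def)
  then have cS: "compactin Y S" using assms(2) closedin_compact_space by blast
  let ?U = "{V. clopenin Y V \<and> y \<notin> V}"
  have "S \<subseteq> \<Union>?U"
  proof
    fix s assume "s \<in> S"
    then have "s \<in> topspace Y" "s \<noteq> y" using assms closedin_subset by auto
    then show "s \<in> \<Union>?U"
      using assms unfolding tame_def clopen_separated_def by blast
  qed
  then obtain F where F: "finite F" "F \<subseteq> ?U" "S \<subseteq> \<Union>F"
    using compactinD[OF cS, of ?U] by (auto simp: clopenin_def)
  have "clopenin Y (\<Union>F)"
    using F(1,2) unfolding clopenin_def by (auto intro!: closedin_Union openin_Union)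
  then show ?thesis
    using F assms by (intro that[of "topspace Y - \<Union>F"] clopenin_Compl) auto
qed

lemma tame_closed_image:
  assumes "tame d X" "tame d Y" "continuous_map X Y f" "closedin X S"
  shows "closedin Y (f ` S)"
proof (cases d)
  case True
  moreover have "f ` S \<subseteq> topspace Y"
    using assms by (metis closedin_subset continuous_map_image_subset_topspace image_mono subset_trans)
  ultimately show ?thesis using assms tame_discrete_clopenin clopenin_def by metis
next
  case False
  then show ?thesis
    using assms continuous_imp_closed_map[of X Y f] tame_Hausdorff[OF assms(2)]
    by (auto simp: tame_def pretame_def closed_map_def)
qed

section \<open>Orbit relations\<close>

text \<open>The saturation of a closed set \<open>S\<close> is the projection of the relation
  intersected with \<open>topspace Y \<times> S\<close>, and projecting along a compact factor is a
  closed map. So \<open>q\<close> is closed, and a closed continuous image of a normal space is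
  Hausdorff once its points are closed.\<close>

lemma closed_equivalence_Hausdorff:
  assumes Y: "compact_space Y" "Hausdorff_space Y"
    and q: "quotient_map Y Z q"
    and cl: "closedin (prod_topology Y Y) {(x, y). x \<in> topspace Y \<and> y \<in> topspace Y \<and> q x = q y}"
      (is "closedin _ ?E")
  shows "Hausdorff_space Z" "closed_map Y Z q"
proof -
  show qc: "closed_map Y Z q"
    unfolding closed_map_def
  proof (intro allI impI)
    fix S assume S: "closedin Y S"
    have "closedin (prod_topology Y Y) (?E \<inter> (topspace Y \<times> S))"
      using cl S by (intro closedin_Int) (auto simp: closedin_prod_Times_iff)
    then have "closedin Y (fst ` (?E \<inter> (topspace Y \<times> S)))"
      using closed_map_fst[OF Y(1), of Y] by (auto simp: closed_map_def)
    also have "fst ` (?E \<inter> (topspace Y \<times> S)) = {y \<in> topspace Y. q y \<in> q ` S}"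
      using closedin_subset[OF S] by force
    finally show "closedin Z (q ` S)"
      using q closedin_subset[OF S] unfolding quotient_map_closedin by (metis image_mono)
  qed
  have "normal_space Y" using Y compact_Hausdorff_or_regular_imp_normal_space by blast
  moreover have "t1_space Z"
  proof (rule t1_space_closed_map_image)
    show "t1_space Y" using Y(2) Hausdorff_imp_t1_space by blast
  qed (use q qc in \<open>auto simp: quotient_map_def\<close>)
  ultimately show "Hausdorff_space Z"
    using Hausdorff_normal_space_closed_continuous_map_image qc q
    by (metis quotient_imp_continuous_map quotient_imp_surjective_map)
qed

text \<open>The pointwise content of a group object over \<open>B\<close> acting on
  \<open>Y\<close>: a pair \<open>(h, y)\<close> may act only over a common base point, and
  \<open>unit\<close>, \<open>mult\<close> and \<open>inv\<close> are the existence statements that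
  make \<open>orb\<close> an equivalence relation. The group structure enters through them alone, so
  \<open>H\<close> carries no operations here.\<close>

locale fibred_action =
  fixes d :: bool and B :: "'b topology" and H :: "'h topology" and Y :: "'y topology"
    and \<pi>H :: "'h \<Rightarrow> 'b" and \<pi>Y :: "'y \<Rightarrow> 'b" and act :: "'h \<Rightarrow> 'y \<Rightarrow> 'y"
    and D :: "('h \<times> 'y) set"
  assumes B: "tame d B" and H: "tame d H" and Y: "tame d Y"
    and cH: "continuous_map H B \<pi>H" and cY: "continuous_map Y B \<pi>Y"
    and D_def: "D = {(h, y). h \<in> topspace H \<and> y \<in> topspace Y \<and> \<pi>H h = \<pi>Y y}"
    and c_act: "continuous_map (subtopology (prod_topology H Y) D) Y (\<lambda>(h, y). act h y)"
    and fibre: "(h, y) \<in> D \<Longrightarrow> \<pi>Y (act h y) = \<pi>Y y"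
    and unit: "y \<in> topspace Y \<Longrightarrow> \<exists>h. (h, y) \<in> D \<and> act h y = y"
    and mult: "(h, y) \<in> D \<Longrightarrow> (h', y) \<in> D \<Longrightarrow> \<exists>h''. (h'', y) \<in> D \<and> act h'' y = act h (act h' y)"
    and inv: "(h, y) \<in> D \<Longrightarrow> \<exists>h'. (h', y) \<in> D \<and> act h' (act h y) = y"
begin

definition orb :: "'y \<Rightarrow> 'y \<Rightarrow> bool" where
  "orb y y' \<longleftrightarrow> (\<exists>h. (h, y) \<in> D \<and> y' = act h y)"

lemma D_closed: "closedin (prod_topology H Y) D"
proof -
  have "closedin (prod_topology H Y)
      {x \<in> topspace (prod_topology H Y). (\<pi>H \<circ> fst) x = (\<pi>Y \<circ> snd) x}"
    by (rule closedin_continuous_maps_eq[OF tame_Hausdorff[OF B]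
        continuous_map_compose[OF continuous_map_fst cH] continuous_map_compose[OF continuous_map_snd cY]])
  moreover have "{x \<in> topspace (prod_topology H Y). (\<pi>H \<circ> fst) x = (\<pi>Y \<circ> snd) x} = D"
    by (auto simp: D_def)
  ultimately show ?thesis by simp
qed

lemma D_sub: "D \<subseteq> topspace H \<times> topspace Y"
  by (auto simp: D_def)

lemma tame_D: "tame d (subtopology (prod_topology H Y) D)"
  by (rule tame_closed_subtopology[OF tame_prod[OF H Y] D_closed])

lemma topspace_D: "topspace (subtopology (prod_topology H Y) D) = D"
  using D_sub by (auto simp: topspace_subtopology)

lemma act_in: "(h, y) \<in> D \<Longrightarrow> act h y \<in> topspace Y"
  using continuous_map_image_subset_topspace[OF c_act] unfolding topspace_D by auto

lemma act_D: "(h, y) \<in> D \<Longrightarrow> (h', y) \<in> D \<Longrightarrow> (h', act h y) \<in> D"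
  using fibre[of h y] act_in[of h y] by (simp add: D_def)

lemma orb_refl: "y \<in> topspace Y \<Longrightarrow> orb y y"
  using unit[of y] unfolding orb_def by metis

lemma orb_in: "orb y y' \<Longrightarrow> y \<in> topspace Y \<and> y' \<in> topspace Y"
  using act_in D_sub by (auto simp: orb_def)

lemma orb_fibre: "orb y y' \<Longrightarrow> \<pi>Y y' = \<pi>Y y"
  using fibre by (auto simp: orb_def)

lemma orb_sym: "orb y y' \<Longrightarrow> orb y' y"
  unfolding orb_def using inv act_D by metis

lemma orb_trans: assumes "orb y y'" "orb y' y''" shows "orb y y''"
proof -
  obtain h where h: "(h, y) \<in> D" "y' = act h y" using assms by (auto simp: orb_def)
  obtain h' where h': "(h', y') \<in> D" "y'' = act h' y'" using assms by (auto simp: orb_def)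
  have "(h', y) \<in> D" using h h' fibre[OF h(1)] by (auto simp: D_def)
  from mult[OF this h(1)] show ?thesis using h h' unfolding orb_def by metis
qed

text \<open>The graph is the image of the closed set \<open>D\<close> under a continuous map of tame
  spaces, and such images are closed.\<close>

lemma orb_closed: "closedin (prod_topology Y Y) {(y, y'). orb y y'}"
proof -
  have "continuous_map (subtopology (prod_topology H Y) D) (prod_topology Y Y)
      (\<lambda>x. (snd x, (\<lambda>(h, y). act h y) x))"
    by (intro continuous_map_pairedI continuous_map_from_subtopology[OF continuous_map_snd] c_act)
  from tame_closed_image[OF tame_D tame_prod[OF Y Y] this, of D]
  have "closedin (prod_topology Y Y) ((\<lambda>x. (snd x, (\<lambda>(h, y). act h y) x)) ` D)"
    by (metis closedin_topspace topspace_D)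
  also have "(\<lambda>x. (snd x, (\<lambda>(h, y). act h y) x)) ` D = {(y, y'). orb y y'}"
    unfolding orb_def by force
  finally show ?thesis .
qed

lemma orbit_closed:
  assumes "y \<in> topspace Y"
  shows "closedin Y {y' \<in> topspace Y. orb y y'}"
proof -
  have "continuous_map Y (prod_topology Y Y) (\<lambda>y'. (y, y'))"
    using assms by (intro continuous_map_pairedI) auto
  from closedin_continuous_map_preimage[OF this orb_closed] show ?thesis by simp
qed

text \<open>The domain is a fibre because an element acts only over its own base point. This is the
  form in which the saturation argument uses the action.\<close>

lemma act_continuous:
  assumes "h \<in> topspace H"
  shows "continuous_map (subtopology Y {y \<in> topspace Y. \<pi>Y y = \<pi>H h}) Y (act h)"
proof -
  have "continuous_map (subtopology Y {y \<in> topspace Y. \<pi>Y y = \<pi>H h})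
      (subtopology (prod_topology H Y) D) (\<lambda>y. (h, y))"
    unfolding continuous_map_in_subtopology
    using assms by (auto simp: D_def intro!: continuous_map_pairedI)
  from continuous_map_compose[OF this c_act] show ?thesis by (simp add: comp_def)
qed

text \<open>A connected subset of the orbit space lies over a single point of the base, and there orbits
  are separated because the saturation of a clopen set is clopen.\<close>

lemma orbit_space_separated:
  assumes d: "\<not> d" and q: "quotient_map Y Z q"
    and q_iff: "\<And>y y'. y \<in> topspace Y \<Longrightarrow> y' \<in> topspace Y \<Longrightarrow> q y = q y' \<longleftrightarrow> orb y y'"
  shows "clopen_separated Z"
proof -
  have cpY: "compact_space Y" using Y d by (simp add: tame_def pretame_def)
  have surj: "q ` topspace Y = topspace Z" using q by (rule quotient_imp_surjective_map)
  have E: "{(x, y). x \<in> topspace Y \<and> y \<in> topspace Y \<and> q x = q y} = {(y, y'). orb y y'}"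
    using q_iff orb_in by auto
  have Z: "Hausdorff_space Z" "closed_map Y Z q"
    by (rule closed_equivalence_Hausdorff[OF cpY tame_Hausdorff[OF Y] q]; simp only: E orb_closed)+
  have cpZ: "compact_space Z"
    using cpY image_compactin[OF _ quotient_imp_continuous_map[OF q]] surj
    unfolding compact_space_def by metis
  \<comment> \<open>Orbits lie in fibres, so the projection to the base descends to the orbit
    space.\<close>
  obtain p where p: "continuous_map Z B p" "\<And>y. y \<in> topspace Y \<Longrightarrow> p (q y) = \<pi>Y y"
  proof (rule quotient_map_lift_exists[OF q cY])
    show "\<pi>Y x = \<pi>Y y" if "x \<in> topspace Y" "y \<in> topspace Y" "q x = q y" for x y
      using that q_iff orb_fibre by metis
  qed auto
  have "z' = z" if z: "z \<in> topspace Z" and C: "connected_component_of Z z z'" for z z'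
  proof (rule ccontr)
    assume "z' \<noteq> z"
    let ?C = "connected_component_of_set Z z"
    have conn: "connectedin Z ?C" by (rule connectedin_connected_component_of)
    have zC: "z \<in> ?C" "z' \<in> ?C" using z C by (auto simp: connected_component_of_refl)
    have CZ: "?C \<subseteq> topspace Z" by (rule connected_component_of_subset_topspace)
    \<comment> \<open>If \<open>p\<close> took two values on the component, a clopen set separating
      them in \<open>B\<close> would pull back to a clopen set splitting the component.\<close>
    have pC: "p w = p z" if w: "w \<in> ?C" for w
    proof (rule ccontr)
      assume "p w \<noteq> p z"
      then obtain V where V: "clopenin Z V" "w \<in> V" "z \<notin> V"
        using clopen_separate_preimage[OF p(1)] B CZ w z by (metis subsetD tame_def)
      have "closedin Z V" "closedin Z (topspace Z - V)"
        using V(1) clopenin_Compl[OF V(1)] by (auto simp: clopenin_def)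
      moreover have "?C \<subseteq> V \<union> (topspace Z - V)" using CZ by auto
      moreover have "V \<inter> ?C \<noteq> {}" "(topspace Z - V) \<inter> ?C \<noteq> {}" "V \<inter> (topspace Z - V) \<inter> ?C = {}"
        using V w zC z by auto
      ultimately show False using conn unfolding connectedin_closedin by metis
    qed
    obtain y y' where y: "y \<in> topspace Y" "z = q y" and y': "y' \<in> topspace Y" "z' = q y'"
      using z CZ zC(2) surj by (metis imageE subsetD)
    have norb: "\<not> orb y' y" using q_iff[OF y'(1) y(1)] y y' \<open>z' \<noteq> z\<close> by simp
    \<comment> \<open>A clopen neighbourhood of \<open>y\<close> off the closed orbit of
      \<open>y'\<close>; its saturation \<open>W\<close> inside the fibre \<open>F\<close> will
      contain \<open>y\<close> but not \<open>y'\<close>.\<close>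
    obtain V where V: "clopenin Y V" "y \<in> V" "V \<inter> {w \<in> topspace Y. orb y' w} = {}"
      by (rule clopen_separate_closed[OF Y orbit_closed[OF y'(1)] y(1)]) (use norb in simp)
    define F where "F = {w \<in> topspace Y. \<pi>Y w = \<pi>Y y}"
    have Fcl: "closedin Y F" unfolding F_def
      by (rule closedin_continuous_maps_eq[OF tame_Hausdorff[OF B] cY]) (use y cY in \<open>auto simp: continuous_map_def\<close>)
    have y'F: "y' \<in> F" using pC[OF zC(2)] y y' p(2) by (simp add: F_def)
    define W where "W = {w \<in> F. \<exists>v\<in>V. orb w v}"
    have V': "closedin Y V" "closedin Y (topspace Y - V)"
      using V(1) clopenin_Compl[OF V(1)] by (auto simp: clopenin_def)
    \<comment> \<open>\<open>W\<close> is a projection of the closed orbit relation cut down to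
      \<open>F \<times> V\<close>, so compactness makes it closed.\<close>
    have "closedin Y W"
    proof -
      have "closedin (prod_topology Y Y) ({(y, y'). orb y y'} \<inter> (F \<times> V))"
        using V'(1) Fcl by (intro closedin_Int orb_closed) (auto simp: closedin_prod_Times_iff)
      from tame_closed_image[OF tame_prod[OF Y Y] Y continuous_map_fst this]
      have "closedin Y (fst ` ({(y, y'). orb y y'} \<inter> (F \<times> V)))" .
      also have "fst ` ({(y, y'). orb y y'} \<inter> (F \<times> V)) = W" unfolding W_def by force
      finally show ?thesis .
    qed
    \<comment> \<open>A point of \<open>F\<close> lies outside \<open>W\<close> iff every element
      over the base point moves it into the complement of \<open>V\<close>. Each of these conditions
      is closed because \<open>V\<close> is open, and closed sets may be intersected over all
      elements at once.\<close>
    have "closedin Y (F - W)"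
    proof -
      let ?h = "\<lambda>h. {w \<in> topspace (subtopology Y F). act h w \<in> topspace Y - V}"
      let ?I = "{h \<in> topspace H. \<pi>H h = \<pi>Y y}"
      have "closedin Y (?h h)" if "h \<in> ?I" for h
      proof -
        have "continuous_map (subtopology Y F) Y (act h)"
          using act_continuous[of h] that by (simp add: F_def)
        from closedin_continuous_map_preimage[OF this V'(2)] show ?thesis
          by (rule closedin_trans_full[OF _ Fcl])
      qed
      moreover have "?I \<noteq> {}" using unit[OF y(1)] by (auto simp: D_def)
      ultimately have "closedin Y (\<Inter>h\<in>?I. ?h h)" by (intro closedin_Inter) auto
      also have "(\<Inter>h\<in>?I. ?h h) = F - W"
      proof (intro set_eqI)
        fix w
        have *: "(h, w) \<in> D \<longleftrightarrow> h \<in> ?I" if "w \<in> F" for h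
          using that by (auto simp: D_def F_def)
        show "w \<in> (\<Inter>h\<in>?I. ?h h) \<longleftrightarrow> w \<in> F - W"
        proof (cases "w \<in> F")
          case True
          then have wY: "w \<in> topspace Y" by (simp add: F_def)
          have "w \<in> W \<longleftrightarrow> (\<exists>h. (h, w) \<in> D \<and> act h w \<in> V)"
            using True unfolding W_def orb_def by auto
          then have "w \<in> W \<longleftrightarrow> (\<exists>h\<in>?I. act h w \<in> V)" using *[OF True] by auto
          moreover have "w \<in> (\<Inter>h\<in>?I. ?h h) \<longleftrightarrow> (\<forall>h\<in>?I. act h w \<notin> V)"
            using True wY act_in[of _ w] *[OF True] by (simp add: topspace_subtopology)
          ultimately show ?thesis using True by auto
        next
          case False
          then show ?thesis using \<open>?I \<noteq> {}\<close> by (auto simp: topspace_subtopology)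
        qed
      qed
      finally show ?thesis .
    qed
    \<comment> \<open>\<open>W\<close> is a union of orbits and the fibre contains everything above
      the component, so the two closed images are disjoint, cover the component and both meet it;
      this contradicts connectedness.\<close>
    then have "closedin Z (q ` W)" "closedin Z (q ` (F - W))"
      using Z(2) \<open>closedin Y W\<close> by (auto simp: closed_map_def)
    moreover have "?C \<subseteq> q ` W \<union> q ` (F - W)"
    proof
      fix w assume w: "w \<in> ?C"
      then obtain x where x: "x \<in> topspace Y" "w = q x" using CZ surj by (metis imageE subsetD)
      then have "x \<in> F" using pC[OF w] y p(2) by (simp add: F_def)
      then show "w \<in> q ` W \<union> q ` (F - W)" using x by blast
    qed
    moreover have "q ` W \<inter> q ` (F - W) = {}"
    proof -
      have False if "x \<in> W" "x' \<in> F - W" "q x = q x'" for x x'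
      proof -
        have "x \<in> topspace Y" "x' \<in> topspace Y" using that by (auto simp: W_def F_def)
        then have "orb x' x" using q_iff that(3) by metis
        then have "x' \<in> W" using that orb_trans unfolding W_def by blast
        then show False using that by simp
      qed
      then show ?thesis by blast
    qed
    moreover have "z \<in> q ` W"
      using y V(2) orb_refl[OF y(1)] by (auto simp: W_def F_def)
    moreover have "y' \<notin> W"
      using V(3) orb_in by (auto simp: W_def)
    then have "z' \<in> q ` (F - W)" using y' y'F by blast
    ultimately show False using conn zC unfolding connectedin_closedin by blast
  qed
  then show ?thesis
    unfolding clopen_separated_profinite[OF cpZ Z(1)] by (auto simp: connected_component_of_refl)
qed

text \<open>In a discrete space the orbit itself is an invariant clopen set; in the profinite case a
  clopen set of the orbit space is pulled back. Hence the quotient by invariant clopen sets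
  identifies points of one orbit only.\<close>

lemma orbit_separated:
  assumes y: "y \<in> topspace Y" "y' \<in> topspace Y" "\<not> orb y y'"
  shows "clopen_sep_by Y (\<lambda>V. \<forall>(h, y)\<in>D. act h y \<in> V \<longleftrightarrow> y \<in> V) y y'"
proof (cases d)
  case True
  let ?V = "{w \<in> topspace Y. orb y w}"
  have "clopenin Y ?V"
    using Y True by (intro tame_discrete_clopenin) auto
  moreover have "act h w \<in> ?V \<longleftrightarrow> w \<in> ?V" if "(h, w) \<in> D" for h w
  proof -
    have "orb w (act h w)" using that by (auto simp: orb_def)
    then show ?thesis using orb_trans orb_sym orb_in by (metis (mono_tags, lifting) mem_Collect_eq)
  qed
  moreover have "y \<in> ?V" "y' \<notin> ?V" using y orb_refl by auto
  ultimately show ?thesis unfolding clopen_sep_by_def by (intro exI[of _ ?V]) auto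
next
  case False
  \<comment> \<open>The orbit space is realised by sending a point to its orbit as a set, so
    equality of values is the orbit relation.\<close>
  define q where "q y = {y'. orb y y'}" for y
  have q_iff: "q y = q y' \<longleftrightarrow> orb y y'" if "y \<in> topspace Y" "y' \<in> topspace Y" for y y'
  proof
    assume "q y = q y'"
    then show "orb y y'" using orb_refl[OF that(2)] unfolding q_def by (metis mem_Collect_eq)
  next
    assume "orb y y'"
    then have "orb y w \<longleftrightarrow> orb y' w" for w using orb_sym orb_trans by metis
    then show "q y = q y'" by (simp add: q_def)
  qed
  obtain Z where Z: "topspace Z = q ` topspace Y" "quotient_map Y Z q"
    using ex_quotient_topology by metis
  have "clopen_separated Z" by (rule orbit_space_separated[OF False Z(2)]) (rule q_iff)
  moreover have "q y \<noteq> q y'" using q_iff y by metis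
  ultimately obtain V where V: "clopenin Z V" "q y \<in> V" "q y' \<notin> V"
    using Z(1) y unfolding clopen_separated_def by (metis image_eqI)
  let ?V = "{w \<in> topspace Y. q w \<in> V}"
  have "clopenin Y ?V"
    by (rule clopenin_preimage[OF quotient_imp_continuous_map[OF Z(2)] V(1)])
  moreover have "act h w \<in> ?V \<longleftrightarrow> w \<in> ?V" if "(h, w) \<in> D" for h w
  proof -
    have "orb w (act h w)" using that by (auto simp: orb_def)
    then have "q w = q (act h w)" "w \<in> topspace Y" "act h w \<in> topspace Y"
      using q_iff orb_in by metis+
    then show ?thesis by simp
  qed
  ultimately show ?thesis using y V unfolding clopen_sep_by_def by (intro exI[of _ ?V]) auto
qed

end

section \<open>Small sets\<close>

locale universe =
  fixes U :: "'u set set"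
  assumes univ: "set_universe U"
begin

text \<open>Defined through an embedding into a member of \<open>U\<close> and polymorphic in the
  elements, so that sets of pairs, functions, lists and topologies can be measured although only
  subsets of \<open>'u\<close> belong to \<open>U\<close>.\<close>

definition small :: "'a set \<Rightarrow> bool" where
  "small S \<longleftrightarrow> (\<exists>A\<in>U. S \<lesssim> A)"

lemma small_lepoll: "S \<lesssim> T \<Longrightarrow> small T \<Longrightarrow> small S"
  unfolding small_def using lepoll_trans by blast

lemma small_subset: "S \<subseteq> T \<Longrightarrow> small T \<Longrightarrow> small S"
  using small_lepoll subset_imp_lepoll by blast

lemma small_inj: "inj_on f S \<Longrightarrow> f ` S \<subseteq> T \<Longrightarrow> small T \<Longrightarrow> small S"
  using small_lepoll unfolding lepoll_def by blast

lemma small_U: "A \<in> U \<Longrightarrow> small A"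
  unfolding small_def by blast

lemma U_small: "small S \<Longrightarrow> S \<in> U"
  using univ unfolding small_def set_universe_def by blast

lemma ex_infinite: "\<exists>A\<in>U. infinite A"
  using univ unfolding set_universe_def by blast

lemma small_finite: "finite S \<Longrightarrow> small S"
  unfolding small_def using ex_infinite finite_lepoll_infinite by blast

lemma small_nat: "small (UNIV :: nat set)"
  unfolding small_def using ex_infinite infinite_le_lepoll by blast

lemma small_Pow: assumes "small S" shows "small (Pow S)"
proof -
  obtain A where A: "A \<in> U" "S \<lesssim> A" using assms by (auto simp: small_def)
  then obtain B where B: "B \<in> U" "Pow A \<lesssim> B" using univ unfolding set_universe_def by metis
  obtain f where f: "inj_on f S" "f ` S \<subseteq> A" using A(2) unfolding lepoll_def by blast
  have "Pow S \<lesssim> Pow A"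
    unfolding lepoll_def by (rule exI[of _ "image f"]) (use f in \<open>auto simp: inj_on_image_Pow\<close>)
  then show ?thesis using B lepoll_trans unfolding small_def by blast
qed

text \<open>Cardinals are comparable, so among a set dominating \<open>S\<close>, a set dominating
  \<open>T\<close> and an infinite set one dominates the other two.\<close>

lemma small_common:
  assumes "small S" "small T"
  obtains A where "A \<in> U" "infinite A" "S \<lesssim> A" "T \<lesssim> A"
proof -
  have total: "A \<lesssim> B \<or> B \<lesssim> A" for A B :: "'u set"
    using ordLeq_total[OF card_of_Well_order card_of_Well_order, of A B]
    unfolding lepoll_def card_of_ordLeq .
  obtain A B C where A: "A \<in> U" "S \<lesssim> A" "B \<in> U" "T \<lesssim> B" "C \<in> U" "infinite C"
    using assms ex_infinite unfolding small_def by metis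
  have inf: "infinite D" if "C \<lesssim> D" for D :: "'u set"
    using that A(6) lepoll_trans1 by (metis lepoll_trans infinite_le_lepoll)
  consider "A \<lesssim> C" "B \<lesssim> C" | "C \<lesssim> A" "B \<lesssim> A" | "C \<lesssim> B" "A \<lesssim> B"
    using total lepoll_trans by metis
  then show ?thesis
  proof cases
    case 1 then show ?thesis using that[of C] A lepoll_trans by metis
  next
    case 2 then show ?thesis using that[of A] A inf lepoll_trans by metis
  next
    case 3 then show ?thesis using that[of B] A inf lepoll_trans by metis
  qed
qed

lemma small_Times: assumes "small S" "small T" shows "small (S \<times> T)"
proof -
  obtain A where A: "A \<in> U" "infinite A" "S \<lesssim> A" "T \<lesssim> A" using small_common assms by blast
  have "A \<times> A \<lesssim> A"
    using card_of_Times_same_infinite[OF A(2)] eqpoll_iff_card_of_ordIso eqpoll_imp_lepoll by blast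
  then have "S \<times> T \<lesssim> A" using times_lepoll_mono[OF A(3,4)] lepoll_trans by blast
  then show ?thesis using A(1) unfolding small_def by blast
qed

text \<open>An extensional function on \<open>S\<close> is recovered from its graph, a subset of
  \<open>S \<times> T\<close>.\<close>

lemma small_funcset: assumes "small S" "small T" shows "small (S \<rightarrow>\<^sub>E T)"
proof (rule small_inj)
  show "small (Pow (S \<times> T))" using assms by (intro small_Pow small_Times)
  show "inj_on (\<lambda>f. (\<lambda>x. (x, f x)) ` S) (S \<rightarrow>\<^sub>E T)"
  proof (rule inj_onI)
    fix f g assume fg: "f \<in> S \<rightarrow>\<^sub>E T" "g \<in> S \<rightarrow>\<^sub>E T" and eq: "(\<lambda>x. (x, f x)) ` S = (\<lambda>x. (x, g x)) ` S"
    have "f x = g x" if "x \<in> S" for x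
    proof -
      have "(x, f x) \<in> (\<lambda>x. (x, f x)) ` S" using that by blast
      then have "(x, f x) \<in> (\<lambda>x. (x, g x)) ` S" by (simp only: eq)
      then show ?thesis by auto
    qed
    then show "f = g" using fg by (intro PiE_ext[OF fg]) auto
  qed
qed auto

text \<open>A list is recovered from the graph of its index function, a set of pairs of a natural
  number and an element of \<open>S\<close>.\<close>

lemma small_lists: assumes "small S" shows "small (lists S)"
proof (rule small_inj)
  show "small (Pow ((UNIV :: nat set) \<times> S))" using assms by (intro small_Pow small_Times small_nat)
  let ?g = "\<lambda>xs. {(i, xs ! i) | i. i < length xs}"
  show "inj_on ?g (lists S)"
  proof (rule inj_onI)
    fix xs ys :: "'a list" assume eq: "?g xs = ?g ys"
    have "i < length xs \<longleftrightarrow> i < length ys" for i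
    proof -
      have "i < length xs \<longleftrightarrow> (\<exists>x. (i, x) \<in> ?g xs)" by auto
      also have "\<dots> \<longleftrightarrow> (\<exists>x. (i, x) \<in> ?g ys)" by (simp only: eq)
      also have "\<dots> \<longleftrightarrow> i < length ys" by auto
      finally show ?thesis .
    qed
    then have len: "length xs = length ys" by (metis linorder_neqE_nat less_irrefl)
    moreover have "xs ! i = ys ! i" if "i < length xs" for i
    proof -
      have "(i, xs ! i) \<in> ?g xs" using that by blast
      then have "(i, xs ! i) \<in> ?g ys" by (simp only: eq)
      then show ?thesis by auto
    qed
    ultimately show "xs = ys" by (intro nth_equalityI)
  qed
  show "?g ` lists S \<subseteq> Pow (UNIV \<times> S)" by (auto simp: in_lists_conv_set)
qed

lemma small_topologies: assumes "small A" shows "small {T. topspace T \<subseteq> A}"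
proof (rule small_inj)
  show "small (Pow (Pow A))" using assms by (intro small_Pow)
  show "inj_on (\<lambda>T. Collect (openin T)) {T. topspace T \<subseteq> A}"
    by (rule inj_onI) (metis Collect_inj openin_inject)
  show "(\<lambda>T. Collect (openin T)) ` {T. topspace T \<subseteq> A} \<subseteq> Pow (Pow A)"
    using openin_subset by fastforce
qed

lemma small_embed: assumes "small S" obtains f :: "'a \<Rightarrow> 'u" where "inj_on f S" "f ` S \<in> U"
proof -
  obtain A f where A: "A \<in> U" and f: "inj_on f S" "f ` S \<subseteq> A"
    using assms unfolding small_def lepoll_def by metis
  have "f ` S \<in> U" using U_small small_subset small_U A f(2) by metis
  then show ?thesis using that f(1) by blast
qed

end

section \<open>Discrete and profinite groups\<close>

text \<open>Groups with elements in an arbitrary type, kept apart from the group objects of a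
  category: the universal group is built inside a product, whose elements are functions, and only
  its final copy lives in \<open>'u\<close>.\<close>

record 'a tg =
  tg_top :: "'a topology"
  tg_mul :: "'a \<Rightarrow> 'a \<Rightarrow> 'a"
  tg_one :: 'a
  tg_inv :: "'a \<Rightarrow> 'a"

abbreviation tg_set :: "'a tg \<Rightarrow> 'a set" where
  "tg_set G \<equiv> topspace (tg_top G)"

definition tgroup :: "bool \<Rightarrow> 'a tg \<Rightarrow> bool" where
  "tgroup d G \<longleftrightarrow> tame d (tg_top G) \<and>
     continuous_map (prod_topology (tg_top G) (tg_top G)) (tg_top G) (\<lambda>(x, y). tg_mul G x y) \<and>
     continuous_map (tg_top G) (tg_top G) (tg_inv G) \<and> tg_one G \<in> tg_set G \<and>
     (\<forall>x\<in>tg_set G. \<forall>y\<in>tg_set G. \<forall>z\<in>tg_set G.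
        tg_mul G (tg_mul G x y) z = tg_mul G x (tg_mul G y z)) \<and>
     (\<forall>x\<in>tg_set G. tg_mul G (tg_one G) x = x \<and> tg_mul G x (tg_one G) = x \<and>
        tg_mul G (tg_inv G x) x = tg_one G \<and> tg_mul G x (tg_inv G x) = tg_one G)"

definition thom :: "'a tg \<Rightarrow> 'b tg \<Rightarrow> ('a \<Rightarrow> 'b) \<Rightarrow> bool" where
  "thom G H f \<longleftrightarrow> continuous_map (tg_top G) (tg_top H) f \<and>
     (\<forall>x\<in>tg_set G. \<forall>y\<in>tg_set G. f (tg_mul G x y) = tg_mul H (f x) (f y))"

lemma tgroup_tame: "tgroup d G \<Longrightarrow> tame d (tg_top G)"
  by (simp add: tgroup_def)

lemma tgroup_mul_continuous:
  "tgroup d G \<Longrightarrow> continuous_map (prod_topology (tg_top G) (tg_top G)) (tg_top G) (\<lambda>(x, y). tg_mul G x y)"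
  by (simp add: tgroup_def)

lemma tgroup_inv_continuous: "tgroup d G \<Longrightarrow> continuous_map (tg_top G) (tg_top G) (tg_inv G)"
  by (simp add: tgroup_def)

lemma tgroup_closed:
  assumes "tgroup d G"
  shows "tg_one G \<in> tg_set G"
    and "x \<in> tg_set G \<Longrightarrow> tg_inv G x \<in> tg_set G"
    and "x \<in> tg_set G \<Longrightarrow> y \<in> tg_set G \<Longrightarrow> tg_mul G x y \<in> tg_set G"
proof -
  show "tg_one G \<in> tg_set G" using assms by (simp add: tgroup_def)
  show "tg_inv G x \<in> tg_set G" if "x \<in> tg_set G"
    using continuous_map_image_subset_topspace[OF tgroup_inv_continuous[OF assms]] that by blast
  show "tg_mul G x y \<in> tg_set G" if "x \<in> tg_set G" "y \<in> tg_set G"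
    using continuous_map_image_subset_topspace[OF tgroup_mul_continuous[OF assms]] that by auto
qed

lemma tgroup_laws:
  assumes "tgroup d G"
  shows "x \<in> tg_set G \<Longrightarrow> y \<in> tg_set G \<Longrightarrow> z \<in> tg_set G \<Longrightarrow>
      tg_mul G (tg_mul G x y) z = tg_mul G x (tg_mul G y z)"
    and "x \<in> tg_set G \<Longrightarrow> tg_mul G (tg_one G) x = x"
    and "x \<in> tg_set G \<Longrightarrow> tg_mul G x (tg_one G) = x"
    and "x \<in> tg_set G \<Longrightarrow> tg_mul G (tg_inv G x) x = tg_one G"
    and "x \<in> tg_set G \<Longrightarrow> tg_mul G x (tg_inv G x) = tg_one G"
  using assms by (simp_all add: tgroup_def)

lemma tgroup_inv_unique:
  assumes G: "tgroup d G" and x: "x \<in> tg_set G" "y \<in> tg_set G" "tg_mul G x y = tg_one G"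
  shows "y = tg_inv G x"
proof -
  have "tg_mul G (tg_inv G x) (tg_mul G x y) = y"
    using tgroup_laws[OF G] tgroup_closed[OF G] x(1,2) by metis
  then show ?thesis using x tgroup_laws(3)[OF G] tgroup_closed[OF G] by metis
qed

lemma tgroup_idem:
  assumes G: "tgroup d G" and x: "x \<in> tg_set G" "tg_mul G x x = x"
  shows "x = tg_one G"
proof -
  have "tg_mul G (tg_inv G x) (tg_mul G x x) = x"
    using tgroup_laws[OF G] tgroup_closed[OF G] x(1) by metis
  then show ?thesis using x tgroup_laws(4)[OF G] by metis
qed

lemma thom_in: "thom G H f \<Longrightarrow> x \<in> tg_set G \<Longrightarrow> f x \<in> tg_set H"
  unfolding thom_def by (auto simp: continuous_map_def)

lemma thom_one:
  assumes G: "tgroup d G" and H: "tgroup d' H" and f: "thom G H f"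
  shows "f (tg_one G) = tg_one H"
proof (rule tgroup_idem[OF H])
  show "f (tg_one G) \<in> tg_set H" using thom_in[OF f tgroup_closed(1)[OF G]] .
  have "f (tg_mul G (tg_one G) (tg_one G)) = tg_mul H (f (tg_one G)) (f (tg_one G))"
    using f tgroup_closed(1)[OF G] unfolding thom_def by blast
  then show "tg_mul H (f (tg_one G)) (f (tg_one G)) = f (tg_one G)"
    using tgroup_laws(2)[OF G tgroup_closed(1)[OF G]] by simp
qed

lemma thom_inv:
  assumes G: "tgroup d G" and H: "tgroup d' H" and f: "thom G H f" and x: "x \<in> tg_set G"
  shows "f (tg_inv G x) = tg_inv H (f x)"
proof (rule tgroup_inv_unique[OF H])
  have ix: "tg_inv G x \<in> tg_set G" using tgroup_closed[OF G] x by blast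
  show "f x \<in> tg_set H" "f (tg_inv G x) \<in> tg_set H" using thom_in[OF f] x ix by blast+
  have "f (tg_mul G x (tg_inv G x)) = tg_mul H (f x) (f (tg_inv G x))"
    using f x ix unfolding thom_def by blast
  then show "tg_mul H (f x) (f (tg_inv G x)) = tg_one H"
    using tgroup_laws(5)[OF G x] thom_one[OF G H f] by simp
qed

lemma thom_compose: "thom G H f \<Longrightarrow> thom H K g \<Longrightarrow> thom G K (\<lambda>x. g (f x))"
  using thom_in[of G H f] continuous_map_compose[of "tg_top G" "tg_top H" f "tg_top K" g]
  unfolding thom_def by (simp add: comp_def)

text \<open>The operations of the copy are set to \<open>undefined\<close> off its carrier, so the
  record is determined by what happens on the carrier. Without this normalisation the groups on
  subsets of a small set need not form a small set.\<close>

lemma tgroup_transport: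
  assumes G: "tgroup d G" and f: "inj_on f (tg_set G)"
  obtains H where "tgroup d H" "tg_set H = f ` tg_set G" "thom G H f"
    "thom H G (inv_into (tg_set G) f)"
    "\<forall>x y. \<not> (x \<in> tg_set H \<and> y \<in> tg_set H) \<longrightarrow> tg_mul H x y = undefined"
    "\<forall>x. x \<notin> tg_set H \<longrightarrow> tg_inv H x = undefined"
proof -
  obtain T where T: "topspace T = f ` tg_set G" "homeomorphic_map (tg_top G) T f" "tame d T"
    using tame_transport[OF tgroup_tame[OF G] f] by blast
  let ?g = "inv_into (tg_set G) f"
  let ?c = "f ` tg_set G"
  have cf: "continuous_map (tg_top G) T f" using T(2) by (rule homeomorphic_imp_continuous_map)
  obtain g' where g': "homeomorphic_maps (tg_top G) T f g'" using T(2) homeomorphic_map_maps by blast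
  have g: "?g (f x) = x" if "x \<in> tg_set G" for x using f that by simp
  have "continuous_map T (tg_top G) ?g"
  proof (rule continuous_map_eq)
    show "continuous_map T (tg_top G) g'" using g' by (simp add: homeomorphic_maps_def)
    show "g' x = ?g x" if "x \<in> topspace T" for x
      using that g' g unfolding T(1) by (auto simp: homeomorphic_maps_def)
  qed
  note cg = this
  have fg: "f (?g x) = x" "?g x \<in> tg_set G" if "x \<in> ?c" for x
    using that by (auto simp: f_inv_into_f inv_into_into)
  define H where "H = \<lparr>tg_top = T,
    tg_mul = (\<lambda>x y. if x \<in> ?c \<and> y \<in> ?c then f (tg_mul G (?g x) (?g y)) else undefined),
    tg_one = f (tg_one G),
    tg_inv = (\<lambda>x. if x \<in> ?c then f (tg_inv G (?g x)) else undefined)\<rparr>"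
  have Hs: "tg_top H = T" "tg_set H = ?c" by (simp_all add: H_def T(1))
  have mulH: "tg_mul H (f x) (f y) = f (tg_mul G x y)" if "x \<in> tg_set G" "y \<in> tg_set G" for x y
    using that g by (simp add: H_def)
  have invH: "tg_inv H (f x) = f (tg_inv G x)" if "x \<in> tg_set G" for x
    using that g by (simp add: H_def)
  have oneH: "tg_one H = f (tg_one G)" by (simp add: H_def)
  have "tgroup d H"
    unfolding tgroup_def
  proof (intro conjI ballI)
    show "tame d (tg_top H)" using T(3) Hs by simp
    have "continuous_map (prod_topology T T) (prod_topology (tg_top G) (tg_top G))
        (\<lambda>x. (?g (fst x), ?g (snd x)))"
      using continuous_map_compose[OF continuous_map_fst cg, of T]
        continuous_map_compose[OF continuous_map_snd cg, of T]
      by (intro continuous_map_pairedI) (simp_all add: comp_def)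
    from continuous_map_compose[OF continuous_map_compose[OF this tgroup_mul_continuous[OF G]] cf]
    show "continuous_map (prod_topology (tg_top H) (tg_top H)) (tg_top H) (\<lambda>(x, y). tg_mul H x y)"
      unfolding Hs by (rule continuous_map_eq) (auto simp: T(1) H_def)
    from continuous_map_compose[OF continuous_map_compose[OF cg tgroup_inv_continuous[OF G]] cf]
    show "continuous_map (tg_top H) (tg_top H) (tg_inv H)"
      unfolding Hs by (rule continuous_map_eq) (auto simp: T(1) H_def)
    show "tg_one H \<in> tg_set H" using tgroup_closed(1)[OF G] unfolding Hs(2) oneH by blast
  next
    fix x y z assume "x \<in> tg_set H" "y \<in> tg_set H" "z \<in> tg_set H"
    then obtain a b c where "a \<in> tg_set G" "b \<in> tg_set G" "c \<in> tg_set G" "x = f a" "y = f b" "z = f c"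
      unfolding Hs(2) by blast
    then show "tg_mul H (tg_mul H x y) z = tg_mul H x (tg_mul H y z)"
      using tgroup_closed(3)[OF G] tgroup_laws(1)[OF G] by (simp add: mulH)
  next
    fix x assume "x \<in> tg_set H"
    then obtain a where "a \<in> tg_set G" "x = f a" unfolding Hs(2) by blast
    then show "tg_mul H (tg_one H) x = x" "tg_mul H x (tg_one H) = x"
      "tg_mul H (tg_inv H x) x = tg_one H" "tg_mul H x (tg_inv H x) = tg_one H"
      using tgroup_closed[OF G] tgroup_laws[OF G] by (simp_all add: mulH invH oneH)
  qed
  moreover have "thom G H f" using cf mulH by (simp add: thom_def Hs)
  moreover have "thom H G ?g"
    unfolding thom_def
  proof (intro conjI ballI)
    show "continuous_map (tg_top H) (tg_top G) ?g" using cg Hs by simp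
    fix x y assume "x \<in> tg_set H" "y \<in> tg_set H"
    then obtain a b where "a \<in> tg_set G" "b \<in> tg_set G" "x = f a" "y = f b" unfolding Hs(2) by blast
    then show "?g (tg_mul H x y) = tg_mul G (?g x) (?g y)"
      using tgroup_closed(3)[OF G] by (simp add: mulH g)
  qed
  moreover have "tg_mul H x y = undefined" if "\<not> (x \<in> tg_set H \<and> y \<in> tg_set H)" for x y
    using that unfolding Hs(2) by (auto simp: H_def)
  moreover have "tg_inv H x = undefined" if "x \<notin> tg_set H" for x
    using that unfolding Hs(2) by (simp add: H_def)
  ultimately show ?thesis by (intro that[OF _ Hs(2)]) simp_all
qed

section \<open>Generated subgroups, their closures and their cardinality\<close>

inductive_set gen :: "'a tg \<Rightarrow> 'a set \<Rightarrow> 'a set" for G S where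
  one: "tg_one G \<in> gen G S"
| mul: "x \<in> S \<Longrightarrow> y \<in> gen G S \<Longrightarrow> tg_mul G x y \<in> gen G S"
| mul_inv: "x \<in> S \<Longrightarrow> y \<in> gen G S \<Longrightarrow> tg_mul G (tg_inv G x) y \<in> gen G S"

text \<open>For discrete groups the closure is \<open>gen\<close> itself, so this is algebraic
  generation; for profinite groups it is topological generation.\<close>

definition dense_gen :: "'a tg \<Rightarrow> 'a set \<Rightarrow> bool" where
  "dense_gen G S \<longleftrightarrow> S \<subseteq> tg_set G \<and> tg_top G closure_of (gen G S) = tg_set G"

text \<open>Since \<open>gen\<close> grows by multiplying on the left with a generator or its
  inverse, each element is the value of a word of signed letters. The letters are taken from
  \<open>S\<close> and not from its image, so the bound does not depend on
  \<open>\<phi>\<close>.\<close>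

lemma gen_lepoll: "gen G (\<phi> ` S) \<lesssim> lists ((UNIV :: bool set) \<times> S)"
proof -
  let ?ev = "\<lambda>w. foldr (\<lambda>(b, x) r. tg_mul G (if b then \<phi> x else tg_inv G (\<phi> x)) r) w (tg_one G)"
  have "x \<in> ?ev ` lists (UNIV \<times> S)" if "x \<in> gen G (\<phi> ` S)" for x
    using that
  proof induction
    case one
    have "tg_one G = ?ev []" by simp
    then show ?case by blast
  next
    case (mul x y)
    then obtain s w where s: "s \<in> S" "x = \<phi> s" "w \<in> lists (UNIV \<times> S)" "y = ?ev w" by blast
    then have "tg_mul G x y = ?ev ((True, s) # w)" "(True, s) # w \<in> lists (UNIV \<times> S)" by auto
    then show ?case by blast
  next
    case (mul_inv x y)
    then obtain s w where s: "s \<in> S" "x = \<phi> s" "w \<in> lists (UNIV \<times> S)" "y = ?ev w" by blast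
    then have "tg_mul G (tg_inv G x) y = ?ev ((False, s) # w)" "(False, s) # w \<in> lists (UNIV \<times> S)" by auto
    then show ?case by blast
  qed
  then show ?thesis by (meson subsetI subset_image_lepoll)
qed

lemma gen_sub: "tgroup d G \<Longrightarrow> S \<subseteq> tg_set G \<Longrightarrow> gen G S \<subseteq> tg_set G"
proof
  fix x assume G: "tgroup d G" and S: "S \<subseteq> tg_set G" and "x \<in> gen G S"
  from this(3) show "x \<in> tg_set G"
    by induction (use tgroup_closed[OF G] S in auto)
qed

lemma gen_incl: assumes "tgroup d G" "S \<subseteq> tg_set G" "x \<in> S" shows "x \<in> gen G S"
  using gen.mul[OF assms(3) gen.one, of G] tgroup_laws(3)[OF assms(1)] assms(2,3) by (metis subsetD)

lemma gen_mul:
  assumes G: "tgroup d G" and S: "S \<subseteq> tg_set G" and x: "x \<in> gen G S" and y: "y \<in> gen G S"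
  shows "tg_mul G x y \<in> gen G S"
  using x
proof induction
  case one
  then show ?case using y gen_sub[OF G S] tgroup_laws(2)[OF G] by auto
next
  case (mul s w)
  then have "tg_mul G (tg_mul G s w) y = tg_mul G s (tg_mul G w y)"
    using y S gen_sub[OF G S] tgroup_laws(1)[OF G] by blast
  then show ?case using mul gen.mul by metis
next
  case (mul_inv s w)
  then have "tg_mul G (tg_mul G (tg_inv G s) w) y = tg_mul G (tg_inv G s) (tg_mul G w y)"
    using y S gen_sub[OF G S] tgroup_laws(1)[OF G] tgroup_closed(2)[OF G] by blast
  then show ?case using mul_inv gen.mul_inv by metis
qed

lemma tgroup_inv_inv:
  assumes G: "tgroup d G" and x: "x \<in> tg_set G" shows "tg_inv G (tg_inv G x) = x"
  using tgroup_inv_unique[OF G tgroup_closed(2)[OF G x] x tgroup_laws(4)[OF G x]] by simp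

lemma tgroup_inv_mul:
  assumes G: "tgroup d G" and x: "x \<in> tg_set G" "y \<in> tg_set G"
  shows "tg_inv G (tg_mul G x y) = tg_mul G (tg_inv G y) (tg_inv G x)"
proof (rule sym, rule tgroup_inv_unique[OF G])
  note c = tgroup_closed[OF G] and l = tgroup_laws[OF G]
  show "tg_mul G x y \<in> tg_set G" "tg_mul G (tg_inv G y) (tg_inv G x) \<in> tg_set G" using x c by blast+
  have "tg_mul G y (tg_mul G (tg_inv G y) (tg_inv G x)) = tg_inv G x"
    using x c l by metis
  then show "tg_mul G (tg_mul G x y) (tg_mul G (tg_inv G y) (tg_inv G x)) = tg_one G"
    using x c l by metis
qed

lemma gen_inv:
  assumes G: "tgroup d G" and S: "S \<subseteq> tg_set G" and x: "x \<in> gen G S"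
  shows "tg_inv G x \<in> gen G S"
  using x
proof induction
  case one
  have "tg_one G = tg_inv G (tg_one G)"
    using tgroup_inv_unique[OF G] tgroup_laws(2)[OF G] tgroup_closed(1)[OF G] by metis
  then show ?case using gen.one by metis
next
  case (mul s w)
  have s: "s \<in> tg_set G" "w \<in> tg_set G" using mul S gen_sub[OF G S] by blast+
  have "tg_mul G (tg_inv G s) (tg_one G) \<in> gen G S" using mul by (intro gen.mul_inv gen.one)
  then have "tg_inv G s \<in> gen G S" using tgroup_laws(3)[OF G] tgroup_closed(2)[OF G] s by metis
  then show ?case using tgroup_inv_mul[OF G s] gen_mul[OF G S] mul by metis
next
  case (mul_inv s w)
  have s: "s \<in> tg_set G" "tg_inv G s \<in> tg_set G" "w \<in> tg_set G"
    using mul_inv S gen_sub[OF G S] tgroup_closed(2)[OF G] by blast+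
  have "s \<in> gen G S" using gen_incl[OF G S] mul_inv by blast
  then show ?case using tgroup_inv_mul[OF G s(2,3)] tgroup_inv_inv[OF G s(1)] gen_mul[OF G S] mul_inv by metis
qed

text \<open>Homomorphisms that agree on generators agree on the subgroup generated by them, and the
  set where they agree is closed because the target is Hausdorff.\<close>

lemma thom_eq_on_dense:
  assumes G: "tgroup d G" and H: "tgroup d' H" and f: "thom G H f" and g: "thom G H g"
    and S: "dense_gen G S" and eq: "\<And>x. x \<in> S \<Longrightarrow> f x = g x" and x: "x \<in> tg_set G"
  shows "f x = g x"
proof -
  have SG: "S \<subseteq> tg_set G" using S by (simp add: dense_gen_def)
  have gen_eq: "f x = g x" if "x \<in> gen G S" for x
    using that
  proof induction
    case one
    then show ?case using thom_one[OF G H f] thom_one[OF G H g] by simp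
  next
    case (mul s w)
    then have "s \<in> tg_set G" "w \<in> tg_set G" using SG gen_sub[OF G SG] by blast+
    then show ?case using f g mul eq unfolding thom_def by metis
  next
    case (mul_inv s w)
    then have s: "s \<in> tg_set G" "tg_inv G s \<in> tg_set G" "w \<in> tg_set G"
      using SG gen_sub[OF G SG] tgroup_closed(2)[OF G] by blast+
    then have "f (tg_inv G s) = g (tg_inv G s)"
      using thom_inv[OF G H f] thom_inv[OF G H g] eq mul_inv by metis
    then show ?case using f g mul_inv s unfolding thom_def by metis
  qed
  have "closedin (tg_top G) {x \<in> tg_set G. f x = g x}"
    by (rule closedin_continuous_maps_eq[OF tame_Hausdorff[OF tgroup_tame[OF H]]])
      (use f g in \<open>auto simp: thom_def\<close>)
  moreover have "x \<in> tg_top G closure_of (gen G S)" using S x by (simp add: dense_gen_def)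
  ultimately show ?thesis using forall_in_closure_of[where P="\<lambda>x. f x = g x"] gen_eq by blast
qed

text \<open>The closure of a subgroup is a subgroup by continuity of the operations. Only the
  topology of the record is changed, so \<open>gen\<close> gives the same set in \<open>K\<close> as
  in \<open>G\<close>.\<close>

lemma tgroup_closure:
  assumes G: "tgroup d G" and S: "S \<subseteq> tg_set G"
    and K_def: "K = G\<lparr>tg_top := subtopology (tg_top G) (tg_top G closure_of (gen G S))\<rparr>"
  shows "tgroup d K" "tg_set K = tg_top G closure_of (gen G S)" "dense_gen K S"
proof -
  let ?c = "tg_top G closure_of (gen G S)"
  have D: "gen G S \<subseteq> tg_set G" by (rule gen_sub[OF G S])
  have cG: "?c \<subseteq> tg_set G" by (rule closure_of_subset_topspace)
  have Dc: "gen G S \<subseteq> ?c" using D by (rule closure_of_subset)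
  show ts: "tg_set K = ?c" using cG by (auto simp: K_def)
  have mulc: "tg_mul G x y \<in> ?c" if "x \<in> ?c" "y \<in> ?c" for x y
  proof -
    \<comment> \<open>The closure of a product is the product of the closures, so joint continuity
      of the multiplication applies.\<close>
    have "(x, y) \<in> prod_topology (tg_top G) (tg_top G) closure_of (gen G S \<times> gen G S)"
      using that by (simp add: closure_of_Times)
    then have "tg_mul G x y \<in> tg_top G closure_of ((\<lambda>(x, y). tg_mul G x y) ` (gen G S \<times> gen G S))"
      using continuous_map_image_closure_subset[OF tgroup_mul_continuous[OF G], of "gen G S \<times> gen G S"]
      by force
    moreover have "(\<lambda>(x, y). tg_mul G x y) ` (gen G S \<times> gen G S) \<subseteq> gen G S"
      using gen_mul[OF G S] by auto
    ultimately show ?thesis using closure_of_mono by blast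
  qed
  have invc: "tg_inv G x \<in> ?c" if "x \<in> ?c" for x
  proof -
    have "tg_inv G x \<in> tg_top G closure_of (tg_inv G ` gen G S)"
      using continuous_map_image_closure_subset[OF tgroup_inv_continuous[OF G], of "gen G S"] that by force
    moreover have "tg_inv G ` gen G S \<subseteq> gen G S" using gen_inv[OF G S] by auto
    ultimately show ?thesis using closure_of_mono by blast
  qed
  have K: "tg_top K = subtopology (tg_top G) ?c" "tg_mul K = tg_mul G" "tg_inv K = tg_inv G" "tg_one K = tg_one G"
    by (simp_all add: K_def)
  have inj: "continuous_map (tg_top K) (tg_top G) (\<lambda>x. x)"
    unfolding K using continuous_map_from_subtopology[OF continuous_map_id] by (simp add: id_def)
  show "tgroup d K"
    unfolding tgroup_def
  proof (intro conjI ballI)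
    show "tame d (tg_top K)"
      unfolding K by (rule tame_closed_subtopology[OF tgroup_tame[OF G] closedin_closure_of])
    have "continuous_map (prod_topology (tg_top K) (tg_top K)) (prod_topology (tg_top G) (tg_top G)) (\<lambda>x. (fst x, snd x))"
      using continuous_map_compose[OF continuous_map_fst inj] continuous_map_compose[OF continuous_map_snd inj]
      by (intro continuous_map_pairedI) (simp_all add: comp_def)
    from continuous_map_compose[OF this tgroup_mul_continuous[OF G]]
    have "continuous_map (prod_topology (tg_top K) (tg_top K)) (tg_top G) (\<lambda>(x, y). tg_mul K x y)"
      by (simp add: K(2) comp_def case_prod_unfold)
    then show "continuous_map (prod_topology (tg_top K) (tg_top K)) (tg_top K) (\<lambda>(x, y). tg_mul K x y)"
      using mulc ts unfolding K(1) continuous_map_in_subtopology by (auto simp: K)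
    from continuous_map_compose[OF inj tgroup_inv_continuous[OF G]]
    have "continuous_map (tg_top K) (tg_top G) (tg_inv K)"
      by (simp add: K(3) comp_def)
    then show "continuous_map (tg_top K) (tg_top K) (tg_inv K)"
      using invc ts unfolding K(1) continuous_map_in_subtopology by (auto simp: K)
    show "tg_one K \<in> tg_set K" unfolding ts K(4) using Dc gen.one by blast
  qed (use tgroup_laws[OF G] cG ts in \<open>auto simp: K subset_iff\<close>)
  have "x \<in> gen K S \<longleftrightarrow> x \<in> gen G S" for x
  proof
    show "x \<in> gen G S" if "x \<in> gen K S" using that
      by induction (auto simp: K intro: gen.intros)
    show "x \<in> gen K S" if "x \<in> gen G S" using that
      by induction (auto simp flip: K intro: gen.intros)
  qed
  then have gK: "gen K S = gen G S" by blast
  have "S \<subseteq> ?c" using gen_incl[OF G S] Dc by blast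
  moreover have "tg_top K closure_of gen K S = tg_set K"
    unfolding gK ts unfolding K(1) using Dc by (simp add: closure_of_subtopology Int_absorb1)
  ultimately show "dense_gen K S" unfolding dense_gen_def ts by blast
qed

text \<open>A point is determined by the traces on \<open>D\<close> of its open neighbourhoods. If
  two points had the same traces, disjoint neighbourhoods of them would, by density of
  \<open>D\<close>, have a common point in \<open>D\<close>.\<close>

lemma dense_lepoll:
  assumes K: "Hausdorff_space K" and D: "K closure_of D = topspace K"
  shows "topspace K \<lesssim> Pow (Pow D)"
  unfolding lepoll_def
proof (intro exI conjI)
  let ?n = "\<lambda>k. {S \<inter> D | S. openin K S \<and> k \<in> S}"
  show "inj_on ?n (topspace K)"
  proof (rule inj_onI, rule ccontr)
    fix k k' assume k: "k \<in> topspace K" "k' \<in> topspace K" "?n k = ?n k'" "k \<noteq> k'"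
    then obtain S T where S: "openin K S" "openin K T" "k \<in> S" "k' \<in> T" "disjnt S T"
      using K unfolding Hausdorff_space_def by metis
    then have "S \<inter> D \<in> ?n k'" using k(3) by blast
    then obtain R where R: "S \<inter> D = R \<inter> D" "openin K R" "k' \<in> R" by blast
    have "k' \<in> K closure_of D" "openin K (T \<inter> R)" "k' \<in> T \<inter> R" using D k S R by (auto simp: openin_Int)
    then obtain y where "y \<in> D" "y \<in> T \<inter> R" unfolding in_closure_of by blast
    then have "y \<in> S \<inter> T" using R(1) by blast
    then show False using S(5) by (auto simp: disjnt_def)
  qed
qed auto

text \<open>The product in the category of sets carries the discrete topology. The product topology
  would be wrong in that case, as it is not discrete for infinitely many factors with more than one
  point.\<close>

definition tprod :: "bool \<Rightarrow> ('i \<Rightarrow> 'a topology) \<Rightarrow> 'i set \<Rightarrow> ('i \<Rightarrow> 'a) topology" where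
  "tprod d T I = (if d then discrete_topology (\<Pi>\<^sub>E i\<in>I. topspace (T i)) else product_topology T I)"

lemma topspace_tprod: "topspace (tprod d T I) = (\<Pi>\<^sub>E i\<in>I. topspace (T i))"
  by (simp add: tprod_def)

lemma tprod_proj: "i \<in> I \<Longrightarrow> continuous_map (tprod d T I) (T i) (\<lambda>x. x i)"
  by (auto simp: tprod_def continuous_map_product_projection)

lemma tame_tprod:
  assumes T: "\<And>i. i \<in> I \<Longrightarrow> tame d (T i)"
  shows "tame d (tprod d T I)"
proof -
  have "clopen_separated (tprod d T I)"
    unfolding clopen_separated_def
  proof (intro ballI impI)
    fix x y assume x: "x \<in> topspace (tprod d T I)" and y: "y \<in> topspace (tprod d T I)" and "x \<noteq> y"
    then obtain i where i: "i \<in> I" "x i \<noteq> y i" unfolding topspace_tprod by (metis PiE_ext)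
    have "clopen_separated (T i)" using T[OF i(1)] by (simp add: tame_def)
    from clopen_separate_preimage[where f="\<lambda>x. x i", OF tprod_proj[OF i(1)] this x y i(2)]
    show "\<exists>V. clopenin (tprod d T I) V \<and> x \<in> V \<and> y \<notin> V" .
  qed
  moreover have "pretame d (tprod d T I)"
  proof (cases d)
    case True then show ?thesis by (simp add: pretame_def tprod_def)
  next
    case False
    then have "compact_space (T i)" if "i \<in> I" for i using T[OF that] by (simp add: tame_def pretame_def)
    then show ?thesis using False by (simp add: pretame_def tprod_def compact_space_product_topology)
  qed
  ultimately show ?thesis by (simp add: tame_def)
qed

lemma tprod_into:
  assumes X: "tame d X" and f: "\<And>i. i \<in> I \<Longrightarrow> continuous_map X (T i) (\<lambda>x. f x i)"
    and ext: "\<And>x. f x \<in> extensional I"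
  shows "continuous_map X (tprod d T I) f"
proof (cases d)
  case True
  have "f ` topspace X \<subseteq> (\<Pi>\<^sub>E i\<in>I. topspace (T i))"
    using f ext by (auto simp: PiE_def continuous_map_def)
  then show ?thesis using X True by (intro tame_discrete_continuous) (auto simp: topspace_tprod)
next
  case False
  then show ?thesis using f ext by (simp add: tprod_def continuous_map_componentwise image_subset_iff)
qed

definition tg_prod :: "bool \<Rightarrow> 'i set \<Rightarrow> ('i \<Rightarrow> 'a tg) \<Rightarrow> ('i \<Rightarrow> 'a) tg" where
  "tg_prod d I G = \<lparr>tg_top = tprod d (\<lambda>i. tg_top (G i)) I,
     tg_mul = (\<lambda>x y. \<lambda>i\<in>I. tg_mul (G i) (x i) (y i)),
     tg_one = (\<lambda>i\<in>I. tg_one (G i)),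
     tg_inv = (\<lambda>x. \<lambda>i\<in>I. tg_inv (G i) (x i))\<rparr>"

lemma tg_prod_simps:
  "tg_top (tg_prod d I G) = tprod d (\<lambda>i. tg_top (G i)) I"
  "tg_mul (tg_prod d I G) x y = (\<lambda>i\<in>I. tg_mul (G i) (x i) (y i))"
  "tg_one (tg_prod d I G) = (\<lambda>i\<in>I. tg_one (G i))"
  "tg_inv (tg_prod d I G) x = (\<lambda>i\<in>I. tg_inv (G i) (x i))"
  by (simp_all add: tg_prod_def)

lemma tgroup_prod:
  assumes G: "\<And>i. i \<in> I \<Longrightarrow> tgroup d (G i)"
  shows "tgroup d (tg_prod d I G)"
proof -
  let ?T = "tprod d (\<lambda>i. tg_top (G i)) I"
  have tT: "tame d ?T" by (rule tame_tprod[OF tgroup_tame[OF G]])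
  have coord: "x i \<in> tg_set (G i)" if "x \<in> topspace ?T" "i \<in> I" for x i
    using that by (auto simp: topspace_tprod)
  have "continuous_map (prod_topology ?T ?T) ?T (\<lambda>p. \<lambda>i\<in>I. tg_mul (G i) (fst p i) (snd p i))"
  proof (rule tprod_into[OF tame_prod[OF tT tT]])
    fix i assume i: "i \<in> I"
    have "continuous_map (prod_topology ?T ?T) (prod_topology (tg_top (G i)) (tg_top (G i))) (\<lambda>p. (fst p i, snd p i))"
      using continuous_map_compose[OF continuous_map_fst tprod_proj[OF i, of d "\<lambda>i. tg_top (G i)"], of ?T]
        continuous_map_compose[OF continuous_map_snd tprod_proj[OF i, of d "\<lambda>i. tg_top (G i)"], of ?T]
      by (intro continuous_map_pairedI) (simp_all add: comp_def)
    from continuous_map_compose[OF this tgroup_mul_continuous[OF G[OF i]]]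
    show "continuous_map (prod_topology ?T ?T) (tg_top (G i))
        (\<lambda>p. (\<lambda>i\<in>I. tg_mul (G i) (fst p i) (snd p i)) i)"
      using i by (simp add: comp_def)
  qed simp
  then have cm: "continuous_map (prod_topology ?T ?T) ?T (\<lambda>(x, y). tg_mul (tg_prod d I G) x y)"
    by (simp add: tg_prod_simps case_prod_unfold)
  have "continuous_map ?T ?T (\<lambda>x. \<lambda>i\<in>I. tg_inv (G i) (x i))"
  proof (rule tprod_into[OF tT])
    fix i assume i: "i \<in> I"
    from continuous_map_compose[OF tprod_proj[OF i, of d "\<lambda>i. tg_top (G i)"] tgroup_inv_continuous[OF G[OF i]]]
    show "continuous_map ?T (tg_top (G i)) (\<lambda>x. (\<lambda>i\<in>I. tg_inv (G i) (x i)) i)"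
      using i by (simp add: comp_def)
  qed simp
  then have ci: "continuous_map ?T ?T (tg_inv (tg_prod d I G))"
    by (simp add: tg_prod_def)
  have one: "tg_one (tg_prod d I G) \<in> topspace ?T"
    using tgroup_closed(1)[OF G] by (simp add: topspace_tprod tg_prod_simps)
  have ext: "(\<lambda>i\<in>I. x i) = x" if "x \<in> topspace ?T" for x
    using that by (auto simp: topspace_tprod PiE_def extensional_restrict)
  show ?thesis
    unfolding tgroup_def tg_prod_simps(1)
  proof (intro conjI ballI tT cm ci one)
    fix x y z assume xyz: "x \<in> topspace ?T" "y \<in> topspace ?T" "z \<in> topspace ?T"
    show "tg_mul (tg_prod d I G) (tg_mul (tg_prod d I G) x y) z = tg_mul (tg_prod d I G) x (tg_mul (tg_prod d I G) y z)"
      unfolding tg_prod_simps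
      by (rule restrict_ext) (use xyz coord tgroup_laws(1)[OF G] in simp)
  next
    fix x assume x: "x \<in> topspace ?T"
    have "(\<lambda>i\<in>I. tg_mul (G i) (tg_one (G i)) (x i)) = (\<lambda>i\<in>I. x i)"
      "(\<lambda>i\<in>I. tg_mul (G i) (x i) (tg_one (G i))) = (\<lambda>i\<in>I. x i)"
      "(\<lambda>i\<in>I. tg_mul (G i) (tg_inv (G i) (x i)) (x i)) = (\<lambda>i\<in>I. tg_one (G i))"
      "(\<lambda>i\<in>I. tg_mul (G i) (x i) (tg_inv (G i) (x i))) = (\<lambda>i\<in>I. tg_one (G i))"
      using coord[OF x] tgroup_laws(2-5)[OF G] by (auto intro!: restrict_ext)
    then show "tg_mul (tg_prod d I G) (tg_one (tg_prod d I G)) x = x"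
      "tg_mul (tg_prod d I G) x (tg_one (tg_prod d I G)) = x"
      "tg_mul (tg_prod d I G) (tg_inv (tg_prod d I G) x) x = tg_one (tg_prod d I G)"
      "tg_mul (tg_prod d I G) x (tg_inv (tg_prod d I G) x) = tg_one (tg_prod d I G)"
      unfolding tg_prod_simps ext[OF x] by (simp_all cong: restrict_cong)
  qed
qed

lemma thom_proj: "i \<in> I \<Longrightarrow> thom (tg_prod d I G) (G i) (\<lambda>x. x i)"
  unfolding thom_def tg_prod_simps using tprod_proj[of i I d "\<lambda>i. tg_top (G i)"] by simp

text \<open>Relations x y = z between points of \<open>X\<close> serve two purposes: they make a map
  multiplicative on prescribed pairs, and, with a point sent to the unit as one factor, they force
  two points to have the same image.\<close>

definition satisfies :: "('x \<times> 'x \<times> 'x) set \<Rightarrow> 'a tg \<Rightarrow> ('x \<Rightarrow> 'a) \<Rightarrow> bool" where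
  "satisfies Rel G \<phi> \<longleftrightarrow> (\<forall>(x, y, z)\<in>Rel. tg_mul G (\<phi> x) (\<phi> y) = \<phi> z)"

context universe
begin

text \<open>Every group generated by the image of \<open>X\<close> has a copy inside the bounded set \<open>A\<close>, so that the
  product over all such copies is small, and the closed subgroup generated by \<open>X\<close> in it is initial.\<close>

lemma free_tgroup:
  fixes X :: "'x topology" and Rel :: "('x \<times> 'x \<times> 'x) set"
  assumes X: "tame d X" and sX: "small (topspace X)"
    and Rel: "Rel \<subseteq> topspace X \<times> topspace X \<times> topspace X"
  obtains G :: "'u tg" and \<iota> where "tgroup d G" "tg_set G \<in> U" "continuous_map X (tg_top G) \<iota>"
    "satisfies Rel G \<iota>" "dense_gen G (\<iota> ` topspace X)"
    "\<And>(K :: 'u tg) \<phi>. tgroup d K \<Longrightarrow> continuous_map X (tg_top K) \<phi> \<Longrightarrow> satisfies Rel K \<phi> \<Longrightarrow>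
       \<exists>\<psi>. thom G K \<psi> \<and> (\<forall>x\<in>topspace X. \<psi> (\<iota> x) = \<phi> x)"
proof -
  let ?W = "lists ((UNIV :: bool set) \<times> topspace X)"
  have "small (Pow (Pow ?W))" by (intro small_Pow small_lists small_Times[OF small_finite sX]) simp
  \<comment> \<open>\<open>Pow (Pow ?W)\<close> bounds every group densely generated by an image of
    \<open>X\<close>. \<open>A\<close> is infinite so that adjoining the value
    \<open>undefined\<close> does not enlarge it.\<close>
  then obtain A where A: "A \<in> U" "Pow (Pow ?W) \<lesssim> A" and infA: "infinite A"
    using small_common by metis
  define ok :: "'u tg \<Rightarrow> ('x \<Rightarrow> 'u) \<Rightarrow> bool" where
    "ok K \<phi> \<longleftrightarrow> tgroup d K \<and> continuous_map X (tg_top K) \<phi> \<and> satisfies Rel K \<phi>" for K \<phi>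
  \<comment> \<open>Indices are group structures on subsets of \<open>A\<close> together with a map
    from \<open>X\<close>, normalised to \<open>undefined\<close> outside their domains so that
    there is only a small set of them.\<close>
  define I where "I = {(K, \<phi>). ok K \<phi> \<and> tg_set K \<subseteq> A \<and> \<phi> \<in> extensional (topspace X) \<and>
    (\<forall>x y. \<not> (x \<in> tg_set K \<and> y \<in> tg_set K) \<longrightarrow> tg_mul K x y = undefined) \<and>
    (\<forall>x. x \<notin> tg_set K \<longrightarrow> tg_inv K x = undefined)}"
  have sA: "small A" by (rule small_U[OF A(1)])
  have sI: "small I"
  proof (rule small_inj)
    let ?A = "insert undefined A"
    have sA': "small ?A"
      by (rule small_lepoll[OF eqpoll_imp_lepoll[OF infinite_insert_eqpoll[OF infA]] sA])
    let ?Z = "{T. topspace T \<subseteq> A} \<times> (A \<times> A \<rightarrow>\<^sub>E ?A) \<times> ?A \<times> (A \<rightarrow>\<^sub>E ?A) \<times> (topspace X \<rightarrow>\<^sub>E ?A)"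
    \<comment> \<open>The code of an index: its components range over topologies, elements and
      functions between small sets, and the normalisation makes the code determine the
      index.\<close>
    let ?f = "\<lambda>(K, \<phi>). (tg_top K, (\<lambda>p. tg_mul K (fst p) (snd p)), tg_one K, tg_inv K, \<phi>)"
    show "small ?Z"
      by (intro small_Times small_topologies small_funcset sA sA' sX)
    show "inj_on ?f I"
      by (rule inj_onI) (auto simp: fun_eq_iff intro: tg.equality)
    show "?f ` I \<subseteq> ?Z"
    proof
      fix p assume "p \<in> ?f ` I"
      then obtain j where j: "p = ?f j" "j \<in> I" by (rule imageE)
      obtain K \<phi> where "j = (K, \<phi>)" by (cases j)
      with j have p: "p = ?f (K, \<phi>)" and K: "(K, \<phi>) \<in> I" by simp_all
      have g: "tgroup d K" "tg_set K \<subseteq> A" "continuous_map X (tg_top K) \<phi>" "\<phi> \<in> extensional (topspace X)"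
        "\<And>x y. \<not> (x \<in> tg_set K \<and> y \<in> tg_set K) \<Longrightarrow> tg_mul K x y = undefined"
        "\<And>x. x \<notin> tg_set K \<Longrightarrow> tg_inv K x = undefined"
        using K by (auto simp: I_def ok_def)
      note c = tgroup_closed[OF g(1)]
      have "(\<lambda>p. tg_mul K (fst p) (snd p)) \<in> A \<times> A \<rightarrow>\<^sub>E ?A"
      proof (rule PiE_I)
        fix q assume "q \<in> A \<times> A"
        show "tg_mul K (fst q) (snd q) \<in> ?A"
          using c(3)[of "fst q" "snd q"] g(2) g(5)[of "fst q" "snd q"] by blast
      next
        fix q assume "q \<notin> A \<times> A"
        then show "tg_mul K (fst q) (snd q) = undefined"
          using g(2) g(5)[of "fst q" "snd q"] by (metis mem_Times_iff subsetD)
      qed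
      moreover have "tg_inv K \<in> A \<rightarrow>\<^sub>E ?A"
      proof (rule PiE_I)
        show "tg_inv K x \<in> ?A" for x using c(2)[of x] g(2) g(6)[of x] by blast
        show "tg_inv K x = undefined" if "x \<notin> A" for x using that g(2) g(6)[of x] by blast
      qed
      moreover have "\<phi> \<in> topspace X \<rightarrow>\<^sub>E ?A"
        using g(2,3,4) by (auto simp: PiE_def continuous_map_def)
      moreover have "tg_one K \<in> ?A" using c(1) g(2) by blast
      ultimately show "p \<in> ?Z" using g(2) by (simp add: p)
    qed
  qed
  have okI: "ok (fst j) (snd j)" "tg_set (fst j) \<subseteq> A" if "j \<in> I" for j
    using that by (auto simp: I_def)
  define P where "P = tg_prod d I fst"
  have P: "tgroup d P" unfolding P_def by (rule tgroup_prod) (use okI in \<open>auto simp: ok_def\<close>)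
  \<comment> \<open>The diagonal map: in the factor indexed by a pair its coordinate is the map
    stored in that pair.\<close>
  define \<iota>0 where "\<iota>0 x = (\<lambda>j\<in>I. snd j x)" for x
  have c0: "continuous_map X (tg_top P) \<iota>0"
    unfolding P_def tg_prod_simps
  proof (rule tprod_into[OF X])
    show "continuous_map X (tg_top (fst j)) (\<lambda>x. \<iota>0 x j)" if "j \<in> I" for j
      using okI(1)[OF that] that by (simp add: \<iota>0_def ok_def)
  qed (simp add: \<iota>0_def)
  have r0: "satisfies Rel P \<iota>0"
    unfolding satisfies_def
  proof clarify
    fix x y z assume "(x, y, z) \<in> Rel"
    then have "tg_mul (fst j) (snd j x) (snd j y) = snd j z" if "j \<in> I" for j
      using okI(1)[OF that] by (auto simp: ok_def satisfies_def)
    then show "tg_mul P (\<iota>0 x) (\<iota>0 y) = \<iota>0 z"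
      unfolding P_def tg_prod_simps \<iota>0_def by (intro restrict_ext) simp
  qed
  have im0: "\<iota>0 ` topspace X \<subseteq> tg_set P" by (rule continuous_map_image_subset_topspace[OF c0])
  \<comment> \<open>The whole product has too many points for a homomorphism out of it to be
    determined by its values on \<open>X\<close>; cutting down to the closed subgroup generated by
    the diagonal gives uniqueness.\<close>
  define Q where "Q = P\<lparr>tg_top := subtopology (tg_top P) (tg_top P closure_of (gen P (\<iota>0 ` topspace X)))\<rparr>"
  note Q = tgroup_closure[OF P im0 Q_def]
  have im0': "\<iota>0 ` topspace X \<subseteq> tg_set Q" using Q(3) by (simp add: dense_gen_def)
  have c1: "continuous_map X (tg_top Q) \<iota>0"
    using c0 im0' unfolding Q(2) by (auto simp: Q_def continuous_map_in_subtopology)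
  have QP: "thom Q P (\<lambda>x. x)"
    unfolding thom_def using continuous_map_from_subtopology[OF continuous_map_id]
    by (simp add: Q_def id_def)
  have r1: "satisfies Rel Q \<iota>0" using r0 by (simp add: satisfies_def Q_def)
  have "tg_set Q \<subseteq> (I \<rightarrow>\<^sub>E A)"
  proof -
    have "tg_set Q \<subseteq> tg_set P" unfolding Q(2) by (rule closure_of_subset_topspace)
    also have "\<dots> \<subseteq> (I \<rightarrow>\<^sub>E A)" using okI(2) by (auto simp: P_def tg_prod_simps topspace_tprod PiE_def Pi_def) (meson subsetD)
    finally show ?thesis .
  qed
  then have "small (tg_set Q)" by (rule small_subset) (intro small_funcset sI sA)
  then obtain f :: "_ \<Rightarrow> 'u" where f: "inj_on f (tg_set Q)" "f ` tg_set Q \<in> U" by (rule small_embed)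
  obtain G where G: "tgroup d G" "tg_set G = f ` tg_set Q" "thom Q G f" "thom G Q (inv_into (tg_set Q) f)"
    by (rule tgroup_transport[OF Q(1) f(1)])
  define \<iota> where "\<iota> x = f (\<iota>0 x)" for x
  have c2: "continuous_map X (tg_top G) \<iota>"
    using continuous_map_compose[OF c1, of "tg_top G" f] G(3) by (simp add: \<iota>_def[abs_def] thom_def comp_def)
  have r2: "satisfies Rel G \<iota>"
    unfolding satisfies_def
  proof clarify
    fix x y z assume xyz: "(x, y, z) \<in> Rel"
    then have "\<iota>0 x \<in> tg_set Q" "\<iota>0 y \<in> tg_set Q" using Rel im0' by blast+
    then have "tg_mul G (f (\<iota>0 x)) (f (\<iota>0 y)) = f (tg_mul Q (\<iota>0 x) (\<iota>0 y))" using G(3) by (simp add: thom_def)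
    moreover have "tg_mul Q (\<iota>0 x) (\<iota>0 y) = \<iota>0 z" using r1 xyz unfolding satisfies_def by blast
    ultimately show "tg_mul G (\<iota> x) (\<iota> y) = \<iota> z" by (simp add: \<iota>_def)
  qed
  have den: "dense_gen G (\<iota> ` topspace X)"
    unfolding dense_gen_def
  proof
    show im: "\<iota> ` topspace X \<subseteq> tg_set G" by (rule continuous_map_image_subset_topspace[OF c2])
    \<comment> \<open>Density is carried along the copy: \<open>f\<close> maps words in the old
      generators to words in the new ones, and closures into closures.\<close>
    have "f x \<in> gen G (\<iota> ` topspace X)" if "x \<in> gen Q (\<iota>0 ` topspace X)" for x
      using that
    proof induction
      case one
      then show ?case using thom_one[OF Q(1) G(1,3)] gen.one by metis
    next
      case (mul s w)
      then have "s \<in> tg_set Q" "w \<in> tg_set Q" "f s \<in> \<iota> ` topspace X"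
        using im0' gen_sub[OF Q(1) im0'] by (auto simp: \<iota>_def)
      then show ?case using mul G(3) gen.mul unfolding thom_def by metis
    next
      case (mul_inv s w)
      then have s: "s \<in> tg_set Q" "w \<in> tg_set Q" "f s \<in> \<iota> ` topspace X"
        using im0' gen_sub[OF Q(1) im0'] by (auto simp: \<iota>_def)
      then have "tg_inv Q s \<in> tg_set Q" "f (tg_inv Q s) = tg_inv G (f s)"
        using tgroup_closed(2)[OF Q(1)] thom_inv[OF Q(1) G(1,3)] by blast+
      then show ?case using s mul_inv G(3) gen.mul_inv unfolding thom_def by metis
    qed
    then have "f ` gen Q (\<iota>0 ` topspace X) \<subseteq> gen G (\<iota> ` topspace X)" by blast
    then have sub1: "tg_top G closure_of (f ` gen Q (\<iota>0 ` topspace X)) \<subseteq> tg_top G closure_of (gen G (\<iota> ` topspace X))"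
      by (rule closure_of_mono)
    have sub2: "f ` (tg_top Q closure_of gen Q (\<iota>0 ` topspace X)) \<subseteq> tg_top G closure_of (f ` gen Q (\<iota>0 ` topspace X))"
      using G(3) by (intro continuous_map_image_closure_subset) (simp add: thom_def)
    have e: "tg_top Q closure_of gen Q (\<iota>0 ` topspace X) = tg_set Q" using Q(3) by (simp add: dense_gen_def)
    have "tg_set G \<subseteq> tg_top G closure_of (gen G (\<iota> ` topspace X))"
      using subset_trans[OF sub2 sub1] by (simp only: e G(2))
    then show "tg_top G closure_of gen G (\<iota> ` topspace X) = tg_set G"
      using closure_of_subset_topspace by (rule subset_antisym[rotated])
  qed
  have univ: "\<exists>\<psi>. thom G K \<psi> \<and> (\<forall>x\<in>topspace X. \<psi> (\<iota> x) = \<phi> x)"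
    if K: "tgroup d K" "continuous_map X (tg_top K) \<phi>" "satisfies Rel K \<phi>" for K :: "'u tg" and \<phi>
  proof -
    have imK: "\<phi> ` topspace X \<subseteq> tg_set K" by (rule continuous_map_image_subset_topspace[OF K(2)])
    \<comment> \<open>\<open>K\<close> may be too large to be an index, so it is replaced by the
      closed subgroup generated by the image of \<open>X\<close>, whose cardinality is bounded, and
      that in turn by a copy on a subset of \<open>A\<close>.\<close>
    define L where "L = K\<lparr>tg_top := subtopology (tg_top K) (tg_top K closure_of (gen K (\<phi> ` topspace X)))\<rparr>"
    note L = tgroup_closure[OF K(1) imK L_def]
    have imL: "\<phi> ` topspace X \<subseteq> tg_set L" using L(3) by (simp add: dense_gen_def)
    have cL: "continuous_map X (tg_top L) \<phi>"
      using K(2) imL unfolding L(2) by (auto simp: L_def continuous_map_in_subtopology)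
    have LK: "thom L K (\<lambda>x. x)"
      unfolding thom_def using continuous_map_from_subtopology[OF continuous_map_id]
      by (simp add: L_def id_def)
    have rL: "satisfies Rel L \<phi>" using K(3) by (simp add: satisfies_def L_def)
    have "tg_set L \<lesssim> Pow (Pow (gen L (\<phi> ` topspace X)))"
      by (rule dense_lepoll[OF tame_Hausdorff[OF tgroup_tame[OF L(1)]]]) (use L(3) in \<open>simp add: dense_gen_def\<close>)
    also have "Pow (Pow (gen L (\<phi> ` topspace X))) \<lesssim> Pow (Pow ?W)"
    proof -
      have mono: "Pow S \<lesssim> Pow T" if ST: "S \<lesssim> T" for S :: "'s set" and T :: "'t set"
      proof -
        obtain g where g: "inj_on g S" "g ` S \<subseteq> T" using ST unfolding lepoll_def by blast
        show ?thesis unfolding lepoll_def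
          by (rule exI[of _ "image g"]) (use g in \<open>auto simp: inj_on_image_Pow\<close>)
      qed
      show ?thesis by (intro mono gen_lepoll)
    qed
    also note A(2)
    finally obtain g where g: "inj_on g (tg_set L)" "g ` tg_set L \<subseteq> A" unfolding lepoll_def by blast
    obtain M where M: "tgroup d M" "tg_set M = g ` tg_set L" "thom L M g" "thom M L (inv_into (tg_set L) g)"
      "\<forall>x y. \<not> (x \<in> tg_set M \<and> y \<in> tg_set M) \<longrightarrow> tg_mul M x y = undefined"
      "\<forall>x. x \<notin> tg_set M \<longrightarrow> tg_inv M x = undefined"
      by (rule tgroup_transport[OF L(1) g(1)])
    \<comment> \<open>Restricted to \<open>topspace X\<close> to meet the normalisation required of
      members of \<open>I\<close>.\<close>
    define \<phi>' where "\<phi>' = (\<lambda>x\<in>topspace X. g (\<phi> x))"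
    have "continuous_map (tg_top L) (tg_top M) g" using M(3) by (simp add: thom_def)
    from continuous_map_compose[OF cL this] have cM: "continuous_map X (tg_top M) \<phi>'"
      by (rule continuous_map_eq) (simp add: \<phi>'_def)
    have rM: "satisfies Rel M \<phi>'"
      unfolding satisfies_def
    proof clarify
      fix x y z assume xyz: "(x, y, z) \<in> Rel"
      then have x: "x \<in> topspace X" "y \<in> topspace X" "z \<in> topspace X" using Rel by blast+
      then have "\<phi> x \<in> tg_set L" "\<phi> y \<in> tg_set L" using imL by blast+
      then have "tg_mul M (g (\<phi> x)) (g (\<phi> y)) = g (tg_mul L (\<phi> x) (\<phi> y))" using M(3) by (simp add: thom_def)
      moreover have "tg_mul L (\<phi> x) (\<phi> y) = \<phi> z" using rL xyz unfolding satisfies_def by blast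
      ultimately show "tg_mul M (\<phi>' x) (\<phi>' y) = \<phi>' z" using x by (simp add: \<phi>'_def)
    qed
    have "\<phi>' \<in> extensional (topspace X)" by (simp add: \<phi>'_def)
    then have j: "(M, \<phi>') \<in> I"
      unfolding I_def ok_def using M(1,2,5,6) g(2) cM rM by blast
    \<comment> \<open>From the copy \<open>G\<close> back to functions on \<open>I\<close>,
      projected to the factor \<open>(M, \<phi>')\<close>, and from \<open>M\<close> back to
      \<open>L\<close>, which sits inside \<open>K\<close>.\<close>
    let ?\<psi> = "\<lambda>x. inv_into (tg_set L) g ((inv_into (tg_set Q) f x) (M, \<phi>'))"
    have "thom P M (\<lambda>x. x (M, \<phi>'))"
      using thom_proj[OF j, of d fst] by (simp add: P_def)
    from thom_compose[OF thom_compose[OF thom_compose[OF thom_compose[OF G(4) QP] this] M(4)] LK]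
    have "thom G K ?\<psi>" .
    moreover have "?\<psi> (\<iota> x) = \<phi> x" if x: "x \<in> topspace X" for x
    proof -
      have "inv_into (tg_set Q) f (\<iota> x) = \<iota>0 x" using f(1) im0' x by (simp add: \<iota>_def inv_into_f_f image_subset_iff)
      moreover have "\<iota>0 x (M, \<phi>') = g (\<phi> x)" using j x by (simp add: \<iota>0_def \<phi>'_def)
      moreover have "inv_into (tg_set L) g (g (\<phi> x)) = \<phi> x" using g(1) imL x by (simp add: inv_into_f_f image_subset_iff)
      ultimately show ?thesis by simp
    qed
    ultimately show ?thesis by blast
  qed
  show ?thesis
    by (rule that[OF G(1) _ c2 r2 den univ]) (use f(2) G(2) in simp_all)
qed

end

section \<open>Concrete categories over a base space\<close>

definition ap :: "('u \<rightharpoonup> 'u) \<Rightarrow> 'u \<Rightarrow> 'u" where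
  "ap f x = the (f x)"

lemma tame_singleton: "tame d (discrete_topology {w})"
  by (auto simp: tame_def pretame_def clopen_separated_discrete compact_space_discrete_topology)

text \<open>Covers the categories of sets and of profinite spaces (with \<open>B\<close> a point) and all
  their slices (with \<open>B\<close> the base of the slice).\<close>

locale concrete_cat = universe U for U :: "'u set set" +
  fixes C :: "('o, 'u \<rightharpoonup> 'u) cat" and d :: bool and B :: "'b topology"
    and T :: "'o \<Rightarrow> 'u topology" and \<pi> :: "'o \<Rightarrow> 'u \<Rightarrow> 'b"
  assumes tame_B: "tame d B" and small_B: "small (topspace B)"
    and Hom_eq: "\<lbrakk>X \<in> Ob C; Y \<in> Ob C\<rbrakk> \<Longrightarrow> Hom C X Y = {f. dom f = topspace (T X) \<and>
      continuous_map (T X) (T Y) (ap f) \<and> (\<forall>x\<in>topspace (T X). \<pi> Y (ap f x) = \<pi> X x)}"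
    and Id_eq: "X \<in> Ob C \<Longrightarrow> cat.Id C X = Some |` topspace (T X)"
    and Comp_eq: "Comp C = (\<circ>\<^sub>m)"
    and Ob_tame: "X \<in> Ob C \<Longrightarrow> tame d (T X)"
    and Ob_U: "X \<in> Ob C \<Longrightarrow> topspace (T X) \<in> U"
    and Ob_\<pi>: "X \<in> Ob C \<Longrightarrow> continuous_map (T X) B (\<pi> X)"
    and Ob_ex: "\<lbrakk>tame d Z; topspace Z \<in> U; continuous_map Z B p\<rbrakk> \<Longrightarrow>
      \<exists>X\<in>Ob C. T X = Z \<and> (\<forall>x\<in>topspace Z. \<pi> X x = p x)"
begin

abbreviation pts :: "'o \<Rightarrow> 'u set" where
  "pts X \<equiv> topspace (T X)"

definition mk :: "'o \<Rightarrow> ('u \<Rightarrow> 'u) \<Rightarrow> 'u \<rightharpoonup> 'u" where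
  "mk X g = (\<lambda>x. if x \<in> pts X then Some (g x) else None)"

lemma ap_mk: "x \<in> pts X \<Longrightarrow> ap (mk X g) x = g x"
  by (simp add: ap_def mk_def)

lemma \<pi>_in: "X \<in> Ob C \<Longrightarrow> x \<in> pts X \<Longrightarrow> \<pi> X x \<in> topspace B"
  using continuous_map_image_subset_topspace[OF Ob_\<pi>] by blast

lemma mk_Hom:
  assumes "X \<in> Ob C" "Y \<in> Ob C" "continuous_map (T X) (T Y) g" "\<And>x. x \<in> pts X \<Longrightarrow> \<pi> Y (g x) = \<pi> X x"
  shows "mk X g \<in> Hom C X Y"
proof -
  have "continuous_map (T X) (T Y) (ap (mk X g))"
    by (rule continuous_map_eq[OF assms(3)]) (simp add: ap_mk)
  moreover have "dom (mk X g) = pts X" by (auto simp: mk_def dom_def)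
  ultimately show ?thesis using assms by (simp add: Hom_eq ap_mk)
qed

lemma Hom_dom: "\<lbrakk>f \<in> Hom C X Y; X \<in> Ob C; Y \<in> Ob C\<rbrakk> \<Longrightarrow> dom f = pts X"
  and Hom_cont: "\<lbrakk>f \<in> Hom C X Y; X \<in> Ob C; Y \<in> Ob C\<rbrakk> \<Longrightarrow> continuous_map (T X) (T Y) (ap f)"
  and Hom_\<pi>: "\<lbrakk>f \<in> Hom C X Y; X \<in> Ob C; Y \<in> Ob C; x \<in> pts X\<rbrakk> \<Longrightarrow> \<pi> Y (ap f x) = \<pi> X x"
  by (auto simp: Hom_eq)

lemma Hom_in: "\<lbrakk>f \<in> Hom C X Y; X \<in> Ob C; Y \<in> Ob C; x \<in> pts X\<rbrakk> \<Longrightarrow> ap f x \<in> pts Y"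
  using continuous_map_image_subset_topspace[OF Hom_cont] by blast

lemma Hom_ext:
  assumes "f \<in> Hom C X Y" "g \<in> Hom C X Y" "X \<in> Ob C" "Y \<in> Ob C" "\<And>x. x \<in> pts X \<Longrightarrow> ap f x = ap g x"
  shows "f = g"
proof
  fix x
  show "f x = g x"
  proof (cases "x \<in> pts X")
    case True
    then obtain a b where "f x = Some a" "g x = Some b"
      using Hom_dom[OF assms(1,3,4)] Hom_dom[OF assms(2,3,4)] by (metis domD)
    then show ?thesis using assms(5)[OF True] by (simp add: ap_def)
  next
    case False
    then have "x \<notin> dom f" "x \<notin> dom g" using Hom_dom assms by metis+
    then show ?thesis by (simp add: domIff)
  qed
qed

lemma ap_Comp: "\<lbrakk>f \<in> Hom C X Y; X \<in> Ob C; Y \<in> Ob C; x \<in> pts X\<rbrakk> \<Longrightarrow> ap (g \<odot>\<^bsub>C\<^esub> f) x = ap g (ap f x)"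
proof -
  assume "f \<in> Hom C X Y" "X \<in> Ob C" "Y \<in> Ob C" "x \<in> pts X"
  then obtain a where "f x = Some a" using Hom_dom by (metis domD)
  then show ?thesis by (simp add: Comp_eq ap_def map_comp_def)
qed

lemma Comp_Hom:
  assumes "f \<in> Hom C X Y" "g \<in> Hom C Y Z" "X \<in> Ob C" "Y \<in> Ob C" "Z \<in> Ob C"
  shows "g \<odot>\<^bsub>C\<^esub> f \<in> Hom C X Z"
proof -
  have "g \<odot>\<^bsub>C\<^esub> f = mk X (\<lambda>x. ap g (ap f x))"
  proof
    fix x
    show "(g \<odot>\<^bsub>C\<^esub> f) x = mk X (\<lambda>x. ap g (ap f x)) x"
    proof (cases "x \<in> pts X")
      case True
      then obtain a where a: "f x = Some a" using Hom_dom[OF assms(1,3,4)] by (metis domD)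
      have "a \<in> pts Y" using Hom_in[OF assms(1,3,4) True] a by (simp add: ap_def)
      then obtain b where "g a = Some b" using Hom_dom[OF assms(2,4,5)] by (metis domD)
      then show ?thesis using a True by (simp add: Comp_eq map_comp_def mk_def ap_def)
    next
      case False
      then have "f x = None" using Hom_dom[OF assms(1,3,4)] by (metis domIff)
      then show ?thesis using False by (simp add: Comp_eq map_comp_def mk_def)
    qed
  qed
  moreover have "mk X (\<lambda>x. ap g (ap f x)) \<in> Hom C X Z"
    using continuous_map_compose[OF Hom_cont[OF assms(1,3,4)] Hom_cont[OF assms(2,4,5)]]
      Hom_\<pi>[OF assms(1,3,4)] Hom_\<pi>[OF assms(2,4,5)] Hom_in[OF assms(1,3,4)] assms
    by (intro mk_Hom) (simp_all add: comp_def)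
  ultimately show ?thesis by simp
qed

lemma ap_Id: "X \<in> Ob C \<Longrightarrow> x \<in> pts X \<Longrightarrow> ap (cat.Id C X) x = x"
  by (simp add: Id_eq ap_def)

lemma Id_Hom: "X \<in> Ob C \<Longrightarrow> cat.Id C X \<in> Hom C X X"
proof -
  assume X: "X \<in> Ob C"
  have "cat.Id C X = mk X (\<lambda>x. x)" by (auto simp: Id_eq[OF X] mk_def restrict_map_def)
  then show ?thesis using mk_Hom[OF X X continuous_map_id[unfolded id_def]] by simp
qed

lemma category_C: "category C"
proof
  fix X assume "X \<in> Ob C"
  then show "cat.Id C X \<in> Hom C X X" by (rule Id_Hom)
next
  fix X Y Z f g assume "X \<in> Ob C" "Y \<in> Ob C" "Z \<in> Ob C" "f \<in> Hom C X Y" "g \<in> Hom C Y Z"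
  then show "g \<odot>\<^bsub>C\<^esub> f \<in> Hom C X Z" using Comp_Hom by blast
next
  fix X Y f assume X: "X \<in> Ob C" "Y \<in> Ob C" "f \<in> Hom C X Y"
  show "f \<odot>\<^bsub>C\<^esub> cat.Id C X = f"
    by (rule Hom_ext[OF Comp_Hom[OF Id_Hom[OF X(1)] X(3,1,1,2)] X(3,1,2)])
      (simp add: ap_Comp[OF Id_Hom[OF X(1)] X(1,1)] ap_Id X(1))
  show "cat.Id C Y \<odot>\<^bsub>C\<^esub> f = f"
    by (rule Hom_ext[OF Comp_Hom[OF X(3) Id_Hom[OF X(2)] X(1,2,2)] X(3,1,2)])
      (simp add: ap_Comp[OF X(3,1,2)] ap_Id X(2) Hom_in[OF X(3,1,2)])
next
  fix W X Y Z f g h assume X: "W \<in> Ob C" "X \<in> Ob C" "Y \<in> Ob C" "Z \<in> Ob C"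
    "f \<in> Hom C W X" "g \<in> Hom C X Y" "h \<in> Hom C Y Z"
  show "(h \<odot>\<^bsub>C\<^esub> g) \<odot>\<^bsub>C\<^esub> f = h \<odot>\<^bsub>C\<^esub> (g \<odot>\<^bsub>C\<^esub> f)"
    by (simp add: Comp_eq map_comp_def fun_eq_iff split: option.split)
qed

lemma Comp_eqI:
  assumes "f \<in> Hom C X Y" "g \<in> Hom C Y Z" "h \<in> Hom C X Z" "X \<in> Ob C" "Y \<in> Ob C" "Z \<in> Ob C"
  shows "g \<odot>\<^bsub>C\<^esub> f = h \<longleftrightarrow> (\<forall>x\<in>pts X. ap g (ap f x) = ap h x)"
  using Hom_ext[OF Comp_Hom[OF assms(1,2,4,5,6)] assms(3,4,6)] ap_Comp[OF assms(1,4,5)] by metis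

lemma Comp_eq_Comp_iff:
  assumes "f \<in> Hom C X Y" "g \<in> Hom C Y Z" "f' \<in> Hom C X Y'" "g' \<in> Hom C Y' Z"
    "X \<in> Ob C" "Y \<in> Ob C" "Y' \<in> Ob C" "Z \<in> Ob C"
  shows "g \<odot>\<^bsub>C\<^esub> f = g' \<odot>\<^bsub>C\<^esub> f' \<longleftrightarrow> (\<forall>x\<in>pts X. ap g (ap f x) = ap g' (ap f' x))"
  using Comp_eqI[OF assms(1,2) Comp_Hom[OF assms(3,4,5,7,8)] assms(5,6,8)] ap_Comp[OF assms(3,5,7)]
  by metis

text \<open>Every point of an object over \<open>b\<close> is the value of an arrow from this
  one-point object. Testing a universal property on it turns the property into a statement about
  points.\<close>

lemma point:
  assumes "b \<in> topspace B"
  obtains W w where "W \<in> Ob C" "pts W = {w}" "\<pi> W w = b"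
    "\<forall>Y y. Y \<in> Ob C \<and> y \<in> pts Y \<and> \<pi> Y y = b \<longrightarrow> mk W (\<lambda>_. y) \<in> Hom C W Y"
proof -
  fix w :: 'u
  have "topspace (discrete_topology {w}) \<in> U" using U_small[OF small_finite] by simp
  moreover have "continuous_map (discrete_topology {w}) B (\<lambda>_. b)" using assms by simp
  ultimately obtain W where W: "W \<in> Ob C" "T W = discrete_topology {w}" "\<pi> W w = b"
    using Ob_ex[OF tame_singleton[of d w], of "\<lambda>_. b"] by auto
  have "mk W (\<lambda>_. y) \<in> Hom C W Y" if "Y \<in> Ob C" "y \<in> pts Y" "\<pi> Y y = b" for Y y
    using that W by (intro mk_Hom) auto
  then show ?thesis using that[of W w] W by simp
qed

section \<open>Products and pullbacks as sets of pairs\<close>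

definition fibre_product :: "'o \<Rightarrow> 'o \<Rightarrow> ('u \<times> 'u) set" where
  "fibre_product A A' = {(a, b). a \<in> pts A \<and> b \<in> pts A' \<and> \<pi> A a = \<pi> A' b}"

text \<open>Treats products and pullbacks at once: \<open>D\<close> is the fibre product over the
  base for the former and the set of pairs with equal images for the latter. No topology is
  mentioned because it is forced by continuity of the two legs.\<close>

definition joint_bij :: "'o \<Rightarrow> 'o \<Rightarrow> 'o \<Rightarrow> ('u \<rightharpoonup> 'u) \<Rightarrow> ('u \<rightharpoonup> 'u) \<Rightarrow> ('u \<times> 'u) set \<Rightarrow> bool" where
  "joint_bij P A A' p q D \<longleftrightarrow> P \<in> Ob C \<and> A \<in> Ob C \<and> A' \<in> Ob C \<and> p \<in> Hom C P A \<and> q \<in> Hom C P A' \<and>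
     bij_betw (\<lambda>z. (ap p z, ap q z)) (pts P) D"

text \<open>The image of the tame space \<open>T P\<close> is closed, so \<open>D\<close> is itself
  a tame space, and a continuous bijection between tame spaces is a homeomorphism.\<close>

lemma joint_bij_inverse:
  assumes "joint_bij P A A' p q D"
  obtains g where "continuous_map (subtopology (prod_topology (T A) (T A')) D) (T P) g"
    "\<forall>a b. (a, b) \<in> D \<longrightarrow> g (a, b) \<in> pts P \<and> ap p (g (a, b)) = a \<and> ap q (g (a, b)) = b"
    "\<forall>z\<in>pts P. g (ap p z, ap q z) = z" "D \<subseteq> pts A \<times> pts A'"
proof -
  have j: "P \<in> Ob C" "A \<in> Ob C" "A' \<in> Ob C" "p \<in> Hom C P A" "q \<in> Hom C P A'"
    and bij: "bij_betw (\<lambda>z. (ap p z, ap q z)) (pts P) D"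
    using assms by (auto simp: joint_bij_def)
  let ?f = "\<lambda>z. (ap p z, ap q z)"
  let ?S = "subtopology (prod_topology (T A) (T A')) D"
  have tp: "tame d (prod_topology (T A) (T A'))" by (intro tame_prod Ob_tame j)
  have c: "continuous_map (T P) (prod_topology (T A) (T A')) ?f"
    by (intro continuous_map_pairedI Hom_cont j)
  have im: "?f ` pts P = D" using bij by (simp add: bij_betw_def)
  have "closedin (prod_topology (T A) (T A')) D"
    using tame_closed_image[OF Ob_tame[OF j(1)] tp c closedin_topspace] im by simp
  then have tS: "tame d ?S" by (rule tame_closed_subtopology[OF tp])
  have DS: "D \<subseteq> pts A \<times> pts A'"
    using continuous_map_image_subset_topspace[OF c] im by simp
  then have ts: "topspace ?S = D" by auto
  have cS: "continuous_map (T P) ?S ?f" using c im by (auto simp: continuous_map_in_subtopology)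
  have "homeomorphic_map (T P) ?S ?f"
    by (rule tame_bij_homeomorphic[OF _ tS cS]) (use Ob_tame[OF j(1)] bij ts in \<open>auto simp: tame_def\<close>)
  then obtain g where g: "homeomorphic_maps (T P) ?S ?f g" using homeomorphic_map_maps by blast
  show ?thesis
  proof (rule that[of g])
    show "continuous_map ?S (T P) g" using g by (simp add: homeomorphic_maps_def)
    then have "g x \<in> pts P" if "x \<in> D" for x
      using continuous_map_image_subset_topspace ts that by blast
    moreover have "?f (g x) = x" if "x \<in> D" for x
      using g that ts unfolding homeomorphic_maps_def by metis
    ultimately show "\<forall>a b. (a, b) \<in> D \<longrightarrow> g (a, b) \<in> pts P \<and> ap p (g (a, b)) = a \<and> ap q (g (a, b)) = b"
      by (metis Pair_inject)
    show "\<forall>z\<in>pts P. g (ap p z, ap q z) = z"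
      using g unfolding homeomorphic_maps_def by metis
  qed (rule DS)
qed

lemma joint_bij_inj:
  "\<lbrakk>joint_bij P A A' p q D; z \<in> pts P; z' \<in> pts P; ap p z = ap p z'; ap q z = ap q z'\<rbrakk> \<Longrightarrow> z = z'"
  unfolding joint_bij_def bij_betw_def by (elim conjE, erule inj_onD) simp_all

text \<open>The arrow wanted is the pair of \<open>u\<close> and \<open>v\<close> followed by the
  continuous inverse of the two legs.\<close>

lemma joint_bij_lift:
  assumes j: "joint_bij P A A' p q D"
    and X: "X \<in> Ob C" "u \<in> Hom C X A" "v \<in> Hom C X A'" and D: "\<And>x. x \<in> pts X \<Longrightarrow> (ap u x, ap v x) \<in> D"
  shows "\<exists>!h. h \<in> Hom C X P \<and> p \<odot>\<^bsub>C\<^esub> h = u \<and> q \<odot>\<^bsub>C\<^esub> h = v"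
proof -
  have o: "P \<in> Ob C" "A \<in> Ob C" "A' \<in> Ob C" "p \<in> Hom C P A" "q \<in> Hom C P A'"
    using j by (auto simp: joint_bij_def)
  obtain g where g1: "continuous_map (subtopology (prod_topology (T A) (T A')) D) (T P) g"
    and g': "\<forall>a b. (a, b) \<in> D \<longrightarrow> g (a, b) \<in> pts P \<and> ap p (g (a, b)) = a \<and> ap q (g (a, b)) = b"
    using joint_bij_inverse[OF j] by metis
  note g = g1 g'[rule_format]
  have "continuous_map (T X) (subtopology (prod_topology (T A) (T A')) D) (\<lambda>x. (ap u x, ap v x))"
    using D X o by (auto simp: continuous_map_in_subtopology intro!: continuous_map_pairedI Hom_cont)
  from continuous_map_compose[OF this g(1)]
  have c: "continuous_map (T X) (T P) (\<lambda>x. g (ap u x, ap v x))" by (simp add: comp_def)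
  let ?h = "mk X (\<lambda>x. g (ap u x, ap v x))"
  have h: "?h \<in> Hom C X P"
  proof (rule mk_Hom[OF X(1) o(1) c])
    fix x assume x: "x \<in> pts X"
    have "\<pi> P (g (ap u x, ap v x)) = \<pi> A (ap p (g (ap u x, ap v x)))"
      using Hom_\<pi>[OF o(4,1,2)] g(2)[OF D[OF x]] by metis
    then show "\<pi> P (g (ap u x, ap v x)) = \<pi> X x" using g(2)[OF D[OF x]] Hom_\<pi>[OF X(2,1) o(2) x] by simp
  qed
  have hu: "p \<odot>\<^bsub>C\<^esub> ?h = u" "q \<odot>\<^bsub>C\<^esub> ?h = v"
    using Comp_eqI[OF h o(4) X(2,1) o(1,2)] Comp_eqI[OF h o(5) X(3,1) o(1,3)] g(2)[OF D] by (simp_all add: ap_mk)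
  show ?thesis
  proof (rule ex1I[of _ ?h])
    fix k assume k: "k \<in> Hom C X P \<and> p \<odot>\<^bsub>C\<^esub> k = u \<and> q \<odot>\<^bsub>C\<^esub> k = v"
    show "k = ?h"
    proof (rule Hom_ext[OF _ h X(1) o(1)])
      fix x assume x: "x \<in> pts X"
      have "ap p (ap k x) = ap p (ap ?h x)" "ap q (ap k x) = ap q (ap ?h x)"
        using k hu ap_Comp[OF h X(1) o(1) x] ap_Comp[of k X P x, OF _ X(1) o(1) x] by metis+
      then show "ap k x = ap ?h x"
        using joint_bij_inj[OF j] Hom_in[OF h X(1) o(1) x] Hom_in[of k X P x] k X o x by blast
    qed (use k in blast)
  qed (use h hu in blast)
qed

text \<open>A closed set of pairs is tame and small, so it can be copied into \<open>'u\<close>. The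
  structure map is read off from the first coordinate; the second projection respects it because
  \<open>D\<close> lies in the fibre product.\<close>

lemma joint_bij_ex:
  assumes A: "A \<in> Ob C" "A' \<in> Ob C" and D: "D \<subseteq> fibre_product A A'"
    and cl: "closedin (prod_topology (T A) (T A')) D"
  obtains P p q where "joint_bij P A A' p q D"
proof -
  let ?S = "subtopology (prod_topology (T A) (T A')) D"
  have ts: "topspace ?S = D" using D by (auto simp: fibre_product_def)
  have tS: "tame d ?S" using cl by (intro tame_closed_subtopology tame_prod Ob_tame A)
  have "small D"
    by (rule small_subset[OF _ small_Times[OF small_U[OF Ob_U[OF A(1)]] small_U[OF Ob_U[OF A(2)]]]])
      (use D in \<open>auto simp: fibre_product_def\<close>)
  then obtain f :: "'u \<times> 'u \<Rightarrow> 'u" where f: "inj_on f D" "f ` D \<in> U" by (rule small_embed)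
  obtain Z where Z: "topspace Z = f ` topspace ?S" "homeomorphic_map ?S Z f" "tame d Z"
    by (rule tame_transport[OF tS]) (use f ts in auto)
  obtain g where g: "homeomorphic_maps ?S Z f g" using Z(2) homeomorphic_map_maps by blast
  have cg: "continuous_map Z ?S g" using g by (simp add: homeomorphic_maps_def)
  then have cg': "continuous_map Z (prod_topology (T A) (T A')) g" by (simp add: continuous_map_in_subtopology)
  have c1: "continuous_map Z (T A) (\<lambda>z. fst (g z))" "continuous_map Z (T A') (\<lambda>z. snd (g z))"
    using continuous_map_compose[OF cg' continuous_map_fst] continuous_map_compose[OF cg' continuous_map_snd]
    by (simp_all add: comp_def)
  have "topspace Z \<in> U" using f(2) Z(1) ts by simp
  moreover have "continuous_map Z B (\<lambda>z. \<pi> A (fst (g z)))"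
    using continuous_map_compose[OF c1(1) Ob_\<pi>[OF A(1)]] by (simp add: comp_def)
  ultimately obtain P where P: "P \<in> Ob C" "T P = Z" "\<And>z. z \<in> topspace Z \<Longrightarrow> \<pi> P z = \<pi> A (fst (g z))"
    using Ob_ex[OF Z(3)] by metis
  have gD: "g z \<in> D" if "z \<in> topspace Z" for z
    using continuous_map_image_subset_topspace[OF cg] that ts by blast
  let ?p = "mk P (\<lambda>z. fst (g z))" and ?q = "mk P (\<lambda>z. snd (g z))"
  have "?p \<in> Hom C P A" using P c1 by (intro mk_Hom A) auto
  moreover have "?q \<in> Hom C P A'"
  proof (rule mk_Hom[OF P(1) A(2)])
    fix x assume "x \<in> pts P"
    then show "\<pi> A' (snd (g x)) = \<pi> P x" using P gD[of x] D by (auto simp: fibre_product_def)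
  qed (use P c1 in simp)
  moreover have "bij_betw (\<lambda>z. (ap ?p z, ap ?q z)) (pts P) D"
  proof (rule bij_betwI[where g=f])
    show "(\<lambda>z. (ap ?p z, ap ?q z)) \<in> pts P \<rightarrow> D" using gD P(2) by (simp add: ap_mk)
    show "f \<in> D \<rightarrow> pts P" using P(2) Z(1) ts by auto
    show "f (ap ?p z, ap ?q z) = z" if "z \<in> pts P" for z
      using that P(2) g by (simp add: ap_mk homeomorphic_maps_def)
    fix y assume y: "y \<in> D"
    then have fy: "f y \<in> pts P" using P(2) Z(1) ts by auto
    have "g (f y) = y" using y ts g unfolding homeomorphic_maps_def by metis
    then show "(ap ?p (f y), ap ?q (f y)) = y" using fy by (simp add: ap_mk)
  qed
  ultimately show ?thesis using that A P(1) unfolding joint_bij_def by blast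
qed

text \<open>Universality is tested on one-point objects: uniqueness of the lift makes the two legs
  jointly injective, and existence shows that every pair in \<open>D\<close> is hit.\<close>

lemma joint_bij_of_universal:
  assumes o: "P \<in> Ob C" "A \<in> Ob C" "A' \<in> Ob C" "p \<in> Hom C P A" "q \<in> Hom C P A'"
    and D: "D \<subseteq> fibre_product A A'" and pD: "\<And>z. z \<in> pts P \<Longrightarrow> (ap p z, ap q z) \<in> D"
    and univ: "\<And>X u v. X \<in> Ob C \<Longrightarrow> u \<in> Hom C X A \<Longrightarrow> v \<in> Hom C X A' \<Longrightarrow>
      (\<And>x. x \<in> pts X \<Longrightarrow> (ap u x, ap v x) \<in> D) \<Longrightarrow>
      \<exists>!h. h \<in> Hom C X P \<and> p \<odot>\<^bsub>C\<^esub> h = u \<and> q \<odot>\<^bsub>C\<^esub> h = v"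
  shows "joint_bij P A A' p q D"
proof -
  have "inj_on (\<lambda>z. (ap p z, ap q z)) (pts P)"
  proof (rule inj_onI)
    fix z z' assume z: "z \<in> pts P" "z' \<in> pts P" "(ap p z, ap q z) = (ap p z', ap q z')"
    have \<pi>: "\<pi> P z' = \<pi> P z" using Hom_\<pi>[OF o(4,1,2)] z by (metis Pair_inject)
    obtain W w where W: "W \<in> Ob C" "pts W = {w}"
      "\<forall>Y y. Y \<in> Ob C \<and> y \<in> pts Y \<and> \<pi> Y y = \<pi> P z \<longrightarrow> mk W (\<lambda>_. y) \<in> Hom C W Y"
      using point[OF \<pi>_in[OF o(1) z(1)]] by metis
    have h: "mk W (\<lambda>_. z) \<in> Hom C W P" "mk W (\<lambda>_. z') \<in> Hom C W P" using W(3) o z \<pi> by blast+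
    have "p \<odot>\<^bsub>C\<^esub> mk W (\<lambda>_. z') = p \<odot>\<^bsub>C\<^esub> mk W (\<lambda>_. z)" "q \<odot>\<^bsub>C\<^esub> mk W (\<lambda>_. z') = q \<odot>\<^bsub>C\<^esub> mk W (\<lambda>_. z)"
      using z(3) Comp_eq_Comp_iff[OF h(2) o(4) h(1) o(4) W(1) o(1,1,2)]
        Comp_eq_Comp_iff[OF h(2) o(5) h(1) o(5) W(1) o(1,1,3)] by (simp_all add: ap_mk W(2))
    moreover have "\<exists>!h. h \<in> Hom C W P \<and> p \<odot>\<^bsub>C\<^esub> h = p \<odot>\<^bsub>C\<^esub> mk W (\<lambda>_. z) \<and> q \<odot>\<^bsub>C\<^esub> h = q \<odot>\<^bsub>C\<^esub> mk W (\<lambda>_. z)"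
      by (rule univ[OF W(1) Comp_Hom[OF h(1) o(4) W(1) o(1,2)] Comp_Hom[OF h(1) o(5) W(1) o(1,3)]])
        (simp add: ap_Comp[OF h(1) W(1) o(1)] ap_mk pD z(1))
    ultimately have "mk W (\<lambda>_. z) = mk W (\<lambda>_. z')" using h by blast
    then have "ap (mk W (\<lambda>_. z)) w = ap (mk W (\<lambda>_. z')) w" by simp
    then show "z = z'" using W(2) by (simp add: ap_mk)
  qed
  moreover have "\<exists>z\<in>pts P. (ap p z, ap q z) = (a, b)" if ab: "(a, b) \<in> D" for a b
  proof -
    have a: "a \<in> pts A" "b \<in> pts A'" "\<pi> A' b = \<pi> A a" using ab D by (auto simp: fibre_product_def)
    obtain W w where W: "W \<in> Ob C" "pts W = {w}"
      "\<forall>Y y. Y \<in> Ob C \<and> y \<in> pts Y \<and> \<pi> Y y = \<pi> A a \<longrightarrow> mk W (\<lambda>_. y) \<in> Hom C W Y"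
      using point[OF \<pi>_in[OF o(2) a(1)]] by metis
    have "\<exists>!h. h \<in> Hom C W P \<and> p \<odot>\<^bsub>C\<^esub> h = mk W (\<lambda>_. a) \<and> q \<odot>\<^bsub>C\<^esub> h = mk W (\<lambda>_. b)"
      by (rule univ[OF W(1)]) (use W o a ab in \<open>simp_all add: ap_mk\<close>)
    then obtain h where h: "h \<in> Hom C W P" "p \<odot>\<^bsub>C\<^esub> h = mk W (\<lambda>_. a)" "q \<odot>\<^bsub>C\<^esub> h = mk W (\<lambda>_. b)" by blast
    have w: "w \<in> pts W" using W(2) by simp
    have "ap p (ap h w) = a" "ap q (ap h w) = b"
      using ap_Comp[OF h(1) W(1) o(1) w, of p] ap_Comp[OF h(1) W(1) o(1) w, of q] h(2,3) w by (simp_all add: ap_mk)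
    then show ?thesis using Hom_in[OF h(1) W(1) o(1) w] by blast
  qed
  then have "(\<lambda>z. (ap p z, ap q z)) ` pts P = D" using pD by force
  ultimately show ?thesis using o by (simp add: joint_bij_def bij_betw_def)
qed

lemma Hom_fibre_product:
  "\<lbrakk>f \<in> Hom C X A; g \<in> Hom C X A'; X \<in> Ob C; A \<in> Ob C; A' \<in> Ob C; x \<in> pts X\<rbrakk> \<Longrightarrow> (ap f x, ap g x) \<in> fibre_product A A'"
  by (simp add: fibre_product_def Hom_in Hom_\<pi>)

lemma is_product_iff: "is_product C A A' P p q \<longleftrightarrow> joint_bij P A A' p q (fibre_product A A')"
proof
  assume P: "is_product C A A' P p q"
  then have o: "P \<in> Ob C" "A \<in> Ob C" "A' \<in> Ob C" "p \<in> Hom C P A" "q \<in> Hom C P A'"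
    by (auto simp: is_product_def)
  show "joint_bij P A A' p q (fibre_product A A')"
    by (rule joint_bij_of_universal[OF o]) (use P Hom_fibre_product o in \<open>auto simp: is_product_def\<close>)
next
  assume j: "joint_bij P A A' p q (fibre_product A A')"
  then have o: "P \<in> Ob C" "A \<in> Ob C" "A' \<in> Ob C" "p \<in> Hom C P A" "q \<in> Hom C P A'"
    by (auto simp: joint_bij_def)
  show "is_product C A A' P p q"
    unfolding is_product_def using o joint_bij_lift[OF j] Hom_fibre_product by blast
qed

lemma is_pullback_iff:
  assumes o: "A \<in> Ob C" "A' \<in> Ob C" "Z \<in> Ob C" "f \<in> Hom C A Z" "g \<in> Hom C A' Z"
  shows "is_pullback C A A' Z f g P p q \<longleftrightarrow>
    joint_bij P A A' p q {(a, b). a \<in> pts A \<and> b \<in> pts A' \<and> ap f a = ap g b}" (is "_ \<longleftrightarrow> joint_bij P A A' p q ?D")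
proof -
  have D: "?D \<subseteq> fibre_product A A'"
    using Hom_\<pi>[OF o(4,1,3)] Hom_\<pi>[OF o(5,2,3)] unfolding fibre_product_def by force
  have eq: "f \<odot>\<^bsub>C\<^esub> u = g \<odot>\<^bsub>C\<^esub> v \<longleftrightarrow> (\<forall>x\<in>pts X. (ap u x, ap v x) \<in> ?D)"
    if "X \<in> Ob C" "u \<in> Hom C X A" "v \<in> Hom C X A'" for X u v
    using Comp_eq_Comp_iff[OF that(2) o(4) that(3) o(5) that(1) o(1-3)]
      Hom_in[OF that(2,1) o(1)] Hom_in[OF that(3,1) o(2)] by simp
  show ?thesis
  proof
    assume P: "is_pullback C A A' Z f g P p q"
    then have oP: "P \<in> Ob C" "p \<in> Hom C P A" "q \<in> Hom C P A'" by (auto simp: is_pullback_def)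
    show "joint_bij P A A' p q ?D"
    proof (rule joint_bij_of_universal[OF oP(1) o(1,2) oP(2,3) D])
      show "(ap p z, ap q z) \<in> ?D" if "z \<in> pts P" for z
        using eq[OF oP] P that unfolding is_pullback_def by blast
      show "\<exists>!h. h \<in> Hom C X P \<and> p \<odot>\<^bsub>C\<^esub> h = u \<and> q \<odot>\<^bsub>C\<^esub> h = v"
        if X: "X \<in> Ob C" "u \<in> Hom C X A" "v \<in> Hom C X A'" and "\<And>x. x \<in> pts X \<Longrightarrow> (ap u x, ap v x) \<in> ?D" for X u v
      proof -
        have "f \<odot>\<^bsub>C\<^esub> u = g \<odot>\<^bsub>C\<^esub> v" using eq[OF X] that(4) by blast
        then show ?thesis using P X unfolding is_pullback_def by blast
      qed
    qed
  next
    assume j: "joint_bij P A A' p q ?D"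
    then have oP: "P \<in> Ob C" "p \<in> Hom C P A" "q \<in> Hom C P A'" by (auto simp: joint_bij_def)
    have "\<forall>z\<in>pts P. (ap p z, ap q z) \<in> ?D" using j unfolding joint_bij_def bij_betw_def by blast
    then have "f \<odot>\<^bsub>C\<^esub> p = g \<odot>\<^bsub>C\<^esub> q" using eq[OF oP] by blast
    moreover have "\<exists>!h. h \<in> Hom C X P \<and> p \<odot>\<^bsub>C\<^esub> h = u \<and> q \<odot>\<^bsub>C\<^esub> h = v"
      if "X \<in> Ob C" "u \<in> Hom C X A" "v \<in> Hom C X A'" "f \<odot>\<^bsub>C\<^esub> u = g \<odot>\<^bsub>C\<^esub> v" for X u v
      by (rule joint_bij_lift[OF j that(1-3)]) (use eq[OF that(1-3)] that(4) in blast)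
    ultimately show "is_pullback C A A' Z f g P p q" using o oP unfolding is_pullback_def by blast
  qed
qed

lemma closedin_fibre_product:
  assumes "A \<in> Ob C" "A' \<in> Ob C" shows "closedin (prod_topology (T A) (T A')) (fibre_product A A')"
proof -
  have "closedin (prod_topology (T A) (T A'))
      {x \<in> topspace (prod_topology (T A) (T A')). (\<pi> A \<circ> fst) x = (\<pi> A' \<circ> snd) x}"
    by (rule closedin_continuous_maps_eq[OF tame_Hausdorff[OF tame_B]
        continuous_map_compose[OF continuous_map_fst Ob_\<pi>[OF assms(1)]]
        continuous_map_compose[OF continuous_map_snd Ob_\<pi>[OF assms(2)]]])
  moreover have "{x \<in> topspace (prod_topology (T A) (T A')). (\<pi> A \<circ> fst) x = (\<pi> A' \<circ> snd) x} = fibre_product A A'"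
    by (auto simp: fibre_product_def)
  ultimately show ?thesis by simp
qed

lemma closedin_pullback:
  assumes o: "A \<in> Ob C" "A' \<in> Ob C" "Z \<in> Ob C" "f \<in> Hom C A Z" "g \<in> Hom C A' Z"
  shows "closedin (prod_topology (T A) (T A')) {(a, b). a \<in> pts A \<and> b \<in> pts A' \<and> ap f a = ap g b}"
proof -
  have "closedin (prod_topology (T A) (T A'))
      {x \<in> topspace (prod_topology (T A) (T A')). (ap f \<circ> fst) x = (ap g \<circ> snd) x}"
    by (rule closedin_continuous_maps_eq[OF tame_Hausdorff[OF Ob_tame[OF o(3)]]
        continuous_map_compose[OF continuous_map_fst Hom_cont[OF o(4,1,3)]]
        continuous_map_compose[OF continuous_map_snd Hom_cont[OF o(5,2,3)]]])
  moreover have "{x \<in> topspace (prod_topology (T A) (T A')). (ap f \<circ> fst) x = (ap g \<circ> snd) x}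
      = {(a, b). a \<in> pts A \<and> b \<in> pts A' \<and> ap f a = ap g b}"
    by auto
  ultimately show ?thesis by simp
qed

lemma pullback_sub:
  assumes o: "A \<in> Ob C" "A' \<in> Ob C" "Z \<in> Ob C" "f \<in> Hom C A Z" "g \<in> Hom C A' Z"
  shows "{(a, b). a \<in> pts A \<and> b \<in> pts A' \<and> ap f a = ap g b} \<subseteq> fibre_product A A'"
  using Hom_\<pi>[OF o(4,1,3)] Hom_\<pi>[OF o(5,2,3)] unfolding fibre_product_def by force

lemma pullback_ex:
  assumes o: "A \<in> Ob C" "A' \<in> Ob C" "Z \<in> Ob C" "f \<in> Hom C A Z" "g \<in> Hom C A' Z"
  shows "\<exists>P p q. is_pullback C A A' Z f g P p q"
  unfolding is_pullback_iff[OF o]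
  using joint_bij_ex[OF o(1,2) pullback_sub[OF o] closedin_pullback[OF o]] by metis

lemma product_ex: "A \<in> Ob C \<Longrightarrow> A' \<in> Ob C \<Longrightarrow> \<exists>P p q. is_product C A A' P p q"
  unfolding is_product_iff
  using joint_bij_ex[OF _ _ subset_refl closedin_fibre_product] by metis

text \<open>Two points with the same image lie over the same base point, so they give two arrows
  from a single one-point object, and the mono identifies these.\<close>

lemma mono_inj:
  assumes m: "is_mono C X Y f" shows "inj_on (ap f) (pts X)"
proof (rule inj_onI)
  fix x x' assume x: "x \<in> pts X" "x' \<in> pts X" "ap f x = ap f x'"
  have o: "X \<in> Ob C" "Y \<in> Ob C" "f \<in> Hom C X Y" using m by (auto simp: is_mono_def)
  have \<pi>: "\<pi> X x' = \<pi> X x" using Hom_\<pi>[OF o(3,1,2)] x by metis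
  obtain W w where W: "W \<in> Ob C" "pts W = {w}"
    "\<forall>Y y. Y \<in> Ob C \<and> y \<in> pts Y \<and> \<pi> Y y = \<pi> X x \<longrightarrow> mk W (\<lambda>_. y) \<in> Hom C W Y"
    using point[OF \<pi>_in[OF o(1) x(1)]] by metis
  have h: "mk W (\<lambda>_. x) \<in> Hom C W X" "mk W (\<lambda>_. x') \<in> Hom C W X" using W(3) o x \<pi> by blast+
  have "f \<odot>\<^bsub>C\<^esub> mk W (\<lambda>_. x) = f \<odot>\<^bsub>C\<^esub> mk W (\<lambda>_. x')"
    using Comp_eq_Comp_iff[OF h(1) o(3) h(2) o(3) W(1) o(1,1,2)] x(3) by (simp add: ap_mk W(2))
  then have "mk W (\<lambda>_. x) = mk W (\<lambda>_. x')" using m W(1) h unfolding is_mono_def by blast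
  then have "ap (mk W (\<lambda>_. x)) w = ap (mk W (\<lambda>_. x')) w" by simp
  then show "x = x'" using W(2) by (simp add: ap_mk)
qed

end

section \<open>Terminal objects, chosen products, coequalisers and regularity\<close>

context concrete_cat begin

text \<open>The base is terminal over itself; it is copied into \<open>'u\<close>, with the inverse
  of the copying as structure map.\<close>

lemma terminal_ex: "\<exists>t. is_terminal C t"
proof -
  obtain f :: "'b \<Rightarrow> 'u" where f: "inj_on f (topspace B)" "f ` topspace B \<in> U"
    by (rule small_embed[OF small_B])
  obtain Z where Z: "topspace Z = f ` topspace B" "homeomorphic_map B Z f" "tame d Z"
    by (rule tame_transport[OF tame_B f(1)])
  obtain g where g: "homeomorphic_maps B Z f g" using Z(2) homeomorphic_map_maps by blast
  then have cf: "continuous_map B Z f" and cg: "continuous_map Z B g"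
    and fg: "\<And>z. z \<in> topspace Z \<Longrightarrow> f (g z) = z" and gf: "\<And>b. b \<in> topspace B \<Longrightarrow> g (f b) = b"
    by (auto simp: homeomorphic_maps_def)
  have "topspace Z \<in> U" using Z f by simp
  then obtain t where t: "t \<in> Ob C" "T t = Z" "\<And>z. z \<in> topspace Z \<Longrightarrow> \<pi> t z = g z"
    using Ob_ex[OF Z(3) _ cg] by metis
  have "\<exists>!h. h \<in> Hom C X t" if X: "X \<in> Ob C" for X
  proof (rule ex1I[of _ "mk X (\<lambda>x. f (\<pi> X x))"])
    have fin: "f (\<pi> X x) \<in> topspace Z" if "x \<in> pts X" for x using \<pi>_in[OF X that] Z(1) by blast
    have "continuous_map (T X) (T t) (\<lambda>x. f (\<pi> X x))"
      using continuous_map_compose[OF Ob_\<pi>[OF X] cf] t by (simp add: comp_def)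
    then show mk: "mk X (\<lambda>x. f (\<pi> X x)) \<in> Hom C X t"
      by (rule mk_Hom[OF X t(1)]) (simp add: t(3) fin gf \<pi>_in[OF X])
    fix h assume h: "h \<in> Hom C X t"
    show "h = mk X (\<lambda>x. f (\<pi> X x))"
    proof (rule Hom_ext[OF h mk X t(1)])
      fix x assume x: "x \<in> pts X"
      have "ap h x \<in> topspace Z" using Hom_in[OF h X t(1) x] t(2) by simp
      then have "ap h x = f (\<pi> t (ap h x))" using fg t(3) by simp
      then show "ap h x = ap (mk X (\<lambda>x. f (\<pi> X x))) x" using Hom_\<pi>[OF h X t(1) x] x by (simp add: ap_mk)
    qed
  qed
  then have "is_terminal C t" using t(1) by (simp add: is_terminal_def)
  then show ?thesis ..
qed

lemma terminal_obj: "is_terminal C (terminal_obj C)"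
  unfolding terminal_obj_def using terminal_ex by (rule someI_ex)

lemma terminal_Ob: "terminal_obj C \<in> Ob C"
  by (rule terminal_obj[unfolded is_terminal_def, THEN conjunct1])

lemma to_terminal_Hom: "X \<in> Ob C \<Longrightarrow> to_terminal C X \<in> Hom C X (terminal_obj C)"
  unfolding to_terminal_def
  by (rule theI'[OF bspec[OF terminal_obj[unfolded is_terminal_def, THEN conjunct2]]])

lemma terminal_unique:
  "X \<in> Ob C \<Longrightarrow> f \<in> Hom C X (terminal_obj C) \<Longrightarrow> g \<in> Hom C X (terminal_obj C) \<Longrightarrow> f = g"
  using bspec[OF terminal_obj[unfolded is_terminal_def, THEN conjunct2], of X] by blast

text \<open>The chosen terminal object is arbitrary, so its points are found by testing on one-point
  objects: uniqueness of arrows gives injectivity and existence gives surjectivity.\<close>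

lemma terminal_bij: "bij_betw (\<pi> (terminal_obj C)) (pts (terminal_obj C)) (topspace B)"
proof -
  let ?t = "terminal_obj C"
  have "inj_on (\<pi> ?t) (pts ?t)"
  proof (rule inj_onI)
    fix z z' assume z: "z \<in> pts ?t" "z' \<in> pts ?t" "\<pi> ?t z = \<pi> ?t z'"
    obtain W w where W: "W \<in> Ob C" "pts W = {w}"
      "\<forall>Y y. Y \<in> Ob C \<and> y \<in> pts Y \<and> \<pi> Y y = \<pi> ?t z \<longrightarrow> mk W (\<lambda>_. y) \<in> Hom C W Y"
      using point[OF \<pi>_in[OF terminal_Ob z(1)]] by metis
    have "mk W (\<lambda>_. z) = mk W (\<lambda>_. z')"
      by (rule terminal_unique[OF W(1)]) (use W(3) z terminal_Ob in auto)
    then have "ap (mk W (\<lambda>_. z)) w = ap (mk W (\<lambda>_. z')) w" by simp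
    then show "z = z'" using W(2) by (simp add: ap_mk)
  qed
  moreover have "b \<in> \<pi> ?t ` pts ?t" if b: "b \<in> topspace B" for b
  proof -
    obtain W w where W: "W \<in> Ob C" "pts W = {w}" "\<pi> W w = b"
      using point[OF b] by metis
    have w: "w \<in> pts W" using W(2) by simp
    have "\<pi> ?t (ap (to_terminal C W) w) = b"
      using Hom_\<pi>[OF to_terminal_Hom[OF W(1)] W(1) terminal_Ob w] W(3) by simp
    then show ?thesis using Hom_in[OF to_terminal_Hom[OF W(1)] W(1) terminal_Ob w] by blast
  qed
  ultimately show ?thesis using \<pi>_in[OF terminal_Ob] by (auto simp: bij_betw_def)
qed

definition tm :: "'b \<Rightarrow> 'u" where
  "tm b = inv_into (pts (terminal_obj C)) (\<pi> (terminal_obj C)) b"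

lemma tm: "b \<in> topspace B \<Longrightarrow> tm b \<in> pts (terminal_obj C)" "b \<in> topspace B \<Longrightarrow> \<pi> (terminal_obj C) (tm b) = b"
  "t \<in> pts (terminal_obj C) \<Longrightarrow> tm (\<pi> (terminal_obj C) t) = t"
  unfolding tm_def using terminal_bij
  by (auto simp: bij_betw_def inv_into_into f_inv_into_f)

lemma ap_to_terminal:
  assumes "X \<in> Ob C" "x \<in> pts X" shows "ap (to_terminal C X) x = tm (\<pi> X x)"
  using tm(3)[OF Hom_in[OF to_terminal_Hom[OF assms(1)] assms(1) terminal_Ob assms(2)]]
    Hom_\<pi>[OF to_terminal_Hom[OF assms(1)] assms(1) terminal_Ob assms(2)] by simp

lemma prod_cone:
  assumes "A \<in> Ob C" "A' \<in> Ob C"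
  shows "joint_bij (prod_obj C A A') A A' (proj1 C A A') (proj2 C A A') (fibre_product A A')"
proof -
  have "\<exists>x. case x of (P, p, q) \<Rightarrow> is_product C A A' P p q" using product_ex[OF assms] by auto
  then have "case prod_cone C A A' of (P, p, q) \<Rightarrow> is_product C A A' P p q"
    unfolding prod_cone_def by (rule someI_ex)
  then show ?thesis
    by (simp add: is_product_iff prod_obj_def proj1_def proj2_def case_prod_unfold)
qed

lemma prod_Ob: "A \<in> Ob C \<Longrightarrow> A' \<in> Ob C \<Longrightarrow> prod_obj C A A' \<in> Ob C"
  and proj1_Hom: "A \<in> Ob C \<Longrightarrow> A' \<in> Ob C \<Longrightarrow> proj1 C A A' \<in> Hom C (prod_obj C A A') A"
  and proj2_Hom: "A \<in> Ob C \<Longrightarrow> A' \<in> Ob C \<Longrightarrow> proj2 C A A' \<in> Hom C (prod_obj C A A') A'"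
  using prod_cone by (auto simp: joint_bij_def)

text \<open>The chosen product is known only up to isomorphism, so its points are named by their
  coordinates. The value is meaningful only if \<open>a\<close> and \<open>b\<close> lie over the
  same base point.\<close>

definition pr :: "'o \<Rightarrow> 'o \<Rightarrow> 'u \<Rightarrow> 'u \<Rightarrow> 'u" where
  "pr A A' a b = inv_into (pts (prod_obj C A A')) (\<lambda>z. (ap (proj1 C A A') z, ap (proj2 C A A') z)) (a, b)"

lemma pr:
  assumes "A \<in> Ob C" "A' \<in> Ob C" "a \<in> pts A" "b \<in> pts A'" "\<pi> A a = \<pi> A' b"
  shows pr_in: "pr A A' a b \<in> pts (prod_obj C A A')"
    and proj1_pr: "ap (proj1 C A A') (pr A A' a b) = a"
    and proj2_pr: "ap (proj2 C A A') (pr A A' a b) = b"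
    and \<pi>_pr: "\<pi> (prod_obj C A A') (pr A A' a b) = \<pi> A a"
proof -
  let ?f = "\<lambda>z. (ap (proj1 C A A') z, ap (proj2 C A A') z)"
  have ab: "(a, b) \<in> ?f ` pts (prod_obj C A A')"
    using prod_cone[OF assms(1,2)] assms(3-5) unfolding joint_bij_def bij_betw_def fibre_product_def by auto
  show 1: "pr A A' a b \<in> pts (prod_obj C A A')" unfolding pr_def by (rule inv_into_into[OF ab])
  have "?f (pr A A' a b) = (a, b)" unfolding pr_def by (rule f_inv_into_f[OF ab])
  then show 2: "ap (proj1 C A A') (pr A A' a b) = a" "ap (proj2 C A A') (pr A A' a b) = b" by simp_all
  show "\<pi> (prod_obj C A A') (pr A A' a b) = \<pi> A a"
    using Hom_\<pi>[OF proj1_Hom[OF assms(1,2)] prod_Ob[OF assms(1,2)] assms(1) 1] 2 by simp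
qed

lemma prod_pts:
  assumes "A \<in> Ob C" "A' \<in> Ob C" "z \<in> pts (prod_obj C A A')"
  obtains a b where "a \<in> pts A" "b \<in> pts A'" "\<pi> A a = \<pi> A' b" "z = pr A A' a b"
proof -
  note o = assms(1,2) prod_Ob[OF assms(1,2)] and p = proj1_Hom[OF assms(1,2)] proj2_Hom[OF assms(1,2)]
  let ?a = "ap (proj1 C A A') z" and ?b = "ap (proj2 C A A') z"
  have ab: "?a \<in> pts A" "?b \<in> pts A'" "\<pi> A ?a = \<pi> A' ?b"
    using Hom_in[OF p(1) o(3,1) assms(3)] Hom_in[OF p(2) o(3,2) assms(3)]
      Hom_\<pi>[OF p(1) o(3,1) assms(3)] Hom_\<pi>[OF p(2) o(3,2) assms(3)] by simp_all
  have "z = pr A A' ?a ?b"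
    by (rule joint_bij_inj[OF prod_cone[OF o(1,2)] assms(3)]) (use pr[OF o(1,2) ab] in auto)
  then show ?thesis using that ab by blast
qed

lemma pr_cont:
  assumes "A \<in> Ob C" "A' \<in> Ob C" "continuous_map Z (T A) f" "continuous_map Z (T A') g"
    "\<And>z. z \<in> topspace Z \<Longrightarrow> \<pi> A (f z) = \<pi> A' (g z)"
  shows "continuous_map Z (T (prod_obj C A A')) (\<lambda>z. pr A A' (f z) (g z))"
proof -
  obtain k where k: "continuous_map (subtopology (prod_topology (T A) (T A')) (fibre_product A A')) (T (prod_obj C A A')) k"
    "\<forall>z\<in>pts (prod_obj C A A'). k (ap (proj1 C A A') z, ap (proj2 C A A') z) = z"
    using joint_bij_inverse[OF prod_cone[OF assms(1,2)]] by metis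
  have in_pts: "f z \<in> pts A" "g z \<in> pts A'" if "z \<in> topspace Z" for z
    using continuous_map_image_subset_topspace[OF assms(3)] continuous_map_image_subset_topspace[OF assms(4)] that by blast+
  have "continuous_map Z (subtopology (prod_topology (T A) (T A')) (fibre_product A A')) (\<lambda>z. (f z, g z))"
    unfolding continuous_map_in_subtopology
    using in_pts assms(5) by (auto simp: fibre_product_def intro!: continuous_map_pairedI assms(3,4))
  from continuous_map_compose[OF this k(1)] show ?thesis
  proof (rule continuous_map_eq)
    fix z assume z: "z \<in> topspace Z"
    show "(k \<circ> (\<lambda>z. (f z, g z))) z = pr A A' (f z) (g z)"
      using k(2) pr[OF assms(1,2) in_pts[OF z] assms(5)[OF z]] by (metis comp_apply)
  qed
qed

lemma pairing:
  assumes "X \<in> Ob C" "A \<in> Ob C" "A' \<in> Ob C" "f \<in> Hom C X A" "g \<in> Hom C X A'"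
  shows pairing_Hom: "pairing C X A A' f g \<in> Hom C X (prod_obj C A A')"
    and ap_pairing: "x \<in> pts X \<Longrightarrow> ap (pairing C X A A' f g) x = pr A A' (ap f x) (ap g x)"
proof -
  have "\<exists>!h. h \<in> Hom C X (prod_obj C A A') \<and> proj1 C A A' \<odot>\<^bsub>C\<^esub> h = f \<and> proj2 C A A' \<odot>\<^bsub>C\<^esub> h = g"
    by (rule joint_bij_lift[OF prod_cone[OF assms(2,3)] assms(1,4,5)])
      (rule Hom_fibre_product[OF assms(4,5,1,2,3)])
  from theI'[OF this]
  have h: "pairing C X A A' f g \<in> Hom C X (prod_obj C A A')"
    "proj1 C A A' \<odot>\<^bsub>C\<^esub> pairing C X A A' f g = f" "proj2 C A A' \<odot>\<^bsub>C\<^esub> pairing C X A A' f g = g"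
    unfolding pairing_def by auto
  show "pairing C X A A' f g \<in> Hom C X (prod_obj C A A')" by (rule h)
  assume x: "x \<in> pts X"
  let ?z = "ap (pairing C X A A' f g) x"
  have z: "?z \<in> pts (prod_obj C A A')" by (rule Hom_in[OF h(1) assms(1) prod_Ob[OF assms(2,3)] x])
  have c: "ap (proj1 C A A') ?z = ap f x" "ap (proj2 C A A') ?z = ap g x"
    using ap_Comp[OF h(1) assms(1) prod_Ob[OF assms(2,3)] x] h(2,3) by metis+
  obtain a b where ab: "a \<in> pts A" "b \<in> pts A'" "\<pi> A a = \<pi> A' b" "?z = pr A A' a b"
    by (rule prod_pts[OF assms(2,3) z])
  then show "?z = pr A A' (ap f x) (ap g x)"
    using c pr[OF assms(2,3) ab(1-3)] by simp
qed

definition coeq_sep :: "'o \<Rightarrow> 'o \<Rightarrow> ('u \<rightharpoonup> 'u) \<Rightarrow> ('u \<rightharpoonup> 'u) \<Rightarrow> 'u \<Rightarrow> 'u \<Rightarrow> bool" where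
  "coeq_sep X Y f g = clopen_sep_by (T Y) (\<lambda>V. \<forall>x\<in>pts X. ap f x \<in> V \<longleftrightarrow> ap g x \<in> V)"

text \<open>A surjection is a quotient map, so an arrow \<open>h\<close> descends along
  \<open>q\<close> as soon as it is constant on the fibres of \<open>q\<close>. The factorisation
  respects the base because \<open>h\<close> and \<open>q\<close> do.\<close>

lemma coequaliserI:
  assumes o: "X \<in> Ob C" "Y \<in> Ob C" "Q \<in> Ob C" "f \<in> Hom C X Y" "g \<in> Hom C X Y" "q \<in> Hom C Y Q"
    and surj: "ap q ` pts Y = pts Q" and eq: "\<And>x. x \<in> pts X \<Longrightarrow> ap q (ap f x) = ap q (ap g x)"
    and ker: "\<And>Z h y y'. Z \<in> Ob C \<Longrightarrow> h \<in> Hom C Y Z \<Longrightarrow>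
      (\<And>x. x \<in> pts X \<Longrightarrow> ap h (ap f x) = ap h (ap g x)) \<Longrightarrow>
      y \<in> pts Y \<Longrightarrow> y' \<in> pts Y \<Longrightarrow> ap q y = ap q y' \<Longrightarrow> ap h y = ap h y'"
  shows "is_coequaliser C X Y f g Q q"
proof -
  have "q \<odot>\<^bsub>C\<^esub> f = q \<odot>\<^bsub>C\<^esub> g"
    using Comp_eq_Comp_iff[OF o(4,6,5,6,1,2,2,3)] eq by blast
  moreover have "\<exists>!k. k \<in> Hom C Q Z \<and> k \<odot>\<^bsub>C\<^esub> q = h"
    if Z: "Z \<in> Ob C" "h \<in> Hom C Y Z" "h \<odot>\<^bsub>C\<^esub> f = h \<odot>\<^bsub>C\<^esub> g" for Z h
  proof -
    have hfg: "ap h (ap f x) = ap h (ap g x)" if "x \<in> pts X" for x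
      using Comp_eq_Comp_iff[OF o(4) Z(2) o(5) Z(2) o(1,2,2) Z(1)] Z(3) that by blast
    have qm: "quotient_map (T Y) (T Q) (ap q)"
      using Ob_tame[OF o(2)] by (intro pretame_surj_quotient[OF _ Ob_tame[OF o(3)] Hom_cont[OF o(6,2,3)] surj])
        (simp add: tame_def)
    obtain k where k: "continuous_map (T Q) (T Z) k" "\<And>y. y \<in> pts Y \<Longrightarrow> k (ap q y) = ap h y"
      using quotient_map_lift_exists[OF qm Hom_cont[OF Z(2) o(2) Z(1)]] ker[OF Z(1,2) hfg] by metis
    have kH: "mk Q k \<in> Hom C Q Z"
    proof (rule mk_Hom[OF o(3) Z(1) k(1)])
      fix z assume "z \<in> pts Q"
      then obtain y where y: "y \<in> pts Y" "z = ap q y" using surj by blast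
      then show "\<pi> Z (k z) = \<pi> Q z"
        using k(2) Hom_\<pi>[OF Z(2) o(2) Z(1)] Hom_\<pi>[OF o(6,2,3)] by simp
    qed
    show ?thesis
    proof (rule ex1I[of _ "mk Q k"])
      show "mk Q k \<in> Hom C Q Z \<and> mk Q k \<odot>\<^bsub>C\<^esub> q = h"
        using kH Comp_eqI[OF o(6) kH Z(2) o(2,3) Z(1)] k(2) Hom_in[OF o(6,2,3)] by (simp add: ap_mk)
      fix k' assume k': "k' \<in> Hom C Q Z \<and> k' \<odot>\<^bsub>C\<^esub> q = h"
      show "k' = mk Q k"
      proof (rule Hom_ext[OF _ kH o(3) Z(1)])
        fix z assume "z \<in> pts Q"
        then obtain y where y: "y \<in> pts Y" "z = ap q y" using surj by blast
        then show "ap k' z = ap (mk Q k) z"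
          using k' k(2) ap_Comp[OF o(6,2,3) y(1), of k'] Hom_in[OF o(6,2,3) y(1)] by (simp add: ap_mk)
      qed (use k' in blast)
    qed
  qed
  ultimately show ?thesis using o unfolding is_coequaliser_def by blast
qed

lemma coequaliser_ex:
  assumes o: "X \<in> Ob C" "Y \<in> Ob C" "f \<in> Hom C X Y" "g \<in> Hom C X Y"
  obtains Q q where "is_coequaliser C X Y f g Q q" "ap q ` pts Y = pts Q"
    "\<forall>y\<in>pts Y. \<forall>y'\<in>pts Y. ap q y = ap q y' \<longleftrightarrow> \<not> coeq_sep X Y f g y y'"
proof -
  obtain Z k where Z: "topspace Z \<subseteq> pts Y" "tame d Z" "quotient_map (T Y) Z k"
    and ker: "\<forall>y\<in>pts Y. \<forall>y'\<in>pts Y. k y = k y' \<longleftrightarrow> \<not> coeq_sep X Y f g y y'"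
    unfolding coeq_sep_def
    by (rule tame_quotient[OF Ob_tame[OF o(2)], of "\<lambda>V. \<forall>x\<in>pts X. ap f x \<in> V \<longleftrightarrow> ap g x \<in> V"]) blast
  have ksurj: "k ` pts Y = topspace Z" by (rule quotient_imp_surjective_map[OF Z(3)])
  \<comment> \<open>Stated for an arbitrary target, so that it applies both to the structure map,
    which thereby descends to the quotient, and to every arrow competing with
    \<open>q\<close>.\<close>
  have sep: "coeq_sep X Y f g y y'"
    if h: "continuous_map (T Y) W h" "clopen_separated W" "\<And>x. x \<in> pts X \<Longrightarrow> h (ap f x) = h (ap g x)"
      "y \<in> pts Y" "y' \<in> pts Y" "h y \<noteq> h y'" for W :: "'w topology" and h y y'
  proof -
    have "h y \<in> topspace W" "h y' \<in> topspace W"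
      using continuous_map_image_subset_topspace[OF h(1)] h(4,5) by blast+
    then obtain V where V: "clopenin W V" "h y \<in> V" "h y' \<notin> V"
      using h(2,6) unfolding clopen_separated_def by blast
    show ?thesis unfolding coeq_sep_def clopen_sep_by_def
      by (rule exI[of _ "{y \<in> pts Y. h y \<in> V}"])
        (use V clopenin_preimage[OF h(1) V(1)] h Hom_in[OF o(3,1,2)] Hom_in[OF o(4,1,2)] in simp)
  qed
  obtain p where p: "continuous_map Z B p" "\<And>y. y \<in> pts Y \<Longrightarrow> p (k y) = \<pi> Y y"
  proof (rule quotient_map_lift_exists[OF Z(3) Ob_\<pi>[OF o(2)]])
    show "\<pi> Y y = \<pi> Y y'" if "y \<in> pts Y" "y' \<in> pts Y" "k y = k y'" for y y'
    proof (rule ccontr)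
      assume "\<pi> Y y \<noteq> \<pi> Y y'"
      then have "coeq_sep X Y f g y y'"
        using sep[OF Ob_\<pi>[OF o(2)] _ _ that(1,2)] tame_B Hom_\<pi>[OF o(3,1,2)] Hom_\<pi>[OF o(4,1,2)]
        by (simp add: tame_def)
      then show False using ker that by blast
    qed
  qed auto
  have "topspace Z \<in> U" by (rule U_small[OF small_subset[OF Z(1) small_U[OF Ob_U[OF o(2)]]]])
  then obtain Q where Q: "Q \<in> Ob C" "T Q = Z" "\<And>z. z \<in> topspace Z \<Longrightarrow> \<pi> Q z = p z"
    using Ob_ex[OF Z(2) _ p(1)] by metis
  have k_in: "k y \<in> topspace Z" if "y \<in> pts Y" for y using ksurj that by blast
  have ck: "continuous_map (T Y) (T Q) k" using quotient_imp_continuous_map[OF Z(3)] Q(2) by simp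
  have qH: "mk Y k \<in> Hom C Y Q"
    by (rule mk_Hom[OF o(2) Q(1) ck]) (simp add: Q(3) k_in p(2))
  have surj: "ap (mk Y k) ` pts Y = pts Q" using ksurj Q(2) by (simp add: ap_mk)
  have ker': "\<forall>y\<in>pts Y. \<forall>y'\<in>pts Y. ap (mk Y k) y = ap (mk Y k) y' \<longleftrightarrow> \<not> coeq_sep X Y f g y y'"
    using ker by (simp add: ap_mk)
  have "is_coequaliser C X Y f g Q (mk Y k)"
  proof (rule coequaliserI[OF o(1,2) Q(1) o(3,4) qH surj])
    fix x assume x: "x \<in> pts X"
    then have "\<not> coeq_sep X Y f g (ap f x) (ap g x)" by (auto simp: coeq_sep_def clopen_sep_by_def)
    then show "ap (mk Y k) (ap f x) = ap (mk Y k) (ap g x)"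
      using ker' Hom_in[OF o(3,1,2) x] Hom_in[OF o(4,1,2) x] by blast
  next
    fix W h y y' assume W: "W \<in> Ob C" "h \<in> Hom C Y W" "\<And>x. x \<in> pts X \<Longrightarrow> ap h (ap f x) = ap h (ap g x)"
      and y: "y \<in> pts Y" "y' \<in> pts Y" "ap (mk Y k) y = ap (mk Y k) y'"
    show "ap h y = ap h y'"
    proof (rule ccontr)
      assume "ap h y \<noteq> ap h y'"
      then have "coeq_sep X Y f g y y'"
        using sep[OF Hom_cont[OF W(2) o(2) W(1)] _ W(3) y(1,2)] Ob_tame[OF W(1)] by (simp add: tame_def)
      then show False using ker' y by blast
    qed
  qed
  then show ?thesis using that surj ker' by blast
qed

lemma has_coequalisers_C: "has_coequalisers C"
  unfolding has_coequalisers_def using coequaliser_ex by metis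

text \<open>Coequalisers are unique up to isomorphism, so the description of the constructed one
  carries over to any other.\<close>

lemma
  assumes c: "is_coequaliser C X Y f g Q q"
  shows coequaliser_surj: "ap q ` pts Y = pts Q"
    and coequaliser_ker: "y \<in> pts Y \<Longrightarrow> y' \<in> pts Y \<Longrightarrow> ap q y = ap q y' \<longleftrightarrow> \<not> coeq_sep X Y f g y y'"
proof -
  have o: "X \<in> Ob C" "Y \<in> Ob C" "Q \<in> Ob C" "f \<in> Hom C X Y" "g \<in> Hom C X Y" "q \<in> Hom C Y Q"
    and qfg: "q \<odot>\<^bsub>C\<^esub> f = q \<odot>\<^bsub>C\<^esub> g"
    and univ: "\<And>Z h. Z \<in> Ob C \<Longrightarrow> h \<in> Hom C Y Z \<Longrightarrow> h \<odot>\<^bsub>C\<^esub> f = h \<odot>\<^bsub>C\<^esub> g \<Longrightarrow> \<exists>!k. k \<in> Hom C Q Z \<and> k \<odot>\<^bsub>C\<^esub> q = h"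
    using c by (auto simp: is_coequaliser_def)
  obtain R r where R: "is_coequaliser C X Y f g R r" "ap r ` pts Y = pts R"
    "\<forall>y\<in>pts Y. \<forall>y'\<in>pts Y. ap r y = ap r y' \<longleftrightarrow> \<not> coeq_sep X Y f g y y'"
    by (rule coequaliser_ex[OF o(1,2,4,5)])
  have oR: "R \<in> Ob C" "r \<in> Hom C Y R" "r \<odot>\<^bsub>C\<^esub> f = r \<odot>\<^bsub>C\<^esub> g"
    using R(1) by (auto simp: is_coequaliser_def)
  obtain k where k: "k \<in> Hom C Q R" "k \<odot>\<^bsub>C\<^esub> q = r" using univ[OF oR] by blast
  obtain l where l: "l \<in> Hom C R Q" "l \<odot>\<^bsub>C\<^esub> r = q"
    using R(1) o qfg unfolding is_coequaliser_def by blast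
  have kq: "ap k (ap q y) = ap r y" and lr: "ap l (ap r y) = ap q y" if "y \<in> pts Y" for y
    using ap_Comp[OF o(6,2,3) that, of k] ap_Comp[OF oR(2) o(2) oR(1) that, of l] k l by simp_all
  have lk: "l \<odot>\<^bsub>C\<^esub> k \<in> Hom C Q Q" by (rule Comp_Hom[OF k(1) l(1) o(3) oR(1) o(3)])
  have "(l \<odot>\<^bsub>C\<^esub> k) \<odot>\<^bsub>C\<^esub> q = q"
    using Comp_eqI[OF o(6) lk o(6) o(2,3,3)] ap_Comp[OF k(1) o(3) oR(1) Hom_in[OF o(6,2,3)], of _ l] kq lr by simp
  moreover have "cat.Id C Q \<odot>\<^bsub>C\<^esub> q = q"
    using Comp_eqI[OF o(6) Id_Hom[OF o(3)] o(6) o(2,3,3)] ap_Id[OF o(3)] Hom_in[OF o(6,2,3)] by simp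
  \<comment> \<open>The composite and the identity both factor \<open>q\<close> through itself, so
    uniqueness makes them equal. Every point of \<open>Q\<close> then comes from a point of
    \<open>R\<close>, and so from a point of \<open>Y\<close>.\<close>
  ultimately have "l \<odot>\<^bsub>C\<^esub> k = cat.Id C Q"
    using univ[OF o(3,6) qfg] lk Id_Hom[OF o(3)] by blast
  then have lk_id: "ap l (ap k z) = z" if "z \<in> pts Q" for z
    using ap_Comp[OF k(1) o(3) oR(1) that, of l] ap_Id[OF o(3) that] by simp
  show "ap q ` pts Y = pts Q"
  proof
    show "ap q ` pts Y \<subseteq> pts Q" using Hom_in[OF o(6,2,3)] by blast
    show "pts Q \<subseteq> ap q ` pts Y"
    proof
      fix z assume z: "z \<in> pts Q"
      then obtain y where y: "y \<in> pts Y" "ap k z = ap r y"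
        using Hom_in[OF k(1) o(3) oR(1)] R(2) by (metis imageE)
      then have "z = ap q y" using lk_id[OF z] lr[OF y(1)] by simp
      then show "z \<in> ap q ` pts Y" using y by blast
    qed
  qed
  assume y: "y \<in> pts Y" "y' \<in> pts Y"
  have "ap q y = ap q y' \<longleftrightarrow> ap r y = ap r y'" using kq lr y by metis
  then show "ap q y = ap q y' \<longleftrightarrow> \<not> coeq_sep X Y f g y y'" using R(3) y by blast
qed

text \<open>A surjection is the coequaliser of its kernel pair: an arrow that agrees on the two legs
  is constant on the fibres of the surjection.\<close>

lemma regular_epi_iff:
  "is_regular_epi C Y Q q \<longleftrightarrow> Y \<in> Ob C \<and> Q \<in> Ob C \<and> q \<in> Hom C Y Q \<and> ap q ` pts Y = pts Q"
proof
  assume "is_regular_epi C Y Q q"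
  then show "Y \<in> Ob C \<and> Q \<in> Ob C \<and> q \<in> Hom C Y Q \<and> ap q ` pts Y = pts Q"
    unfolding is_regular_epi_def using coequaliser_surj unfolding is_coequaliser_def by blast
next
  assume o: "Y \<in> Ob C \<and> Q \<in> Ob C \<and> q \<in> Hom C Y Q \<and> ap q ` pts Y = pts Q"
  then have o': "Y \<in> Ob C" "Y \<in> Ob C" "Q \<in> Ob C" "q \<in> Hom C Y Q" "q \<in> Hom C Y Q" by auto
  obtain P p p' where j: "joint_bij P Y Y p p' {(a, b). a \<in> pts Y \<and> b \<in> pts Y \<and> ap q a = ap q b}"
    using pullback_ex[OF o'] unfolding is_pullback_iff[OF o'] by blast
  have im: "(\<lambda>z. (ap p z, ap p' z)) ` pts P = {(a, b). a \<in> pts Y \<and> b \<in> pts Y \<and> ap q a = ap q b}"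
    using j by (simp add: joint_bij_def bij_betw_def)
  have oP: "P \<in> Ob C" "p \<in> Hom C P Y" "p' \<in> Hom C P Y" using j by (auto simp: joint_bij_def)
  have "is_coequaliser C P Y p p' Q q"
  proof (rule coequaliserI[OF oP(1) o'(1,3) oP(2,3) o'(4)])
    show "ap q ` pts Y = pts Q" using o by blast
    show "ap q (ap p x) = ap q (ap p' x)" if "x \<in> pts P" for x
    proof -
      have "(ap p x, ap p' x) \<in> {(a, b). a \<in> pts Y \<and> b \<in> pts Y \<and> ap q a = ap q b}"
        unfolding im[symmetric] using that by blast
      then show ?thesis by simp
    qed
    fix Z h y y' assume h: "\<And>x. x \<in> pts P \<Longrightarrow> ap h (ap p x) = ap h (ap p' x)"
      and y: "y \<in> pts Y" "y' \<in> pts Y" "ap q y = ap q y'"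
    then have "(y, y') \<in> (\<lambda>z. (ap p z, ap p' z)) ` pts P" unfolding im by simp
    then show "ap h y = ap h y'" using h by auto
  qed
  then show "is_regular_epi C Y Q q" unfolding is_regular_epi_def by blast
qed

lemma regular_C: "regular_category C"
  unfolding regular_category_def
proof (intro conjI allI impI ballI)
  show "category C" by (rule category_C)
  show "\<exists>t. is_terminal C t" by (rule terminal_ex)
  show "\<exists>P p q. is_pullback C A A' Z f g P p q"
    if "A \<in> Ob C" "A' \<in> Ob C" "Z \<in> Ob C" "f \<in> Hom C A Z" "g \<in> Hom C A' Z" for A A' Z f g
    using pullback_ex[OF that] .
  show "\<exists>Q q. is_coequaliser C R X r s Q q" if "is_pullback C X X Y f f R r s" for X Y f R r s
    using that has_coequalisers_C unfolding has_coequalisers_def is_pullback_def by blast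
  fix A A' Z f g P p q assume a: "is_regular_epi C A Z f \<and> is_pullback C A A' Z f g P p q"
  then have o: "A \<in> Ob C" "A' \<in> Ob C" "Z \<in> Ob C" "f \<in> Hom C A Z" "g \<in> Hom C A' Z"
    and oP: "P \<in> Ob C" "q \<in> Hom C P A'" by (auto simp: is_pullback_def)
  have surj: "ap f ` pts A = pts Z" using a unfolding regular_epi_iff by blast
  have im: "(\<lambda>z. (ap p z, ap q z)) ` pts P = {(a, b). a \<in> pts A \<and> b \<in> pts A' \<and> ap f a = ap g b}"
    using a unfolding is_pullback_iff[OF o] joint_bij_def bij_betw_def by blast
  have "ap q ` pts P = pts A'"
  proof
    show "ap q ` pts P \<subseteq> pts A'" using Hom_in[OF oP(2,1) o(2)] by blast
    show "pts A' \<subseteq> ap q ` pts P"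
    proof
      fix b assume b: "b \<in> pts A'"
      then obtain a where "a \<in> pts A" "ap f a = ap g b" using surj Hom_in[OF o(5,2,3) b] by (metis imageE)
      then have "(a, b) \<in> (\<lambda>z. (ap p z, ap q z)) ` pts P" unfolding im using b by simp
      then show "b \<in> ap q ` pts P" by auto
    qed
  qed
  then show "is_regular_epi C P A' q" unfolding regular_epi_iff using oP o by blast
qed

lemma times_map:
  assumes o: "A \<in> Ob C" "X \<in> Ob C" "Y \<in> Ob C" "f \<in> Hom C X Y"
  shows times_map_Hom: "times_map C A X Y f \<in> Hom C (prod_obj C A X) (prod_obj C A Y)"
    and ap_times_map: "a \<in> pts A \<Longrightarrow> x \<in> pts X \<Longrightarrow> \<pi> A a = \<pi> X x \<Longrightarrow>
      ap (times_map C A X Y f) (pr A X a x) = pr A Y a (ap f x)"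
proof -
  note P = prod_Ob[OF o(1,2)] and p = proj1_Hom[OF o(1,2)] proj2_Hom[OF o(1,2)]
  have fp: "f \<odot>\<^bsub>C\<^esub> proj2 C A X \<in> Hom C (prod_obj C A X) Y" by (rule Comp_Hom[OF p(2) o(4) P o(2,3)])
  show "times_map C A X Y f \<in> Hom C (prod_obj C A X) (prod_obj C A Y)"
    unfolding times_map_def by (rule pairing_Hom[OF P o(1,3) p(1) fp])
  assume a: "a \<in> pts A" "x \<in> pts X" "\<pi> A a = \<pi> X x"
  note z = pr[OF o(1,2) a]
  show "ap (times_map C A X Y f) (pr A X a x) = pr A Y a (ap f x)"
    unfolding times_map_def
    using ap_pairing[OF P o(1,3) p(1) fp z(1)] ap_Comp[OF p(2) P o(2) z(1)] z by simp
qed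

text \<open>Over a one-point base all pairs of points occur in a product, and fixing the first
  coordinate gives arrows. A competing arrow on the product of \<open>A\<close> and \<open>Y\<close>
  can thus be tested with one coordinate fixed, where the universal property of \<open>q\<close>
  applies; joint continuity of the factorisation comes from surjections being quotient maps.\<close>

lemma products_preserve_coequalisers_C:
  assumes B: "topspace B = {b}"
  shows "products_preserve_coequalisers C"
  unfolding products_preserve_coequalisers_def
proof (intro ballI allI impI)
  fix A X Y f g Q q assume A: "A \<in> Ob C" and c: "is_coequaliser C X Y f g Q q"
  have o: "X \<in> Ob C" "Y \<in> Ob C" "Q \<in> Ob C" "f \<in> Hom C X Y" "g \<in> Hom C X Y" "q \<in> Hom C Y Q"
    using c by (auto simp: is_coequaliser_def)
  have \<pi>b: "\<pi> Z z = b" if "Z \<in> Ob C" "z \<in> pts Z" for Z z using \<pi>_in[OF that] B by simp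
  have qfg: "ap q (ap f x) = ap q (ap g x)" if "x \<in> pts X" for x
    using Comp_eq_Comp_iff[OF o(4,6,5,6,1,2,2,3)] c that by (simp add: is_coequaliser_def)
  have surj: "ap q ` pts Y = pts Q" by (rule coequaliser_surj[OF c])
  show "is_coequaliser C (prod_obj C A X) (prod_obj C A Y) (times_map C A X Y f) (times_map C A X Y g)
      (prod_obj C A Q) (times_map C A Y Q q)"
  proof (rule coequaliserI[OF prod_Ob[OF A o(1)] prod_Ob[OF A o(2)] prod_Ob[OF A o(3)]
        times_map_Hom[OF A o(1,2,4)] times_map_Hom[OF A o(1,2,5)] times_map_Hom[OF A o(2,3,6)]])
    show "ap (times_map C A Y Q q) ` pts (prod_obj C A Y) = pts (prod_obj C A Q)"
    proof
      show "ap (times_map C A Y Q q) ` pts (prod_obj C A Y) \<subseteq> pts (prod_obj C A Q)"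
        using Hom_in[OF times_map_Hom[OF A o(2,3,6)] prod_Ob[OF A o(2)] prod_Ob[OF A o(3)]] by blast
      show "pts (prod_obj C A Q) \<subseteq> ap (times_map C A Y Q q) ` pts (prod_obj C A Y)"
      proof
        fix z assume "z \<in> pts (prod_obj C A Q)"
        then obtain a w where a: "a \<in> pts A" "w \<in> pts Q" "z = pr A Q a w" by (rule prod_pts[OF A o(3)])
        then obtain y where y: "y \<in> pts Y" "w = ap q y" using surj by blast
        have e: "\<pi> A a = \<pi> Y y" using \<pi>b A o a y by simp
        have "z = ap (times_map C A Y Q q) (pr A Y a y)"
          using ap_times_map[OF A o(2,3,6) a(1) y(1) e] a y by simp
        then show "z \<in> ap (times_map C A Y Q q) ` pts (prod_obj C A Y)"
          using pr_in[OF A o(2) a(1) y(1) e] by blast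
      qed
    qed
  next
    fix z assume "z \<in> pts (prod_obj C A X)"
    then obtain a x where a: "a \<in> pts A" "x \<in> pts X" "\<pi> A a = \<pi> X x" "z = pr A X a x" by (rule prod_pts[OF A o(1)])
    have fx: "ap f x \<in> pts Y" "ap g x \<in> pts Y" using Hom_in[OF o(4,1,2) a(2)] Hom_in[OF o(5,1,2) a(2)] by blast+
    have e: "\<pi> A a = \<pi> Y (ap f x)" "\<pi> A a = \<pi> Y (ap g x)" using \<pi>b A o a fx by simp_all
    show "ap (times_map C A Y Q q) (ap (times_map C A X Y f) z) = ap (times_map C A Y Q q) (ap (times_map C A X Y g) z)"
      unfolding a(4) ap_times_map[OF A o(1,2,4) a(1-3)] ap_times_map[OF A o(1,2,5) a(1-3)]
        ap_times_map[OF A o(2,3,6) a(1) fx(1) e(1)] ap_times_map[OF A o(2,3,6) a(1) fx(2) e(2)] qfg[OF a(2)] ..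
  next
    fix Z h z z' assume h: "Z \<in> Ob C" "h \<in> Hom C (prod_obj C A Y) Z"
      and hfg: "\<And>x. x \<in> pts (prod_obj C A X) \<Longrightarrow> ap h (ap (times_map C A X Y f) x) = ap h (ap (times_map C A X Y g) x)"
      and z: "z \<in> pts (prod_obj C A Y)" "z' \<in> pts (prod_obj C A Y)"
      and qz: "ap (times_map C A Y Q q) z = ap (times_map C A Y Q q) z'"
    obtain a y where y: "a \<in> pts A" "y \<in> pts Y" "\<pi> A a = \<pi> Y y" "z = pr A Y a y" by (rule prod_pts[OF A o(2) z(1)])
    obtain a' y' where y': "a' \<in> pts A" "y' \<in> pts Y" "\<pi> A a' = \<pi> Y y'" "z' = pr A Y a' y'" by (rule prod_pts[OF A o(2) z(2)])
    have qy: "ap q y \<in> pts Q" "ap q y' \<in> pts Q" using Hom_in[OF o(6,2,3)] y y' by blast+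
    have "pr A Q a (ap q y) = pr A Q a' (ap q y')"
      using qz ap_times_map[OF A o(2,3,6) y(1-3)] ap_times_map[OF A o(2,3,6) y'(1-3)] y(4) y'(4) by simp
    then have eq: "a' = a" "ap q y = ap q y'"
      using proj1_pr[OF A o(3) y(1) qy(1)] proj1_pr[OF A o(3) y'(1) qy(2)]
        proj2_pr[OF A o(3) y(1) qy(1)] proj2_pr[OF A o(3) y'(1) qy(2)] \<pi>b A o y y' qy by simp_all
    \<comment> \<open>The two points have the same first coordinate \<open>a\<close>, so only the
      restriction of the competing arrow to that slice matters.\<close>
    let ?h = "mk Y (\<lambda>y. ap h (pr A Y a y))"
    have e: "\<pi> A a = \<pi> Y w" if "w \<in> pts Y" for w using \<pi>b A o y that by simp
    have "continuous_map (T Y) (T (prod_obj C A Y)) (\<lambda>w. pr A Y a w)"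
      by (rule pr_cont[OF A o(2)]) (use y e in auto)
    from continuous_map_compose[OF this Hom_cont[OF h(2) prod_Ob[OF A o(2)] h(1)]]
    have "continuous_map (T Y) (T Z) (\<lambda>y. ap h (pr A Y a y))" by (simp add: comp_def)
    then have hH: "?h \<in> Hom C Y Z"
      by (rule mk_Hom[OF o(2) h(1)])
        (use \<pi>b h(1) o(2) Hom_in[OF h(2) prod_Ob[OF A o(2)] h(1) pr_in[OF A o(2) y(1) _ e]] in simp)
    have "ap ?h (ap f x) = ap ?h (ap g x)" if x: "x \<in> pts X" for x
    proof -
      have ex: "\<pi> A a = \<pi> X x" using \<pi>b A o y x by simp
      show ?thesis
        using hfg[OF pr_in[OF A o(1) y(1) x ex]] ap_times_map[OF A o(1,2,4) y(1) x ex]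
          ap_times_map[OF A o(1,2,5) y(1) x ex] Hom_in[OF o(4,1,2) x] Hom_in[OF o(5,1,2) x]
        by (simp add: ap_mk)
    qed
    then have "?h \<odot>\<^bsub>C\<^esub> f = ?h \<odot>\<^bsub>C\<^esub> g"
      using Comp_eq_Comp_iff[OF o(4) hH o(5) hH o(1,2,2) h(1)] by blast
    then obtain k where k: "k \<in> Hom C Q Z" "k \<odot>\<^bsub>C\<^esub> q = ?h"
      using c h(1) hH unfolding is_coequaliser_def by blast
    have "ap ?h w = ap k (ap q w)" if "w \<in> pts Y" for w
      using ap_Comp[OF o(6,2,3) that, of k] k(2) by simp
    then have "ap ?h y = ap ?h y'" using y y' eq(2) by simp
    then show "ap h z = ap h z'" using y y' eq(1) by (simp add: ap_mk)
  qed
qed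

end

section \<open>Group objects and actions in terms of points\<close>

context concrete_cat begin

lemma op_pairing:
  assumes "X \<in> Ob C" "A \<in> Ob C" "A' \<in> Ob C" "Z \<in> Ob C" "m \<in> Hom C (prod_obj C A A') Z"
    "f \<in> Hom C X A" "g \<in> Hom C X A'"
  shows op_pairing_Hom: "m \<odot>\<^bsub>C\<^esub> pairing C X A A' f g \<in> Hom C X Z"
    and ap_op_pairing: "x \<in> pts X \<Longrightarrow> ap (m \<odot>\<^bsub>C\<^esub> pairing C X A A' f g) x = ap m (pr A A' (ap f x) (ap g x))"
proof -
  note h = pairing_Hom[OF assms(1,2,3,6,7)]
  show "m \<odot>\<^bsub>C\<^esub> pairing C X A A' f g \<in> Hom C X Z"
    by (rule Comp_Hom[OF h assms(5,1) prod_Ob[OF assms(2,3)] assms(4)])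
  show "ap (m \<odot>\<^bsub>C\<^esub> pairing C X A A' f g) x = ap m (pr A A' (ap f x) (ap g x))" if "x \<in> pts X"
    using ap_Comp[OF h assms(1) prod_Ob[OF assms(2,3)] that] ap_pairing[OF assms(1,2,3,6,7) that] by simp
qed

lemma Hom_eq_iff:
  "\<lbrakk>f \<in> Hom C X Y; g \<in> Hom C X Y; X \<in> Ob C; Y \<in> Ob C\<rbrakk> \<Longrightarrow> f = g \<longleftrightarrow> (\<forall>x\<in>pts X. ap f x = ap g x)"
  using Hom_ext by metis

lemma binary_op:
  assumes "A \<in> Ob C" "A' \<in> Ob C" "Z \<in> Ob C" "m \<in> Hom C (prod_obj C A A') Z"
    "x \<in> pts A" "y \<in> pts A'" "\<pi> A x = \<pi> A' y"
  shows "ap m (pr A A' x y) \<in> pts Z" "\<pi> Z (ap m (pr A A' x y)) = \<pi> A x"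
  using Hom_in[OF assms(4) prod_Ob[OF assms(1,2)] assms(3) pr_in[OF assms(1,2,5,6,7)]]
    Hom_\<pi>[OF assms(4) prod_Ob[OF assms(1,2)] assms(3) pr_in[OF assms(1,2,5,6,7)]] \<pi>_pr[OF assms(1,2,5,6,7)]
  by simp_all

lemma binary_op_cont:
  assumes "A \<in> Ob C" "A' \<in> Ob C" "Z \<in> Ob C" "m \<in> Hom C (prod_obj C A A') Z"
  shows "continuous_map (subtopology (prod_topology (T A) (T A')) (fibre_product A A')) (T Z)
    (\<lambda>(x, y). ap m (pr A A' x y))"
proof -
  let ?S = "subtopology (prod_topology (T A) (T A')) (fibre_product A A')"
  have "continuous_map ?S (T (prod_obj C A A')) (\<lambda>z. pr A A' (fst z) (snd z))"
    by (rule pr_cont[OF assms(1,2)])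
      (auto simp: fibre_product_def intro: continuous_map_from_subtopology continuous_map_fst continuous_map_snd)
  from continuous_map_compose[OF this Hom_cont[OF assms(4) prod_Ob[OF assms(1,2)] assms(3)]]
  show ?thesis by (simp add: comp_def case_prod_unfold)
qed

definition gm :: "('o, 'u \<rightharpoonup> 'u) grp_obj \<Rightarrow> 'u \<Rightarrow> 'u \<Rightarrow> 'u" where
  "gm G x y = ap (gmul G) (pr (gcar G) (gcar G) x y)"

text \<open>The unit of a group object over a base is a section, with one neutral element in each
  fibre; \<open>tm b\<close> is the point of the terminal object over \<open>b\<close>.\<close>

definition go :: "('o, 'u \<rightharpoonup> 'u) grp_obj \<Rightarrow> 'b \<Rightarrow> 'u" where
  "go G b = ap (gunit G) (tm b)"

definition gi :: "('o, 'u \<rightharpoonup> 'u) grp_obj \<Rightarrow> 'u \<Rightarrow> 'u" where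
  "gi G x = ap (ginv G) x"

definition group_points :: "('o, 'u \<rightharpoonup> 'u) grp_obj \<Rightarrow> bool" where
  "group_points G \<longleftrightarrow> (let K = gcar G in
     (\<forall>x\<in>pts K. \<forall>y\<in>pts K. \<forall>z\<in>pts K. \<pi> K x = \<pi> K y \<longrightarrow> \<pi> K y = \<pi> K z \<longrightarrow>
        gm G (gm G x y) z = gm G x (gm G y z)) \<and>
     (\<forall>x\<in>pts K. gm G (go G (\<pi> K x)) x = x \<and> gm G x (go G (\<pi> K x)) = x \<and>
        gm G (gi G x) x = go G (\<pi> K x) \<and> gm G x (gi G x) = go G (\<pi> K x)))"

definition group_data :: "('o, 'u \<rightharpoonup> 'u) grp_obj \<Rightarrow> bool" where
  "group_data G \<longleftrightarrow> gcar G \<in> Ob C \<and> gmul G \<in> Hom C (prod_obj C (gcar G) (gcar G)) (gcar G) \<and>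
     gunit G \<in> Hom C (terminal_obj C) (gcar G) \<and> ginv G \<in> Hom C (gcar G) (gcar G)"

text \<open>The three factors are independent so that the same computation serves the associative
  law of a group and that of an action.\<close>

lemma triple_projections:
  assumes "A \<in> Ob C" "A' \<in> Ob C" "A'' \<in> Ob C"
  defines "P \<equiv> prod_obj C A A'" and "Q \<equiv> prod_obj C (prod_obj C A A') A''"
  shows "P \<in> Ob C" "Q \<in> Ob C"
    "proj1 C A A' \<odot>\<^bsub>C\<^esub> proj1 C P A'' \<in> Hom C Q A" "proj2 C A A' \<odot>\<^bsub>C\<^esub> proj1 C P A'' \<in> Hom C Q A'"
    "proj2 C P A'' \<in> Hom C Q A''"
    "\<lbrakk>x \<in> pts A; y \<in> pts A'; z \<in> pts A''; \<pi> A x = \<pi> A' y; \<pi> A' y = \<pi> A'' z\<rbrakk> \<Longrightarrow>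
      ap (proj1 C A A' \<odot>\<^bsub>C\<^esub> proj1 C P A'') (pr P A'' (pr A A' x y) z) = x \<and>
      ap (proj2 C A A' \<odot>\<^bsub>C\<^esub> proj1 C P A'') (pr P A'' (pr A A' x y) z) = y \<and>
      ap (proj2 C P A'') (pr P A'' (pr A A' x y) z) = z \<and> pr P A'' (pr A A' x y) z \<in> pts Q"
    "w \<in> pts Q \<Longrightarrow> \<exists>x y z. x \<in> pts A \<and> y \<in> pts A' \<and> z \<in> pts A'' \<and> \<pi> A x = \<pi> A' y \<and> \<pi> A' y = \<pi> A'' z \<and>
      w = pr P A'' (pr A A' x y) z"
proof -
  show P: "P \<in> Ob C" unfolding P_def by (rule prod_Ob[OF assms(1,2)])
  show Q: "Q \<in> Ob C" unfolding Q_def by (rule prod_Ob[OF prod_Ob[OF assms(1,2)] assms(3)])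
  have Q_def': "Q = prod_obj C P A''" by (simp add: Q_def P_def)
  have p1: "proj1 C P A'' \<in> Hom C Q P" unfolding Q_def' by (rule proj1_Hom[OF P assms(3)])
  show p2: "proj2 C P A'' \<in> Hom C Q A''" unfolding Q_def' by (rule proj2_Hom[OF P assms(3)])
  have q1: "proj1 C A A' \<in> Hom C P A" "proj2 C A A' \<in> Hom C P A'"
    unfolding P_def by (rule proj1_Hom[OF assms(1,2)], rule proj2_Hom[OF assms(1,2)])
  show "proj1 C A A' \<odot>\<^bsub>C\<^esub> proj1 C P A'' \<in> Hom C Q A" by (rule Comp_Hom[OF p1 q1(1) Q P assms(1)])
  show "proj2 C A A' \<odot>\<^bsub>C\<^esub> proj1 C P A'' \<in> Hom C Q A'" by (rule Comp_Hom[OF p1 q1(2) Q P assms(2)])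
  show "ap (proj1 C A A' \<odot>\<^bsub>C\<^esub> proj1 C P A'') (pr P A'' (pr A A' x y) z) = x \<and>
      ap (proj2 C A A' \<odot>\<^bsub>C\<^esub> proj1 C P A'') (pr P A'' (pr A A' x y) z) = y \<and>
      ap (proj2 C P A'') (pr P A'' (pr A A' x y) z) = z \<and> pr P A'' (pr A A' x y) z \<in> pts Q"
    if x: "x \<in> pts A" "y \<in> pts A'" "z \<in> pts A''" "\<pi> A x = \<pi> A' y" "\<pi> A' y = \<pi> A'' z"
  proof -
    note w = pr[OF assms(1,2) x(1,2,4), folded P_def]
    have e: "\<pi> P (pr A A' x y) = \<pi> A'' z" using w(4) x by simp
    note w' = pr[OF P assms(3) w(1) x(3) e, folded Q_def']
    show ?thesis using ap_Comp[OF p1 Q P w'(1)] w w' by simp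
  qed
  show "\<exists>x y z. x \<in> pts A \<and> y \<in> pts A' \<and> z \<in> pts A'' \<and> \<pi> A x = \<pi> A' y \<and> \<pi> A' y = \<pi> A'' z \<and>
      w = pr P A'' (pr A A' x y) z" if "w \<in> pts Q"
  proof -
    obtain v z where v: "v \<in> pts P" "z \<in> pts A''" "\<pi> P v = \<pi> A'' z" "w = pr P A'' v z"
      by (rule prod_pts[OF P assms(3) \<open>w \<in> pts Q\<close>[unfolded Q_def']])
    obtain x y where "x \<in> pts A" "y \<in> pts A'" "\<pi> A x = \<pi> A' y" "v = pr A A' x y"
      by (rule prod_pts[OF assms(1,2) v(1)[unfolded P_def]])
    then show ?thesis using v \<pi>_pr[OF assms(1,2), of x y] unfolding P_def by metis
  qed
qed

text \<open>Arrows are equal iff they agree on points, so each diagram becomes a law in the fibres.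
  The points of the triple product are triples over one base point, whence the guards in the
  associative law of \<open>group_points\<close>.\<close>

lemma group_object_iff: "group_object C G \<longleftrightarrow> group_data G \<and> group_points G"
proof (cases "group_data G")
  case False
  then show ?thesis unfolding group_object_def group_data_def Let_def by blast
next
  case True
  define K where "K = gcar G"
  have K: "K \<in> Ob C" and m: "gmul G \<in> Hom C (prod_obj C K K) K" and e: "gunit G \<in> Hom C (terminal_obj C) K"
    and i: "ginv G \<in> Hom C K K"
    using True by (auto simp: group_data_def K_def)
  define u where "u = gunit G \<odot>\<^bsub>C\<^esub> to_terminal C K"
  note I = Id_Hom[OF K]
  have uH: "u \<in> Hom C K K" unfolding u_def by (rule Comp_Hom[OF to_terminal_Hom[OF K] e K terminal_Ob K])
  have ap_u: "ap u x = go G (\<pi> K x)" if "x \<in> pts K" for x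
    unfolding u_def go_def using ap_Comp[OF to_terminal_Hom[OF K] K terminal_Ob that] ap_to_terminal[OF K that] by simp
  note op = op_pairing[OF _ K K K m]
  have l1: "gmul G \<odot>\<^bsub>C\<^esub> pairing C K K K u (Id C K) = Id C K \<longleftrightarrow> (\<forall>x\<in>pts K. gm G (go G (\<pi> K x)) x = x)"
    using Hom_eq_iff[OF op(1)[OF K uH I] I K K] op(2)[OF K uH I] ap_u ap_Id[OF K] by (simp add: gm_def flip: K_def)
  have l2: "gmul G \<odot>\<^bsub>C\<^esub> pairing C K K K (Id C K) u = Id C K \<longleftrightarrow> (\<forall>x\<in>pts K. gm G x (go G (\<pi> K x)) = x)"
    using Hom_eq_iff[OF op(1)[OF K I uH] I K K] op(2)[OF K I uH] ap_u ap_Id[OF K] by (simp add: gm_def flip: K_def)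
  have l3: "gmul G \<odot>\<^bsub>C\<^esub> pairing C K K K (ginv G) (Id C K) = u \<longleftrightarrow> (\<forall>x\<in>pts K. gm G (gi G x) x = go G (\<pi> K x))"
    using Hom_eq_iff[OF op(1)[OF K i I] uH K K] op(2)[OF K i I] ap_u ap_Id[OF K] by (simp add: gm_def gi_def flip: K_def)
  have l4: "gmul G \<odot>\<^bsub>C\<^esub> pairing C K K K (Id C K) (ginv G) = u \<longleftrightarrow> (\<forall>x\<in>pts K. gm G x (gi G x) = go G (\<pi> K x))"
    using Hom_eq_iff[OF op(1)[OF K I i] uH K K] op(2)[OF K I i] ap_u ap_Id[OF K] by (simp add: gm_def gi_def flip: K_def)
  define P where "P = prod_obj C K K"
  define Q where "Q = prod_obj C P K"
  define a where "a = proj1 C K K \<odot>\<^bsub>C\<^esub> proj1 C P K"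
  define b where "b = proj2 C K K \<odot>\<^bsub>C\<^esub> proj1 C P K"
  define c where "c = proj2 C P K"
  note t = triple_projections[OF K K K, folded P_def, folded Q_def, folded a_def b_def c_def]
  note ab = op[OF t(2,3,4)] and bc = op[OF t(2,4,5)]
  note lhs = op[OF t(2) ab(1) t(5)] and rhs = op[OF t(2,3) bc(1)]
  have val: "ap (gmul G \<odot>\<^bsub>C\<^esub> pairing C Q K K (gmul G \<odot>\<^bsub>C\<^esub> pairing C Q K K a b) c) (pr P K (pr K K x y) z) = gm G (gm G x y) z"
    "ap (gmul G \<odot>\<^bsub>C\<^esub> pairing C Q K K a (gmul G \<odot>\<^bsub>C\<^esub> pairing C Q K K b c)) (pr P K (pr K K x y) z) = gm G x (gm G y z)"
    if x: "x \<in> pts K" "y \<in> pts K" "z \<in> pts K" "\<pi> K x = \<pi> K y" "\<pi> K y = \<pi> K z" for x y z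
  proof -
    note w = t(6)[OF x]
    show "ap (gmul G \<odot>\<^bsub>C\<^esub> pairing C Q K K (gmul G \<odot>\<^bsub>C\<^esub> pairing C Q K K a b) c) (pr P K (pr K K x y) z) = gm G (gm G x y) z"
      using lhs(2)[of "pr P K (pr K K x y) z"] ab(2)[of "pr P K (pr K K x y) z"] w by (simp add: gm_def flip: K_def)
    show "ap (gmul G \<odot>\<^bsub>C\<^esub> pairing C Q K K a (gmul G \<odot>\<^bsub>C\<^esub> pairing C Q K K b c)) (pr P K (pr K K x y) z) = gm G x (gm G y z)"
      using rhs(2)[of "pr P K (pr K K x y) z"] bc(2)[of "pr P K (pr K K x y) z"] w by (simp add: gm_def flip: K_def)
  qed
  have l0: "gmul G \<odot>\<^bsub>C\<^esub> pairing C Q K K (gmul G \<odot>\<^bsub>C\<^esub> pairing C Q K K a b) c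
      = gmul G \<odot>\<^bsub>C\<^esub> pairing C Q K K a (gmul G \<odot>\<^bsub>C\<^esub> pairing C Q K K b c) \<longleftrightarrow>
    (\<forall>x\<in>pts K. \<forall>y\<in>pts K. \<forall>z\<in>pts K. \<pi> K x = \<pi> K y \<longrightarrow> \<pi> K y = \<pi> K z \<longrightarrow> gm G (gm G x y) z = gm G x (gm G y z))"
    unfolding Hom_eq_iff[OF lhs(1) rhs(1) t(2) K]
  proof (intro iffI ballI impI)
    fix x y z assume all: "\<forall>w\<in>pts Q. ap (gmul G \<odot>\<^bsub>C\<^esub> pairing C Q K K (gmul G \<odot>\<^bsub>C\<^esub> pairing C Q K K a b) c) w
      = ap (gmul G \<odot>\<^bsub>C\<^esub> pairing C Q K K a (gmul G \<odot>\<^bsub>C\<^esub> pairing C Q K K b c)) w"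
      and x: "x \<in> pts K" "y \<in> pts K" "z \<in> pts K" "\<pi> K x = \<pi> K y" "\<pi> K y = \<pi> K z"
    show "gm G (gm G x y) z = gm G x (gm G y z)"
      using all[rule_format, of "pr P K (pr K K x y) z"] t(6)[OF x] val[OF x] by simp
  next
    fix w assume all: "\<forall>x\<in>pts K. \<forall>y\<in>pts K. \<forall>z\<in>pts K. \<pi> K x = \<pi> K y \<longrightarrow> \<pi> K y = \<pi> K z \<longrightarrow> gm G (gm G x y) z = gm G x (gm G y z)"
      and w: "w \<in> pts Q"
    obtain x y z where x: "x \<in> pts K" "y \<in> pts K" "z \<in> pts K" "\<pi> K x = \<pi> K y" "\<pi> K y = \<pi> K z"
      and w: "w = pr P K (pr K K x y) z" using t(7)[OF w] by blast
    show "ap (gmul G \<odot>\<^bsub>C\<^esub> pairing C Q K K (gmul G \<odot>\<^bsub>C\<^esub> pairing C Q K K a b) c) w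
      = ap (gmul G \<odot>\<^bsub>C\<^esub> pairing C Q K K a (gmul G \<odot>\<^bsub>C\<^esub> pairing C Q K K b c)) w"
      unfolding w val[OF x] using all x by blast
  qed
  have "group_object C G \<longleftrightarrow>
    gmul G \<odot>\<^bsub>C\<^esub> pairing C Q K K (gmul G \<odot>\<^bsub>C\<^esub> pairing C Q K K a b) c
      = gmul G \<odot>\<^bsub>C\<^esub> pairing C Q K K a (gmul G \<odot>\<^bsub>C\<^esub> pairing C Q K K b c) \<and>
    gmul G \<odot>\<^bsub>C\<^esub> pairing C K K K u (Id C K) = Id C K \<and>
    gmul G \<odot>\<^bsub>C\<^esub> pairing C K K K (Id C K) u = Id C K \<and>
    gmul G \<odot>\<^bsub>C\<^esub> pairing C K K K (ginv G) (Id C K) = u \<and>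
    gmul G \<odot>\<^bsub>C\<^esub> pairing C K K K (Id C K) (ginv G) = u"
    using K m e i unfolding group_object_def Let_def P_def Q_def a_def b_def c_def u_def K_def by simp
  also have "\<dots> \<longleftrightarrow> group_points G"
    unfolding l0 l1 l2 l3 l4 group_points_def Let_def K_def[symmetric] by blast
  finally show ?thesis using True by simp
qed

lemma group_closed:
  assumes G: "group_object C G"
  defines "K \<equiv> gcar G"
  shows "K \<in> Ob C"
    and "\<lbrakk>x \<in> pts K; y \<in> pts K; \<pi> K x = \<pi> K y\<rbrakk> \<Longrightarrow> gm G x y \<in> pts K"
    and "\<lbrakk>x \<in> pts K; y \<in> pts K; \<pi> K x = \<pi> K y\<rbrakk> \<Longrightarrow> \<pi> K (gm G x y) = \<pi> K x"
    and "b \<in> topspace B \<Longrightarrow> go G b \<in> pts K"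
    and "b \<in> topspace B \<Longrightarrow> \<pi> K (go G b) = b"
    and "x \<in> pts K \<Longrightarrow> gi G x \<in> pts K"
    and "x \<in> pts K \<Longrightarrow> \<pi> K (gi G x) = \<pi> K x"
proof -
  have K: "K \<in> Ob C" and m: "gmul G \<in> Hom C (prod_obj C K K) K" and e: "gunit G \<in> Hom C (terminal_obj C) K"
    and i: "ginv G \<in> Hom C K K"
    using G unfolding group_object_iff by (auto simp: group_data_def K_def)
  show "K \<in> Ob C" by (rule K)
  show "gm G x y \<in> pts K" "\<pi> K (gm G x y) = \<pi> K x" if "x \<in> pts K" "y \<in> pts K" "\<pi> K x = \<pi> K y"
    using binary_op[OF K K K m that] by (simp_all add: gm_def K_def)
  show "go G b \<in> pts K" "\<pi> K (go G b) = b" if "b \<in> topspace B"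
    using Hom_in[OF e terminal_Ob K tm(1)[OF that]] Hom_\<pi>[OF e terminal_Ob K tm(1)[OF that]] tm(2)[OF that]
    by (simp_all add: go_def)
  show "gi G x \<in> pts K" "\<pi> K (gi G x) = \<pi> K x" if "x \<in> pts K"
    using Hom_in[OF i K K that] Hom_\<pi>[OF i K K that] by (simp_all add: gi_def)
qed

lemma group_laws:
  assumes G: "group_object C G"
  defines "K \<equiv> gcar G"
  shows "\<lbrakk>x \<in> pts K; y \<in> pts K; z \<in> pts K; \<pi> K x = \<pi> K y; \<pi> K y = \<pi> K z\<rbrakk> \<Longrightarrow> gm G (gm G x y) z = gm G x (gm G y z)"
    and "x \<in> pts K \<Longrightarrow> gm G (go G (\<pi> K x)) x = x"
    and "x \<in> pts K \<Longrightarrow> gm G x (go G (\<pi> K x)) = x"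
    and "x \<in> pts K \<Longrightarrow> gm G (gi G x) x = go G (\<pi> K x)"
    and "x \<in> pts K \<Longrightarrow> gm G x (gi G x) = go G (\<pi> K x)"
  using G unfolding group_object_iff group_points_def Let_def K_def by blast+

lemma action_laws:
  assumes G: "group_object C G" and act: "is_action C G Y act"
  defines "K \<equiv> gcar G"
  shows "Y \<in> Ob C" and "act \<in> Hom C (prod_obj C K Y) Y"
    and "y \<in> pts Y \<Longrightarrow> ap act (pr K Y (go G (\<pi> Y y)) y) = y"
    and "\<lbrakk>x \<in> pts K; x' \<in> pts K; y \<in> pts Y; \<pi> K x = \<pi> K x'; \<pi> K x' = \<pi> Y y\<rbrakk> \<Longrightarrow>
      ap act (pr K Y (gm G x x') y) = ap act (pr K Y x (ap act (pr K Y x' y)))"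
proof -
  have K: "K \<in> Ob C" and m: "gmul G \<in> Hom C (prod_obj C K K) K" and e: "gunit G \<in> Hom C (terminal_obj C) K"
    using G unfolding group_object_iff by (auto simp: group_data_def K_def)
  show Y: "Y \<in> Ob C" and a: "act \<in> Hom C (prod_obj C K Y) Y"
    using act unfolding is_action_def Let_def K_def by blast+
  have u: "gunit G \<odot>\<^bsub>C\<^esub> to_terminal C Y \<in> Hom C Y K"
    by (rule Comp_Hom[OF to_terminal_Hom[OF Y] e Y terminal_Ob K])
  have unit: "act \<odot>\<^bsub>C\<^esub> pairing C Y K Y (gunit G \<odot>\<^bsub>C\<^esub> to_terminal C Y) (Id C Y) = Id C Y"
    using act unfolding is_action_def Let_def K_def by blast
  show "ap act (pr K Y (go G (\<pi> Y y)) y) = y" if y: "y \<in> pts Y"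
    using ap_op_pairing[OF Y K Y Y a u Id_Hom[OF Y] y] unit ap_Id[OF Y y]
      ap_Comp[OF to_terminal_Hom[OF Y] Y terminal_Ob y] ap_to_terminal[OF Y y] by (simp add: go_def)
  define P where "P = prod_obj C K K"
  define Q where "Q = prod_obj C P Y"
  define b where "b = proj1 C K K \<odot>\<^bsub>C\<^esub> proj1 C P Y"
  define b' where "b' = proj2 C K K \<odot>\<^bsub>C\<^esub> proj1 C P Y"
  define c where "c = proj2 C P Y"
  note t = triple_projections[OF K K Y, folded P_def, folded Q_def, folded b_def b'_def c_def]
  have eq: "act \<odot>\<^bsub>C\<^esub> pairing C Q K Y (gmul G \<odot>\<^bsub>C\<^esub> pairing C Q K K b b') c
      = act \<odot>\<^bsub>C\<^esub> pairing C Q K Y b (act \<odot>\<^bsub>C\<^esub> pairing C Q K Y b' c)"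
    using act unfolding is_action_def Let_def P_def Q_def b_def b'_def c_def K_def by blast
  note l = op_pairing[OF t(2) K K K m t(3,4)] and r = op_pairing[OF t(2) K Y Y a t(4,5)]
  show "ap act (pr K Y (gm G x x') y) = ap act (pr K Y x (ap act (pr K Y x' y)))"
    if x: "x \<in> pts K" "x' \<in> pts K" "y \<in> pts Y" "\<pi> K x = \<pi> K x'" "\<pi> K x' = \<pi> Y y"
  proof -
    let ?w = "pr P Y (pr K K x x') y"
    note w = t(6)[OF x]
    have "ap (act \<odot>\<^bsub>C\<^esub> pairing C Q K Y (gmul G \<odot>\<^bsub>C\<^esub> pairing C Q K K b b') c) ?w = ap act (pr K Y (gm G x x') y)"
      using ap_op_pairing[OF t(2) K Y Y a l(1) t(5), of ?w] l(2)[of ?w] w by (simp add: gm_def flip: K_def)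
    moreover have "ap (act \<odot>\<^bsub>C\<^esub> pairing C Q K Y b (act \<odot>\<^bsub>C\<^esub> pairing C Q K Y b' c)) ?w
        = ap act (pr K Y x (ap act (pr K Y x' y)))"
      using ap_op_pairing[OF t(2) K Y Y a t(3) r(1), of ?w] r(2)[of ?w] w by simp
    ultimately show ?thesis using eq by simp
  qed
qed

text \<open>The mono identifies \<open>R\<close> with the graph of the orbit relation, and invariant
  clopen sets separate the orbits. The coequaliser of the two legs identifies exactly the points not
  separated in this way, so its kernel pair is \<open>R\<close> again.\<close>

lemma action_Barr_exact_C: "action_Barr_exact C"
  unfolding action_Barr_exact_def
proof (intro conjI allI impI)
  show "regular_category C" by (rule regular_C)
  fix H Y act R e j
  assume asm: "group_object C H \<and> is_action C H Y act \<and> is_regular_epi C (prod_obj C (gcar H) Y) R e \<and>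
    is_mono C R (prod_obj C Y Y) j \<and>
    j \<odot>\<^bsub>C\<^esub> e = pairing C (prod_obj C (gcar H) Y) Y Y act (proj2 C (gcar H) Y)"
  define K where "K = gcar H"
  have H: "group_object C H" and A: "is_action C H Y act" and ep: "is_regular_epi C (prod_obj C K Y) R e"
    and mono: "is_mono C R (prod_obj C Y Y) j"
    and je: "j \<odot>\<^bsub>C\<^esub> e = pairing C (prod_obj C K Y) Y Y act (proj2 C K Y)"
    using asm by (auto simp: K_def)
  note gc = group_closed[OF H, folded K_def] and gl = group_laws[OF H, folded K_def]
    and al = action_laws[OF H A, folded K_def]
  note K = gc(1) and Y = al(1)
  define ac where "ac h y = ap act (pr K Y h y)" for h y
  note KY = prod_Ob[OF K Y] and YY = prod_Ob[OF Y Y]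
  interpret F: fibred_action d B "T K" "T Y" "\<pi> K" "\<pi> Y" ac "fibre_product K Y"
  proof
    show "tame d B" "tame d (T K)" "tame d (T Y)" by (rule tame_B, rule Ob_tame[OF K], rule Ob_tame[OF Y])
    show "continuous_map (T K) B (\<pi> K)" "continuous_map (T Y) B (\<pi> Y)" by (rule Ob_\<pi>[OF K], rule Ob_\<pi>[OF Y])
    show "fibre_product K Y = {(h, y). h \<in> pts K \<and> y \<in> pts Y \<and> \<pi> K h = \<pi> Y y}" by (rule fibre_product_def)
    show "continuous_map (subtopology (prod_topology (T K) (T Y)) (fibre_product K Y)) (T Y) (\<lambda>(h, y). ac h y)"
      unfolding ac_def by (rule binary_op_cont[OF K Y Y al(2)])
  next
    fix h y assume hy: "(h, y) \<in> fibre_product K Y"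
    then have h: "h \<in> pts K" "y \<in> pts Y" "\<pi> K h = \<pi> Y y" by (auto simp: fibre_product_def)
    show "\<pi> Y (ac h y) = \<pi> Y y" unfolding ac_def using binary_op(2)[OF K Y Y al(2) h] h by simp
    have i: "(gi H h, y) \<in> fibre_product K Y" using h gc(6,7)[OF h(1)] by (simp add: fibre_product_def)
    have "ac (gi H h) (ac h y) = ac (gm H (gi H h) h) y"
      unfolding ac_def using al(4)[of "gi H h" h y] gc(6,7)[OF h(1)] h by simp
    also have "\<dots> = y" unfolding ac_def using gl(4)[OF h(1)] h(3) al(3)[OF h(2)] by simp
    finally show "\<exists>h'. (h', y) \<in> fibre_product K Y \<and> ac h' (ac h y) = y" using i by blast
    fix h' assume h': "(h', y) \<in> fibre_product K Y"
    then have h'': "h' \<in> pts K" "\<pi> K h' = \<pi> Y y" by (auto simp: fibre_product_def)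
    have e: "\<pi> K h = \<pi> K h'" using h h'' by simp
    have "(gm H h h', y) \<in> fibre_product K Y"
      using h h'' gc(2,3)[OF h(1) h''(1) e] by (simp add: fibre_product_def)
    moreover have "ac (gm H h h') y = ac h (ac h' y)"
      unfolding ac_def using al(4)[OF h(1) h''(1) h(2) e h''(2)] .
    ultimately show "\<exists>h''. (h'', y) \<in> fibre_product K Y \<and> ac h'' y = ac h (ac h' y)" by blast
  next
    fix y assume y: "y \<in> pts Y"
    have "(go H (\<pi> Y y), y) \<in> fibre_product K Y"
      using y gc(4,5)[OF \<pi>_in[OF Y y]] by (simp add: fibre_product_def)
    then show "\<exists>h. (h, y) \<in> fibre_product K Y \<and> ac h y = y" unfolding ac_def using al(3)[OF y] by blast
  qed
  have R: "R \<in> Ob C" "e \<in> Hom C (prod_obj C K Y) R" "ap e ` pts (prod_obj C K Y) = pts R"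
    using ep unfolding regular_epi_iff by blast+
  have j: "j \<in> Hom C R (prod_obj C Y Y)" using mono by (simp add: is_mono_def)
  define r where "r = proj1 C Y Y \<odot>\<^bsub>C\<^esub> j"
  define s where "s = proj2 C Y Y \<odot>\<^bsub>C\<^esub> j"
  have rs: "r \<in> Hom C R Y" "s \<in> Hom C R Y"
    unfolding r_def s_def by (rule Comp_Hom[OF j _ R(1) YY Y]; rule proj1_Hom[OF Y Y] proj2_Hom[OF Y Y])+
  have ap_rs: "ap r w = ap (proj1 C Y Y) (ap j w)" "ap s w = ap (proj2 C Y Y) (ap j w)" if "w \<in> pts R" for w
    unfolding r_def s_def using ap_Comp[OF j R(1) YY that] by simp_all
  have rse: "ap r (ap e (pr K Y h y)) = ac h y \<and> ap s (ap e (pr K Y h y)) = y \<and> ap e (pr K Y h y) \<in> pts R"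
    if h: "h \<in> pts K" "y \<in> pts Y" "\<pi> K h = \<pi> Y y" for h y
  proof -
    note z = pr[OF K Y h]
    have er: "ap e (pr K Y h y) \<in> pts R" by (rule Hom_in[OF R(2) KY R(1) z(1)])
    have "ap j (ap e (pr K Y h y)) = ap (j \<odot>\<^bsub>C\<^esub> e) (pr K Y h y)" using ap_Comp[OF R(2) KY R(1) z(1)] by simp
    also have "\<dots> = pr Y Y (ac h y) y"
      unfolding je ac_def using ap_pairing[OF KY Y Y al(2) proj2_Hom[OF K Y] z(1)] z(3) by simp
    finally have je: "ap j (ap e (pr K Y h y)) = pr Y Y (ac h y) y" .
    note b = binary_op[OF K Y Y al(2) h, folded ac_def]
    have e: "\<pi> Y (ac h y) = \<pi> Y y" using b(2) h(3) by simp
    show ?thesis using ap_rs[OF er] er pr[OF Y Y b(1) h(2) e] je by simp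
  qed
  \<comment> \<open>The first leg carries the moved point and the second the original one, hence the
    order of the arguments of \<open>F.orb\<close>.\<close>
  have im: "(\<lambda>w. (ap r w, ap s w)) ` pts R = {(a, b). F.orb b a}"
  proof
    show "(\<lambda>w. (ap r w, ap s w)) ` pts R \<subseteq> {(a, b). F.orb b a}"
    proof
      fix p assume "p \<in> (\<lambda>w. (ap r w, ap s w)) ` pts R"
      then obtain z where z: "z \<in> pts (prod_obj C K Y)" "p = (ap r (ap e z), ap s (ap e z))"
        using R(3) by (metis (no_types, lifting) imageE)
      obtain h y where h: "h \<in> pts K" "y \<in> pts Y" "\<pi> K h = \<pi> Y y" "z = pr K Y h y" by (rule prod_pts[OF K Y z(1)])
      then have "p = (ac h y, y)" "(h, y) \<in> fibre_product K Y" using z rse[OF h(1-3)] by (simp_all add: fibre_product_def)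
      then show "p \<in> {(a, b). F.orb b a}" unfolding F.orb_def by blast
    qed
    show "{(a, b). F.orb b a} \<subseteq> (\<lambda>w. (ap r w, ap s w)) ` pts R"
    proof clarify
      fix a b assume "F.orb b a"
      then obtain h where h: "h \<in> pts K" "b \<in> pts Y" "\<pi> K h = \<pi> Y b" "a = ac h b"
        unfolding F.orb_def by (auto simp: fibre_product_def)
      then have "(a, b) = (ap r (ap e (pr K Y h b)), ap s (ap e (pr K Y h b)))" using rse[OF h(1-3)] by simp
      then show "(a, b) \<in> (\<lambda>w. (ap r w, ap s w)) ` pts R" using rse[OF h(1-3)] by blast
    qed
  qed
  have inj: "inj_on (\<lambda>w. (ap r w, ap s w)) (pts R)"
  proof (rule inj_onI)
    fix w w' assume w: "w \<in> pts R" "w' \<in> pts R" "(ap r w, ap s w) = (ap r w', ap s w')"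
    have "ap j w = ap j w'"
      by (rule joint_bij_inj[OF prod_cone[OF Y Y] Hom_in[OF j R(1) YY w(1)] Hom_in[OF j R(1) YY w(2)]])
        (use w ap_rs in simp_all)
    then show "w = w'" using mono_inj[OF mono] w by (simp add: inj_on_def)
  qed
  obtain Q q where Q: "is_coequaliser C R Y r s Q q"
    "\<forall>y\<in>pts Y. \<forall>y'\<in>pts Y. ap q y = ap q y' \<longleftrightarrow> \<not> coeq_sep R Y r s y y'"
    using coequaliser_ex[OF R(1) Y rs] by metis
  have oQ: "Q \<in> Ob C" "q \<in> Hom C Y Q" using Q(1) by (auto simp: is_coequaliser_def)
  \<comment> \<open>An invariant clopen set has the same preimage under both legs, so it is
    admissible for the coequaliser; distinct orbits therefore stay apart.\<close>
  have q_orb: "ap q a = ap q b \<longleftrightarrow> F.orb b a" if ab: "a \<in> pts Y" "b \<in> pts Y" for a b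
  proof
    assume "F.orb b a"
    then obtain w where w: "w \<in> pts R" "a = ap r w" "b = ap s w" using im by force
    have "\<not> coeq_sep R Y r s (ap r w) (ap s w)" using w(1) by (auto simp: coeq_sep_def clopen_sep_by_def)
    then show "ap q a = ap q b" using Q(2) ab w by blast
  next
    assume eq: "ap q a = ap q b"
    show "F.orb b a"
    proof (rule ccontr)
      assume no: "\<not> F.orb b a"
      obtain V where V: "clopenin (T Y) V" "\<And>h y. (h, y) \<in> fibre_product K Y \<Longrightarrow> ac h y \<in> V \<longleftrightarrow> y \<in> V"
        "(b \<in> V) \<noteq> (a \<in> V)"
        using F.orbit_separated[OF ab(2,1) no] unfolding clopen_sep_by_def by blast
      have "ap r w \<in> V \<longleftrightarrow> ap s w \<in> V" if w: "w \<in> pts R" for w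
      proof -
        have "F.orb (ap s w) (ap r w)" using im w by blast
        then show ?thesis using V(2) unfolding F.orb_def by metis
      qed
      then have "coeq_sep R Y r s a b" using V(1,3) unfolding coeq_sep_def clopen_sep_by_def by blast
      then show False using Q(2) eq ab by blast
    qed
  qed
  have "joint_bij R Y Y r s {(a, b). a \<in> pts Y \<and> b \<in> pts Y \<and> ap q a = ap q b}"
  proof -
    have "{(a, b). F.orb b a} = {(a, b). a \<in> pts Y \<and> b \<in> pts Y \<and> ap q a = ap q b}"
      using q_orb F.orb_in by blast
    then show ?thesis using inj im R(1) Y rs by (simp add: joint_bij_def bij_betw_def)
  qed
  then have "is_pullback C Y Y Q q q R r s" using is_pullback_iff[OF Y Y oQ(1,2,2)] by simp
  then show "effective C R Y (proj1 C Y Y \<odot>\<^bsub>C\<^esub> j) (proj2 C Y Y \<odot>\<^bsub>C\<^esub> j)"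
    unfolding effective_def r_def[symmetric] s_def[symmetric] using Q(1) by blast
qed

section \<open>The category of group objects\<close>

lemma Grp_Ob: "G \<in> Ob (Grp C) \<longleftrightarrow> group_object C G"
  by (simp add: Grp_def)

lemma Grp_Comp: "Comp (Grp C) = Comp C"
  by (simp add: Grp_def)

lemma Grp_Id: "cat.Id (Grp C) G = cat.Id C (gcar G)"
  by (simp add: Grp_def)

lemma Grp_Hom_iff:
  assumes G: "group_object C G" and H: "group_object C H"
  shows "f \<in> Hom (Grp C) G H \<longleftrightarrow> f \<in> Hom C (gcar G) (gcar H) \<and>
    (\<forall>x\<in>pts (gcar G). \<forall>y\<in>pts (gcar G). \<pi> (gcar G) x = \<pi> (gcar G) y \<longrightarrow>
       ap f (gm G x y) = gm H (ap f x) (ap f y))"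
proof (cases "f \<in> Hom C (gcar G) (gcar H)")
  case False
  then show ?thesis by (simp add: Grp_def Let_def)
next
  case f: True
  define K L where "K = gcar G" and "L = gcar H"
  have K: "K \<in> Ob C" "gmul G \<in> Hom C (prod_obj C K K) K" and L: "L \<in> Ob C" "gmul H \<in> Hom C (prod_obj C L L) L"
    using G H unfolding group_object_iff by (auto simp: group_data_def K_def L_def)
  have f: "f \<in> Hom C K L" using f by (simp add: K_def L_def)
  note KK = prod_Ob[OF K(1) K(1)] and p = proj1_Hom[OF K(1) K(1)] proj2_Hom[OF K(1) K(1)]
  have fp: "f \<odot>\<^bsub>C\<^esub> proj1 C K K \<in> Hom C (prod_obj C K K) L" "f \<odot>\<^bsub>C\<^esub> proj2 C K K \<in> Hom C (prod_obj C K K) L"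
    by (rule Comp_Hom[OF p(1) f KK K(1) L(1)], rule Comp_Hom[OF p(2) f KK K(1) L(1)])
  note o = op_pairing[OF KK L(1) L(1) L(1) L(2) fp]
  have val: "ap (f \<odot>\<^bsub>C\<^esub> gmul G) (pr K K x y) = ap f (gm G x y)"
    "ap (gmul H \<odot>\<^bsub>C\<^esub> pairing C (prod_obj C K K) L L (f \<odot>\<^bsub>C\<^esub> proj1 C K K) (f \<odot>\<^bsub>C\<^esub> proj2 C K K)) (pr K K x y)
      = gm H (ap f x) (ap f y)"
    if x: "x \<in> pts K" "y \<in> pts K" "\<pi> K x = \<pi> K y" for x y
  proof -
    note z = pr[OF K(1) K(1) x]
    show "ap (f \<odot>\<^bsub>C\<^esub> gmul G) (pr K K x y) = ap f (gm G x y)"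
      using ap_Comp[OF K(2) KK K(1) z(1)] by (simp add: gm_def K_def)
    show "ap (gmul H \<odot>\<^bsub>C\<^esub> pairing C (prod_obj C K K) L L (f \<odot>\<^bsub>C\<^esub> proj1 C K K) (f \<odot>\<^bsub>C\<^esub> proj2 C K K)) (pr K K x y)
      = gm H (ap f x) (ap f y)"
      using o(2)[OF z(1)] ap_Comp[OF p(1) KK K(1) z(1)] ap_Comp[OF p(2) KK K(1) z(1)] z by (simp add: gm_def L_def)
  qed
  have "f \<odot>\<^bsub>C\<^esub> gmul G = gmul H \<odot>\<^bsub>C\<^esub> pairing C (prod_obj C K K) L L (f \<odot>\<^bsub>C\<^esub> proj1 C K K) (f \<odot>\<^bsub>C\<^esub> proj2 C K K)
    \<longleftrightarrow> (\<forall>x\<in>pts K. \<forall>y\<in>pts K. \<pi> K x = \<pi> K y \<longrightarrow> ap f (gm G x y) = gm H (ap f x) (ap f y))"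
    unfolding Hom_eq_iff[OF Comp_Hom[OF K(2) f KK K(1) L(1)] o(1) KK L(1)]
  proof (intro iffI ballI impI)
    fix z assume all: "\<forall>x\<in>pts K. \<forall>y\<in>pts K. \<pi> K x = \<pi> K y \<longrightarrow> ap f (gm G x y) = gm H (ap f x) (ap f y)"
      and z: "z \<in> pts (prod_obj C K K)"
    obtain x y where x: "x \<in> pts K" "y \<in> pts K" "\<pi> K x = \<pi> K y" and z: "z = pr K K x y"
      by (rule prod_pts[OF K(1) K(1) z])
    show "ap (f \<odot>\<^bsub>C\<^esub> gmul G) z
      = ap (gmul H \<odot>\<^bsub>C\<^esub> pairing C (prod_obj C K K) L L (f \<odot>\<^bsub>C\<^esub> proj1 C K K) (f \<odot>\<^bsub>C\<^esub> proj2 C K K)) z"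
      unfolding z val[OF x] using all x by blast
  next
    fix x y assume all: "\<forall>z\<in>pts (prod_obj C K K). ap (f \<odot>\<^bsub>C\<^esub> gmul G) z
      = ap (gmul H \<odot>\<^bsub>C\<^esub> pairing C (prod_obj C K K) L L (f \<odot>\<^bsub>C\<^esub> proj1 C K K) (f \<odot>\<^bsub>C\<^esub> proj2 C K K)) z"
      and x: "x \<in> pts K" "y \<in> pts K" "\<pi> K x = \<pi> K y"
    show "ap f (gm G x y) = gm H (ap f x) (ap f y)"
      using all[rule_format, OF pr_in[OF K(1) K(1) x]] val[OF x] by simp
  qed
  then show ?thesis using f by (simp add: Grp_def Let_def K_def L_def)
qed

lemma category_Grp: "category (Grp C)"
proof
  fix G assume "G \<in> Ob (Grp C)"
  then have G: "group_object C G" by (simp add: Grp_Ob)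
  note K = group_closed[OF G]
  show "cat.Id (Grp C) G \<in> Hom (Grp C) G G"
    unfolding Grp_Hom_iff[OF G G] Grp_Id using Id_Hom[OF K(1)] ap_Id[OF K(1)] K(2) by simp
next
  fix G H K f g assume "G \<in> Ob (Grp C)" "H \<in> Ob (Grp C)" "K \<in> Ob (Grp C)"
    and f: "f \<in> Hom (Grp C) G H" and g: "g \<in> Hom (Grp C) H K"
  then have G: "group_object C G" and H: "group_object C H" and K: "group_object C K" by (simp_all add: Grp_Ob)
  note o = group_closed(1)[OF G] group_closed(1)[OF H] group_closed(1)[OF K]
  have f': "f \<in> Hom C (gcar G) (gcar H)" and g': "g \<in> Hom C (gcar H) (gcar K)"
    using f g by (simp_all add: Grp_Hom_iff G H K)
  show "g \<odot>\<^bsub>Grp C\<^esub> f \<in> Hom (Grp C) G K"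
    unfolding Grp_Hom_iff[OF G K] Grp_Comp
  proof (intro conjI ballI impI)
    show "g \<odot>\<^bsub>C\<^esub> f \<in> Hom C (gcar G) (gcar K)" by (rule Comp_Hom[OF f' g' o])
    fix x y assume x: "x \<in> pts (gcar G)" "y \<in> pts (gcar G)" "\<pi> (gcar G) x = \<pi> (gcar G) y"
    have "ap f (gm G x y) = gm H (ap f x) (ap f y)" using f x unfolding Grp_Hom_iff[OF G H] by blast
    moreover have "ap g (gm H (ap f x) (ap f y)) = gm K (ap g (ap f x)) (ap g (ap f y))"
      using g Hom_in[OF f' o(1,2)] Hom_\<pi>[OF f' o(1,2)] x unfolding Grp_Hom_iff[OF H K] by simp
    ultimately show "ap (g \<odot>\<^bsub>C\<^esub> f) (gm G x y) = gm K (ap (g \<odot>\<^bsub>C\<^esub> f) x) (ap (g \<odot>\<^bsub>C\<^esub> f) y)"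
      using ap_Comp[OF f' o(1,2)] x group_closed(2)[OF G x] by simp
  qed
next
  fix G H f assume "G \<in> Ob (Grp C)" "H \<in> Ob (Grp C)" and f: "f \<in> Hom (Grp C) G H"
  then have G: "group_object C G" and H: "group_object C H" by (simp_all add: Grp_Ob)
  have "f \<in> Hom C (gcar G) (gcar H)" using f by (simp add: Grp_Hom_iff G H)
  then show "f \<odot>\<^bsub>Grp C\<^esub> cat.Id (Grp C) G = f" "cat.Id (Grp C) H \<odot>\<^bsub>Grp C\<^esub> f = f"
    unfolding Grp_Comp Grp_Id
    using category.Comp_Id[OF category_C] category.Id_Comp[OF category_C] group_closed(1)[OF G] group_closed(1)[OF H] by blast+
next
  fix G H K L f g h
  show "(h \<odot>\<^bsub>Grp C\<^esub> g) \<odot>\<^bsub>Grp C\<^esub> f = h \<odot>\<^bsub>Grp C\<^esub> (g \<odot>\<^bsub>Grp C\<^esub> f)"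
    unfolding Grp_Comp by (simp add: Comp_eq map_comp_def fun_eq_iff split: option.split)
qed

end

section \<open>Free group objects\<close>

text \<open>The base is the one-point space on \<open>unit\<close>, so the fibre conditions of
  \<open>concrete_cat\<close> become trivial equations.\<close>

locale absolute_cat = concrete_cat U C d "discrete_topology {()}" T "\<lambda>_ _. ()"
  for U :: "'u set set" and C :: "('o, 'u \<rightharpoonup> 'u) cat" and d :: bool and T :: "'o \<Rightarrow> 'u topology"
begin

definition tg_of :: "('o, 'u \<rightharpoonup> 'u) grp_obj \<Rightarrow> 'u tg" where
  "tg_of G = \<lparr>tg_top = T (gcar G), tg_mul = gm G, tg_one = go G (), tg_inv = gi G\<rparr>"

lemma tg_of_simps:
  "tg_top (tg_of G) = T (gcar G)" "tg_mul (tg_of G) = gm G" "tg_one (tg_of G) = go G ()" "tg_inv (tg_of G) = gi G"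
  by (simp_all add: tg_of_def)

lemma fibre_product_top:
  "subtopology (prod_topology (T X) (T Y)) (fibre_product X Y) = prod_topology (T X) (T Y)"
proof -
  have "fibre_product X Y = topspace (prod_topology (T X) (T Y))"
    by (auto simp: fibre_product_def)
  then show ?thesis by (metis subtopology_topspace)
qed

lemma tgroup_of:
  assumes G: "group_object C G" shows "tgroup d (tg_of G)"
proof -
  have dat: "gcar G \<in> Ob C" "gmul G \<in> Hom C (prod_obj C (gcar G) (gcar G)) (gcar G)" "ginv G \<in> Hom C (gcar G) (gcar G)"
    using G unfolding group_object_iff group_data_def by blast+
  note c = group_closed[OF G] and l = group_laws[OF G]
  have "continuous_map (prod_topology (T (gcar G)) (T (gcar G))) (T (gcar G)) (\<lambda>(x, y). gm G x y)"
    using binary_op_cont[OF dat(1,1,1,2)] unfolding fibre_product_top gm_def .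
  moreover have "continuous_map (T (gcar G)) (T (gcar G)) (gi G)"
    using Hom_cont[OF dat(3,1,1)] by (simp add: gi_def[abs_def])
  ultimately show ?thesis
    unfolding tgroup_def tg_of_simps using c(4) l Ob_tame[OF c(1)] by simp
qed

lemma Grp_Hom_thom:
  assumes "group_object C G" "group_object C H"
  shows "f \<in> Hom (Grp C) G H \<longleftrightarrow> f \<in> Hom C (gcar G) (gcar H) \<and> thom (tg_of G) (tg_of H) (ap f)"
  unfolding Grp_Hom_iff[OF assms] thom_def tg_of_simps
  using Hom_cont[of f "gcar G" "gcar H"] group_closed(1)[OF assms(1)] group_closed(1)[OF assms(2)] by auto

lemma mk_Grp_Hom:
  assumes "group_object C G" "group_object C H" "thom (tg_of G) (tg_of H) \<psi>"
  shows "mk (gcar G) \<psi> \<in> Hom (Grp C) G H"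
proof -
  note o = group_closed(1)[OF assms(1)] group_closed(1)[OF assms(2)]
  have "mk (gcar G) \<psi> \<in> Hom C (gcar G) (gcar H)"
    using assms(3) by (intro mk_Hom o) (auto simp: thom_def tg_of_simps)
  then show ?thesis
    unfolding Grp_Hom_iff[OF assms(1,2)]
    using assms(3) group_closed(2)[OF assms(1)] by (simp add: ap_mk thom_def tg_of_simps)
qed

text \<open>The operations agree with those of \<open>G'\<close> only on its carrier, since an arrow
  carries no information outside its domain.\<close>

lemma ex_group_object:
  assumes G': "tgroup d G'" and U: "tg_set G' \<in> U"
  obtains G where "group_object C G" "T (gcar G) = tg_top G'"
    "\<forall>x\<in>tg_set G'. \<forall>y\<in>tg_set G'. gm G x y = tg_mul G' x y" "go G () = tg_one G'"
    "\<forall>x\<in>tg_set G'. gi G x = tg_inv G' x"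
proof -
  obtain K where K: "K \<in> Ob C" "T K = tg_top G'"
    using Ob_ex[OF tgroup_tame[OF G'] U, of "\<lambda>_. ()"] by auto
  note c = tgroup_closed[OF G', folded K(2)] and l = tgroup_laws[OF G', folded K(2)]
  note KK = prod_Ob[OF K(1) K(1)] and p = proj1_Hom[OF K(1) K(1)] proj2_Hom[OF K(1) K(1)]
  let ?m = "mk (prod_obj C K K) (\<lambda>z. tg_mul G' (ap (proj1 C K K) z) (ap (proj2 C K K) z))"
  let ?e = "mk (terminal_obj C) (\<lambda>_. tg_one G')"
  let ?i = "mk K (tg_inv G')"
  define G where "G = \<lparr>gcar = K, gmul = ?m, gunit = ?e, ginv = ?i\<rparr>"
  have "continuous_map (T (prod_obj C K K)) (prod_topology (T K) (T K)) (\<lambda>z. (ap (proj1 C K K) z, ap (proj2 C K K) z))"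
    by (intro continuous_map_pairedI Hom_cont p KK K)
  from continuous_map_compose[OF this tgroup_mul_continuous[OF G', folded K(2)]]
  have "?m \<in> Hom C (prod_obj C K K) K" by (intro mk_Hom KK K) (simp_all add: comp_def)
  moreover have "?e \<in> Hom C (terminal_obj C) K" using c(1) by (intro mk_Hom terminal_Ob K) auto
  moreover have "?i \<in> Hom C K K" using tgroup_inv_continuous[OF G', folded K(2)] by (intro mk_Hom K) auto
  ultimately have dat: "group_data G" using K by (simp add: group_data_def G_def)
  have gm: "gm G x y = tg_mul G' x y" if "x \<in> pts K" "y \<in> pts K" for x y
    using pr[OF K(1) K(1) that] by (simp add: gm_def G_def ap_mk)
  have go: "go G () = tg_one G'"
    using tm(1)[of "()"] by (simp add: go_def G_def ap_mk)
  have gi: "gi G x = tg_inv G' x" if "x \<in> pts K" for x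
    using that by (simp add: gi_def G_def ap_mk)
  have Gc: "gcar G = K" by (simp add: G_def)
  have "group_points G"
    unfolding group_points_def Let_def Gc using gm go gi c l by simp
  then have "group_object C G" using dat by (simp add: group_object_iff)
  then show ?thesis using that gm go gi K(2) Gc by metis
qed

text \<open>Needed because a group object reproduces a given group only on the carrier. Words in
  elements of \<open>S\<close> never leave it.\<close>

lemma gen_cong:
  assumes "tgroup d G" "S \<subseteq> tg_set G"
    "\<forall>x\<in>tg_set G. \<forall>y\<in>tg_set G. tg_mul H x y = tg_mul G x y" "tg_one H = tg_one G"
    "\<forall>x\<in>tg_set G. tg_inv H x = tg_inv G x"
  shows "gen H S = gen G S"
proof (intro subset_antisym subsetI)
  fix x assume "x \<in> gen G S"
  then show "x \<in> gen H S"
  proof induction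
    case one
    then show ?case using gen.one[of H S] assms(4) by simp
  next
    case (mul s w)
    then have "s \<in> tg_set G" "w \<in> tg_set G" using assms(2) gen_sub[OF assms(1,2)] by blast+
    then show ?case using gen.mul[of s S w H] mul assms(3) by simp
  next
    case (mul_inv s w)
    then have "s \<in> tg_set G" "w \<in> tg_set G" using assms(2) gen_sub[OF assms(1,2)] by blast+
    then show ?case using gen.mul_inv[of s S w H] mul_inv assms(3,5) tgroup_closed(2)[OF assms(1)] by simp
  qed
next
  fix x assume "x \<in> gen H S"
  then show "x \<in> gen G S"
  proof induction
    case one
    then show ?case using gen.one[of G S] assms(4) by simp
  next
    case (mul s w)
    then have "s \<in> tg_set G" "w \<in> tg_set G" using assms(2) gen_sub[OF assms(1,2)] by blast+
    then show ?case using gen.mul[of s S w G] mul assms(3) by simp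
  next
    case (mul_inv s w)
    then have "s \<in> tg_set G" "w \<in> tg_set G" using assms(2) gen_sub[OF assms(1,2)] by blast+
    then show ?case using gen.mul_inv[of s S w G] mul_inv assms(3,5) tgroup_closed(2)[OF assms(1)] by simp
  qed
qed

text \<open>Existence of the factorisation is \<open>free_tgroup\<close> carried over to group
  objects; uniqueness holds because homomorphisms that agree on a dense subgroup are equal.\<close>

lemma free_group_object:
  assumes X: "X \<in> Ob C" and Rel: "Rel \<subseteq> pts X \<times> pts X \<times> pts X"
  obtains G \<iota> where "group_object C G" "\<iota> \<in> Hom C X (gcar G)"
    "\<forall>(x, y, z)\<in>Rel. gm G (ap \<iota> x) (ap \<iota> y) = ap \<iota> z" "dense_gen (tg_of G) (ap \<iota> ` pts X)"
    "\<forall>K \<phi>. group_object C K \<and> \<phi> \<in> Hom C X (gcar K) \<and> (\<forall>(x, y, z)\<in>Rel. gm K (ap \<phi> x) (ap \<phi> y) = ap \<phi> z) \<longrightarrow>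
       (\<exists>!\<psi>. \<psi> \<in> Hom (Grp C) G K \<and> \<psi> \<odot>\<^bsub>C\<^esub> \<iota> = \<phi>)"
proof -
  obtain G' :: "'u tg" and k where G': "tgroup d G'" "tg_set G' \<in> U" "continuous_map (T X) (tg_top G') k"
    "satisfies Rel G' k" "dense_gen G' (k ` pts X)"
    and univ: "\<forall>(K :: 'u tg) \<phi>. tgroup d K \<longrightarrow> continuous_map (T X) (tg_top K) \<phi> \<longrightarrow> satisfies Rel K \<phi> \<longrightarrow>
       (\<exists>\<psi>. thom G' K \<psi> \<and> (\<forall>x\<in>pts X. \<psi> (k x) = \<phi> x))"
    by (rule free_tgroup[OF Ob_tame[OF X] small_U[OF Ob_U[OF X]] Rel]) blast
  obtain G where G: "group_object C G" "T (gcar G) = tg_top G'"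
    "\<forall>x\<in>tg_set G'. \<forall>y\<in>tg_set G'. gm G x y = tg_mul G' x y" "go G () = tg_one G'"
    "\<forall>x\<in>tg_set G'. gi G x = tg_inv G' x"
    by (rule ex_group_object[OF G'(1,2)])
  note oG = group_closed(1)[OF G(1)]
  let ?\<iota> = "mk X k"
  have k_in: "k x \<in> tg_set G'" if "x \<in> pts X" for x
    using continuous_map_image_subset_topspace[OF G'(3)] that by blast
  have \<iota>: "?\<iota> \<in> Hom C X (gcar G)" using G'(3) G(2) by (intro mk_Hom X oG) auto
  have im: "ap ?\<iota> ` pts X = k ` pts X" by (simp add: ap_mk)
  have rel: "gm G (ap ?\<iota> x) (ap ?\<iota> y) = ap ?\<iota> z" if "(x, y, z) \<in> Rel" for x y z
  proof -
    have "x \<in> pts X" "y \<in> pts X" "z \<in> pts X" using that Rel by blast+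
    moreover have "tg_mul G' (k x) (k y) = k z" using G'(4) that unfolding satisfies_def by blast
    ultimately show ?thesis using G(3) k_in by (simp add: ap_mk)
  qed
  have kG: "k ` pts X \<subseteq> tg_set G'" using k_in by blast
  have "gen (tg_of G) (k ` pts X) = gen G' (k ` pts X)"
    by (rule gen_cong[OF G'(1) kG]) (use G(3-5) in \<open>simp_all add: tg_of_simps\<close>)
  then have den: "dense_gen (tg_of G) (ap ?\<iota> ` pts X)"
    using G'(5) G(2) unfolding dense_gen_def im by (simp add: tg_of_simps)
  have toG': "thom (tg_of G) G' (\<lambda>x. x)"
    unfolding thom_def tg_of_simps using G(2,3) continuous_map_id[unfolded id_def, of "tg_top G'"] by simp
  have un: "\<exists>!\<psi>. \<psi> \<in> Hom (Grp C) G K \<and> \<psi> \<odot>\<^bsub>C\<^esub> ?\<iota> = \<phi>"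
    if K: "group_object C K" and \<phi>: "\<phi> \<in> Hom C X (gcar K)" and r: "\<forall>(x, y, z)\<in>Rel. gm K (ap \<phi> x) (ap \<phi> y) = ap \<phi> z" for K \<phi>
  proof -
    note oK = group_closed(1)[OF K]
    have "continuous_map (T X) (tg_top (tg_of K)) (ap \<phi>)" using Hom_cont[OF \<phi> X oK] by (simp add: tg_of_simps)
    moreover have "satisfies Rel (tg_of K) (ap \<phi>)" using r by (simp add: satisfies_def tg_of_simps)
    ultimately obtain \<psi> where \<psi>: "thom G' (tg_of K) \<psi>" "\<forall>x\<in>pts X. \<psi> (k x) = ap \<phi> x"
      using univ tgroup_of[OF K] by blast
    have "thom (tg_of G) (tg_of K) \<psi>" using thom_compose[OF toG' \<psi>(1)] .
    then have h: "mk (gcar G) \<psi> \<in> Hom (Grp C) G K" by (rule mk_Grp_Hom[OF G(1) K])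
    then have h': "mk (gcar G) \<psi> \<in> Hom C (gcar G) (gcar K)" by (simp add: Grp_Hom_iff[OF G(1) K])
    show ?thesis
    proof (rule ex1I[of _ "mk (gcar G) \<psi>"])
      have "mk (gcar G) \<psi> \<odot>\<^bsub>C\<^esub> ?\<iota> = \<phi>"
        using Comp_eqI[OF \<iota> h' \<phi> X oG oK] \<psi>(2) k_in by (simp add: ap_mk G(2))
      with h show "mk (gcar G) \<psi> \<in> Hom (Grp C) G K \<and> mk (gcar G) \<psi> \<odot>\<^bsub>C\<^esub> ?\<iota> = \<phi>" ..
      fix g assume g: "g \<in> Hom (Grp C) G K \<and> g \<odot>\<^bsub>C\<^esub> ?\<iota> = \<phi>"
      then have g': "g \<in> Hom C (gcar G) (gcar K)" "thom (tg_of G) (tg_of K) (ap g)"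
        unfolding Grp_Hom_thom[OF G(1) K] by blast+
      have hh: "thom (tg_of G) (tg_of K) (ap (mk (gcar G) \<psi>))" using h unfolding Grp_Hom_thom[OF G(1) K] by blast
      show "g = mk (gcar G) \<psi>"
      proof (rule Hom_ext[OF g'(1) h' oG oK])
        fix x assume x: "x \<in> pts (gcar G)"
        show "ap g x = ap (mk (gcar G) \<psi>) x"
        proof (rule thom_eq_on_dense[OF tgroup_of[OF G(1)] tgroup_of[OF K] g'(2) hh den])
          fix s assume "s \<in> ap ?\<iota> ` pts X"
          then obtain w where w: "w \<in> pts X" "s = ap ?\<iota> w" by blast
          then have "ap g s = ap \<phi> w" using g ap_Comp[OF \<iota> X oG w(1), of g] by simp
          also have "\<dots> = ap (mk (gcar G) \<psi>) s" using w \<psi>(2) k_in[OF w(1)] by (simp add: ap_mk G(2))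
          finally show "ap g s = ap (mk (gcar G) \<psi>) s" .
        qed (use x in \<open>simp add: tg_of_simps\<close>)
      qed
    qed
  qed
  show ?thesis by (rule that[OF G(1) \<iota> _ den]) (use rel un in blast)+
qed

text \<open>The coequaliser is the universal group on the space underlying \<open>H\<close> in which
  the products of \<open>H\<close> are kept and the two images of each point of \<open>G\<close>
  become equal.\<close>

lemma Grp_coequalisers: "has_coequalisers (Grp C)"
  unfolding has_coequalisers_def
proof (intro ballI)
  fix G H f g assume "G \<in> Ob (Grp C)" "H \<in> Ob (Grp C)" and f: "f \<in> Hom (Grp C) G H" and g: "g \<in> Hom (Grp C) G H"
  then have G: "group_object C G" and H: "group_object C H" by (simp_all add: Grp_Ob)
  note oG = group_closed(1)[OF G] and oH = group_closed(1)[OF H]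
  have f': "f \<in> Hom C (gcar G) (gcar H)" and g': "g \<in> Hom C (gcar G) (gcar H)"
    using f g by (simp_all add: Grp_Hom_iff G H)
  \<comment> \<open>Every relation must have the form x y = z, so the equation between the images of
    \<open>ap f w\<close> and \<open>ap g w\<close> is written with the unit of \<open>H\<close> as
    left factor; the first family already forces that unit to go to the unit.\<close>
  define Rel where "Rel = {(x, y, gm H x y) | x y. x \<in> pts (gcar H) \<and> y \<in> pts (gcar H)} \<union>
    {(go H (), ap f w, ap g w) | w. w \<in> pts (gcar G)}"
  have one: "go H () \<in> pts (gcar H)" using group_closed(4)[OF H] by simp
  have Rel: "Rel \<subseteq> pts (gcar H) \<times> pts (gcar H) \<times> pts (gcar H)"
    using group_closed(2)[OF H] one Hom_in[OF f' oG oH] Hom_in[OF g' oG oH] by (auto simp: Rel_def)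
  have rel_iff: "(\<forall>(x, y, z)\<in>Rel. gm K (ap \<phi> x) (ap \<phi> y) = ap \<phi> z) \<longleftrightarrow>
      \<phi> \<in> Hom (Grp C) H K \<and> \<phi> \<odot>\<^bsub>C\<^esub> f = \<phi> \<odot>\<^bsub>C\<^esub> g"
    if K: "group_object C K" and \<phi>: "\<phi> \<in> Hom C (gcar H) (gcar K)" for K \<phi>
  proof -
    note oK = group_closed(1)[OF K]
    have "(\<forall>(x, y, z)\<in>Rel. gm K (ap \<phi> x) (ap \<phi> y) = ap \<phi> z) \<longleftrightarrow>
        (\<forall>x\<in>pts (gcar H). \<forall>y\<in>pts (gcar H). gm K (ap \<phi> x) (ap \<phi> y) = ap \<phi> (gm H x y)) \<and>
        (\<forall>w\<in>pts (gcar G). gm K (ap \<phi> (go H ())) (ap \<phi> (ap f w)) = ap \<phi> (ap g w))"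
      unfolding Rel_def by blast
    also have "(\<forall>x\<in>pts (gcar H). \<forall>y\<in>pts (gcar H). gm K (ap \<phi> x) (ap \<phi> y) = ap \<phi> (gm H x y)) \<longleftrightarrow>
        \<phi> \<in> Hom (Grp C) H K"
      using \<phi> by (simp add: Grp_Hom_iff[OF H K]) metis
    also have "\<phi> \<in> Hom (Grp C) H K \<and> (\<forall>w\<in>pts (gcar G). gm K (ap \<phi> (go H ())) (ap \<phi> (ap f w)) = ap \<phi> (ap g w)) \<longleftrightarrow>
        \<phi> \<in> Hom (Grp C) H K \<and> (\<forall>w\<in>pts (gcar G). ap \<phi> (ap f w) = ap \<phi> (ap g w))"
    proof (rule conj_cong[OF refl])
      assume "\<phi> \<in> Hom (Grp C) H K"
      then have "ap \<phi> (go H ()) = go K ()"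
        using thom_one[OF tgroup_of[OF H] tgroup_of[OF K]] by (simp add: Grp_Hom_thom[OF H K] tg_of_simps)
      moreover have "gm K (go K ()) (ap \<phi> (ap f w)) = ap \<phi> (ap f w)" if "w \<in> pts (gcar G)" for w
        using group_laws(2)[OF K Hom_in[OF \<phi> oH oK Hom_in[OF f' oG oH that]]] by simp
      ultimately show "(\<forall>w\<in>pts (gcar G). gm K (ap \<phi> (go H ())) (ap \<phi> (ap f w)) = ap \<phi> (ap g w)) \<longleftrightarrow>
          (\<forall>w\<in>pts (gcar G). ap \<phi> (ap f w) = ap \<phi> (ap g w))" by simp
    qed
    also have "(\<forall>w\<in>pts (gcar G). ap \<phi> (ap f w) = ap \<phi> (ap g w)) \<longleftrightarrow> \<phi> \<odot>\<^bsub>C\<^esub> f = \<phi> \<odot>\<^bsub>C\<^esub> g"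
      using Comp_eq_Comp_iff[OF f' \<phi> g' \<phi> oG oH oH oK] by simp
    finally show ?thesis .
  qed
  obtain Q q where Q: "group_object C Q" "q \<in> Hom C (gcar H) (gcar Q)"
    "\<forall>(x, y, z)\<in>Rel. gm Q (ap q x) (ap q y) = ap q z" "dense_gen (tg_of Q) (ap q ` pts (gcar H))"
    and univ: "\<forall>K \<phi>. group_object C K \<and> \<phi> \<in> Hom C (gcar H) (gcar K) \<and>
       (\<forall>(x, y, z)\<in>Rel. gm K (ap \<phi> x) (ap \<phi> y) = ap \<phi> z) \<longrightarrow>
       (\<exists>!\<psi>. \<psi> \<in> Hom (Grp C) Q K \<and> \<psi> \<odot>\<^bsub>C\<^esub> q = \<phi>)"
    by (rule free_group_object[OF oH Rel])
  have "is_coequaliser (Grp C) G H f g Q q"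
    unfolding is_coequaliser_def Grp_Comp Grp_Ob
  proof (intro conjI ballI impI G H f g Q(1))
    show "q \<in> Hom (Grp C) H Q" "q \<odot>\<^bsub>C\<^esub> f = q \<odot>\<^bsub>C\<^esub> g" using rel_iff[OF Q(1,2)] Q(3) by blast+
    fix K h assume "K \<in> Ob (Grp C)" and h: "h \<in> Hom (Grp C) H K" "h \<odot>\<^bsub>C\<^esub> f = h \<odot>\<^bsub>C\<^esub> g"
    then have K: "group_object C K" by (simp add: Grp_Ob)
    have "h \<in> Hom C (gcar H) (gcar K)" using h(1) by (simp add: Grp_Hom_iff[OF H K])
    then show "\<exists>!k. k \<in> Hom (Grp C) Q K \<and> k \<odot>\<^bsub>C\<^esub> q = h" using univ K rel_iff[OF K] h by blast
  qed
  then show "\<exists>Q q. is_coequaliser (Grp C) G H f g Q q" by blast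
qed

text \<open>The coequaliser condition gives invariance under right multiplication by images of
  \<open>k\<close>, while words in \<open>gen\<close> also contain inverses; the last hypothesis
  turns an inverse letter into another image of \<open>k\<close>. Passing from the dense subgroup to
  the whole group uses that targets of arrows are Hausdorff.\<close>

lemma dense_generated_by:
  assumes G: "group_object C G" and X: "X \<in> Ob C" and k: "k \<in> Hom C X (gcar G)"
    and den: "dense_gen (tg_of G) (ap k ` pts X)"
    and inv: "\<And>x. x \<in> pts X \<Longrightarrow> \<exists>x'\<in>pts X. ap k x' = gi G (ap k x)"
  shows "generated_by C G X k"
proof -
  define K where "K = gcar G"
  note gc = group_closed[OF G, folded K_def] and gl = group_laws[OF G, folded K_def]
  note K = gc(1) and kK = k[folded K_def]
  have m: "gmul G \<in> Hom C (prod_obj C K K) K" using G unfolding group_object_iff by (simp add: group_data_def K_def)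
  note KX = prod_Ob[OF K X] and p = proj1_Hom[OF K X] proj2_Hom[OF K X]
  have kp: "k \<odot>\<^bsub>C\<^esub> proj2 C K X \<in> Hom C (prod_obj C K X) K" by (rule Comp_Hom[OF p(2) kK KX X K])
  note o = op_pairing[OF KX K K K m p(1) kp]
  let ?g = "gmul G \<odot>\<^bsub>C\<^esub> pairing C (prod_obj C K X) K K (proj1 C K X) (k \<odot>\<^bsub>C\<^esub> proj2 C K X)"
  have val: "pr K X l x \<in> pts (prod_obj C K X)" "ap (proj1 C K X) (pr K X l x) = l" "ap ?g (pr K X l x) = gm G l (ap k x)"
    if "l \<in> pts K" "x \<in> pts X" for l x
  proof -
    note z = pr[OF K X that refl]
    show "pr K X l x \<in> pts (prod_obj C K X)" "ap (proj1 C K X) (pr K X l x) = l" by (rule z)+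
    show "ap ?g (pr K X l x) = gm G l (ap k x)"
      using o(2)[OF z(1)] ap_Comp[OF p(2) KX X z(1)] z by (simp add: gm_def K_def)
  qed
  let ?t = "to_terminal C K"
  have "is_coequaliser C (prod_obj C K X) K (proj1 C K X) ?g (terminal_obj C) ?t"
  proof (rule coequaliserI[OF KX K terminal_Ob p(1) o(1) to_terminal_Hom[OF K]])
    have e: "go G () \<in> pts K" using gc(4)[of "()"] by simp
    have pts_t: "x = tm ()" if "x \<in> pts (terminal_obj C)" for x using tm(3)[OF that] by simp
    have "ap ?t (go G ()) = tm ()" using ap_to_terminal[OF K e] .
    then have te: "tm () \<in> ap ?t ` pts K" using e by (metis imageI)
    then show "ap ?t ` pts K = pts (terminal_obj C)"
      using Hom_in[OF to_terminal_Hom[OF K] K terminal_Ob] pts_t by fast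
    show "ap ?t (ap (proj1 C K X) z) = ap ?t (ap ?g z)" if "z \<in> pts (prod_obj C K X)" for z
      using ap_to_terminal[OF K] Hom_in[OF p(1) KX K that] Hom_in[OF o(1) KX K that] by simp
  next
    fix Z h y y' assume h: "Z \<in> Ob C" "h \<in> Hom C K Z"
      and eq: "\<And>z. z \<in> pts (prod_obj C K X) \<Longrightarrow> ap h (ap (proj1 C K X) z) = ap h (ap ?g z)"
      and y: "y \<in> pts K" "y' \<in> pts K"
    have inva: "ap h (gm G l (ap k x)) = ap h l" if "l \<in> pts K" "x \<in> pts X" for l x
      using eq[OF val(1)[OF that]] val(2,3)[OF that] by simp
    \<comment> \<open>Quantified over all \<open>l\<close>, because peeling the first letter
      \<open>s\<close> off a word replaces \<open>l\<close> by the product of \<open>l\<close> and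
      \<open>s\<close> in the induction.\<close>
    have gen_inv: "\<forall>l\<in>pts K. ap h (gm G l s) = ap h l" if "s \<in> gen (tg_of G) (ap k ` pts X)" for s
      using that
    proof induction
      case one
      then show ?case using gl(3) by (simp add: tg_of_simps)
    next
      case (mul s w)
      then obtain x where x: "x \<in> pts X" "s = ap k x" by blast
      have sw: "s \<in> pts K" "w \<in> pts K"
        using Hom_in[OF kK X K x(1)] x(2) gen_sub[OF tgroup_of[OF G], of "ap k ` pts X"] mul.hyps den
        by (auto simp: dense_gen_def tg_of_simps K_def)
      show ?case
      proof
        fix l assume l: "l \<in> pts K"
        have "gm G l (gm G s w) = gm G (gm G l s) w" using gl(1)[OF l sw] by simp
        then show "ap h (gm G l (tg_mul (tg_of G) s w)) = ap h l"
          using mul.IH gc(2)[OF l sw(1)] inva[OF l x(1)] x(2) by (simp add: tg_of_simps)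
      qed
    next
      case (mul_inv s w)
      then obtain x0 where x0: "x0 \<in> pts X" "s = ap k x0" by blast
      then obtain x where x: "x \<in> pts X" "gi G s = ap k x" using inv by metis
      have sw: "gi G s \<in> pts K" "w \<in> pts K"
        using Hom_in[OF kK X K x(1)] x(2) gen_sub[OF tgroup_of[OF G], of "ap k ` pts X"] mul_inv.hyps den
        by (auto simp: dense_gen_def tg_of_simps K_def)
      show ?case
      proof
        fix l assume l: "l \<in> pts K"
        have "gm G l (gm G (gi G s) w) = gm G (gm G l (gi G s)) w" using gl(1)[OF l sw] by simp
        then show "ap h (gm G l (tg_mul (tg_of G) (tg_inv (tg_of G) s) w)) = ap h l"
          using mul_inv.IH gc(2)[OF l sw(1)] inva[OF l x(1)] x(2) by (simp add: tg_of_simps)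
      qed
    qed
    have e: "go G () \<in> pts K" using gc(4)[of "()"] by simp
    \<comment> \<open>Invariance applied with \<open>l\<close> the unit compares each word with the
      unit.\<close>
    have gen_const: "ap h s = ap h (go G ())" if s: "s \<in> gen (tg_of G) (ap k ` pts X)" for s
    proof -
      have "s \<in> pts K" using gen_sub[OF tgroup_of[OF G], of "ap k ` pts X"] s den
        by (auto simp: dense_gen_def tg_of_simps K_def)
      then show ?thesis using gen_inv[OF s] e gl(2)[of s] by force
    qed
    have const: "ap h z = ap h (go G ())" if z: "z \<in> pts K" for z
    proof -
      have "closedin (T K) {x \<in> pts K. ap h x = ap h (go G ())}"
        by (rule closedin_continuous_maps_eq[OF tame_Hausdorff[OF Ob_tame[OF h(1)]] Hom_cont[OF h(2) K h(1)]])
          (use Hom_in[OF h(2) K h(1) e] in auto)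
      moreover have "z \<in> T K closure_of gen (tg_of G) (ap k ` pts X)"
        using den z by (simp add: dense_gen_def tg_of_simps K_def)
      ultimately show ?thesis
        using forall_in_closure_of[where P="\<lambda>x. ap h x = ap h (go G ())"] gen_const by blast
    qed
    show "ap h y = ap h y'" using const[OF y(1)] const[OF y(2)] by simp
  qed
  then show ?thesis unfolding generated_by_def Let_def K_def .
qed

end

section \<open>Adjunctions from universal arrows\<close>

text \<open>A choice of universal arrows is a left adjoint. The predicate \<open>P\<close> travels
  with the choice, since the generation condition has to hold for the very unit that witnesses the
  adjunction.\<close>

lemma left_adjoint_of_universal:
  assumes C: "category C" and D: "category D" and R: "is_ftor C D R"
    and ex: "\<And>X. X \<in> Ob D \<Longrightarrow> \<exists>A u. A \<in> Ob C \<and> u \<in> Hom D X (FOb R A) \<and>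
      (\<forall>K\<in>Ob C. \<forall>f\<in>Hom D X (FOb R K). \<exists>!g. g \<in> Hom C A K \<and> FHom R A K g \<odot>\<^bsub>D\<^esub> u = f) \<and> P X A u"
  shows "\<exists>L \<eta>. is_left_adjoint C D L R \<eta> \<and> (\<forall>X\<in>Ob D. P X (FOb L X) (\<eta> X))"
proof -
  have "\<exists>Au. \<forall>X\<in>Ob D. fst (Au X) \<in> Ob C \<and> snd (Au X) \<in> Hom D X (FOb R (fst (Au X))) \<and>
      (\<forall>K\<in>Ob C. \<forall>f\<in>Hom D X (FOb R K). \<exists>!g. g \<in> Hom C (fst (Au X)) K \<and> FHom R (fst (Au X)) K g \<odot>\<^bsub>D\<^esub> snd (Au X) = f) \<and>
      P X (fst (Au X)) (snd (Au X))"
    by (rule bchoice) (use ex in force)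
  then obtain Au where Au: "\<forall>X\<in>Ob D. fst (Au X) \<in> Ob C \<and> snd (Au X) \<in> Hom D X (FOb R (fst (Au X))) \<and>
      (\<forall>K\<in>Ob C. \<forall>f\<in>Hom D X (FOb R K). \<exists>!g. g \<in> Hom C (fst (Au X)) K \<and> FHom R (fst (Au X)) K g \<odot>\<^bsub>D\<^esub> snd (Au X) = f) \<and>
      P X (fst (Au X)) (snd (Au X))" ..
  define A where "A X = fst (Au X)" for X
  define u where "u X = snd (Au X)" for X
  have A: "A X \<in> Ob C" and u: "u X \<in> Hom D X (FOb R (A X))" and P: "P X (A X) (u X)" if "X \<in> Ob D" for X
    using Au that by (auto simp: A_def u_def)
  have univ: "\<exists>!g. g \<in> Hom C (A X) K \<and> FHom R (A X) K g \<odot>\<^bsub>D\<^esub> u X = f"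
    if "X \<in> Ob D" "K \<in> Ob C" "f \<in> Hom D X (FOb R K)" for X K f
    using Au that unfolding A_def u_def by blast
  have uniq: "g = g'" if "X \<in> Ob D" "K \<in> Ob C" "g \<in> Hom C (A X) K" "g' \<in> Hom C (A X) K"
    "FHom R (A X) K g \<odot>\<^bsub>D\<^esub> u X = FHom R (A X) K g' \<odot>\<^bsub>D\<^esub> u X"
    "FHom R (A X) K g' \<odot>\<^bsub>D\<^esub> u X \<in> Hom D X (FOb R K)" for X K g g'
    using univ[OF that(1,2,6)] that(3-5) by blast
  have RO: "FOb R K \<in> Ob D" if "K \<in> Ob C" for K using R that by (auto simp: is_ftor_def)
  have RH: "FHom R K K' g \<in> Hom D (FOb R K) (FOb R K')" if "K \<in> Ob C" "K' \<in> Ob C" "g \<in> Hom C K K'" for K K' g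
    using R that by (auto simp: is_ftor_def)
  have RI: "FHom R K K (cat.Id C K) = cat.Id D (FOb R K)" if "K \<in> Ob C" for K using R that by (auto simp: is_ftor_def)
  have RC: "FHom R K K'' (h \<odot>\<^bsub>C\<^esub> g) = FHom R K' K'' h \<odot>\<^bsub>D\<^esub> FHom R K K' g"
    if "K \<in> Ob C" "K' \<in> Ob C" "K'' \<in> Ob C" "g \<in> Hom C K K'" "h \<in> Hom C K' K''" for K K' K'' g h
    using R that by (auto simp: is_ftor_def)
  have comp: "FHom R (A X) K g \<odot>\<^bsub>D\<^esub> u X \<in> Hom D X (FOb R K)"
    if "X \<in> Ob D" "K \<in> Ob C" "g \<in> Hom C (A X) K" for X K g
    by (rule category.Comp_in_Hom[OF D that(1) RO[OF A[OF that(1)]] RO[OF that(2)] u[OF that(1)] RH[OF A[OF that(1)] that(2,3)]])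
  \<comment> \<open>On arrows the functor is forced by naturality of the unit.\<close>
  define L where "L = \<lparr>FOb = A, FHom = (\<lambda>X Y f. THE g. g \<in> Hom C (A X) (A Y) \<and> FHom R (A X) (A Y) g \<odot>\<^bsub>D\<^esub> u X = u Y \<odot>\<^bsub>D\<^esub> f)\<rparr>"
  have LO: "FOb L = A" by (simp add: L_def)
  have LH: "FHom L X Y f \<in> Hom C (A X) (A Y) \<and> FHom R (A X) (A Y) (FHom L X Y f) \<odot>\<^bsub>D\<^esub> u X = u Y \<odot>\<^bsub>D\<^esub> f"
    if "X \<in> Ob D" "Y \<in> Ob D" "f \<in> Hom D X Y" for X Y f
  proof -
    have "u Y \<odot>\<^bsub>D\<^esub> f \<in> Hom D X (FOb R (A Y))"
      by (rule category.Comp_in_Hom[OF D that(1,2) RO[OF A[OF that(2)]] that(3) u[OF that(2)]])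
    from theI'[OF univ[OF that(1) A[OF that(2)] this]] show ?thesis by (simp add: L_def)
  qed
  have "is_ftor D C L"
    unfolding is_ftor_def LO
  proof (intro conjI ballI)
    show "A X \<in> Ob C" if "X \<in> Ob D" for X using A that .
    show "FHom L X Y f \<in> Hom C (A X) (A Y)" if "X \<in> Ob D" "Y \<in> Ob D" "f \<in> Hom D X Y" for X Y f using LH that by blast
  next
    fix X assume X: "X \<in> Ob D"
    note I = category.Id_in_Hom[OF D X] and I' = category.Id_in_Hom[OF C A[OF X]]
    have "FHom R (A X) (A X) (cat.Id C (A X)) \<odot>\<^bsub>D\<^esub> u X = u X"
      using RI[OF A[OF X]] category.Id_Comp[OF D X RO[OF A[OF X]] u[OF X]] by simp
    moreover have "u X \<odot>\<^bsub>D\<^esub> cat.Id D X = u X" by (rule category.Comp_Id[OF D X RO[OF A[OF X]] u[OF X]])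
    ultimately show "FHom L X X (cat.Id D X) = cat.Id C (A X)"
      using LH[OF X X I] comp[OF X A[OF X] I'] by (intro uniq[OF X A[OF X] _ I']) simp_all
  next
    fix X Y Z f g assume o: "X \<in> Ob D" "Y \<in> Ob D" "Z \<in> Ob D" and f: "f \<in> Hom D X Y" and g: "g \<in> Hom D Y Z"
    note gf = category.Comp_in_Hom[OF D o f g]
    note a = A[OF o(1)] A[OF o(2)] A[OF o(3)]
    have Lf: "FHom L X Y f \<in> Hom C (A X) (A Y)" and Lg: "FHom L Y Z g \<in> Hom C (A Y) (A Z)"
      using LH[OF o(1,2) f] LH[OF o(2,3) g] by blast+
    note Lgf = category.Comp_in_Hom[OF C a Lf Lg]
    have "FHom R (A X) (A Z) (FHom L Y Z g \<odot>\<^bsub>C\<^esub> FHom L X Y f) \<odot>\<^bsub>D\<^esub> u X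
        = FHom R (A Y) (A Z) (FHom L Y Z g) \<odot>\<^bsub>D\<^esub> (FHom R (A X) (A Y) (FHom L X Y f) \<odot>\<^bsub>D\<^esub> u X)"
      unfolding RC[OF a Lf Lg]
      by (rule category.Comp_assoc[OF D o(1) RO[OF a(1)] RO[OF a(2)] RO[OF a(3)] u[OF o(1)] RH[OF a(1,2) Lf] RH[OF a(2,3) Lg]])
    also have "\<dots> = FHom R (A Y) (A Z) (FHom L Y Z g) \<odot>\<^bsub>D\<^esub> (u Y \<odot>\<^bsub>D\<^esub> f)" using LH[OF o(1,2) f] by simp
    also have "\<dots> = (FHom R (A Y) (A Z) (FHom L Y Z g) \<odot>\<^bsub>D\<^esub> u Y) \<odot>\<^bsub>D\<^esub> f"
      by (rule category.Comp_assoc[OF D o(1,2) RO[OF a(2)] RO[OF a(3)] f u[OF o(2)] RH[OF a(2,3) Lg], symmetric])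
    also have "\<dots> = (u Z \<odot>\<^bsub>D\<^esub> g) \<odot>\<^bsub>D\<^esub> f" using LH[OF o(2,3) g] by simp
    also have "\<dots> = u Z \<odot>\<^bsub>D\<^esub> (g \<odot>\<^bsub>D\<^esub> f)"
      by (rule category.Comp_assoc[OF D o(1,2,3) RO[OF a(3)] f g u[OF o(3)]])
    finally show "FHom L X Z (g \<odot>\<^bsub>D\<^esub> f) = FHom L Y Z g \<odot>\<^bsub>C\<^esub> FHom L X Y f"
      using LH[OF o(1,3) gf] comp[OF o(1) a(3) Lgf] by (intro uniq[OF o(1) a(3) _ Lgf]) simp_all
  qed
  moreover have "bij_betw (\<lambda>g. FHom R (A X) K g \<odot>\<^bsub>D\<^esub> u X) (Hom C (A X) K) (Hom D X (FOb R K))"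
    if X: "X \<in> Ob D" and K: "K \<in> Ob C" for X K
    unfolding bij_betw_def
  proof (intro conjI inj_onI subset_antisym subsetI)
    show "g = g'" if "g \<in> Hom C (A X) K" "g' \<in> Hom C (A X) K"
      "FHom R (A X) K g \<odot>\<^bsub>D\<^esub> u X = FHom R (A X) K g' \<odot>\<^bsub>D\<^esub> u X" for g g'
      by (rule uniq[OF X K that comp[OF X K that(2)]])
    show "f \<in> Hom D X (FOb R K)" if "f \<in> (\<lambda>g. FHom R (A X) K g \<odot>\<^bsub>D\<^esub> u X) ` Hom C (A X) K" for f
      using that comp[OF X K] by auto
    show "f \<in> (\<lambda>g. FHom R (A X) K g \<odot>\<^bsub>D\<^esub> u X) ` Hom C (A X) K" if f: "f \<in> Hom D X (FOb R K)" for f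
    proof -
      obtain g where "g \<in> Hom C (A X) K" "FHom R (A X) K g \<odot>\<^bsub>D\<^esub> u X = f" using univ[OF X K f] by blast
      then show ?thesis by blast
    qed
  qed
  ultimately have "is_left_adjoint C D L R u"
    unfolding is_left_adjoint_def LO using R u LH by blast
  then show ?thesis using P LO by metis
qed

section \<open>Slices and constant groups\<close>

lemma slice_Ob: "E \<in> Ob (slice_cat C B) \<longleftrightarrow> fst E \<in> Ob C \<and> snd E \<in> Hom C (fst E) B"
  by (auto simp: slice_cat_def)

lemma slice_Hom: "f \<in> Hom (slice_cat C B) E E' \<longleftrightarrow> f \<in> Hom C (fst E) (fst E') \<and> snd E' \<odot>\<^bsub>C\<^esub> f = snd E"
  by (auto simp: slice_cat_def split: prod.splits)

lemma slice_Comp: "Comp (slice_cat C B) = Comp C"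
  by (simp add: slice_cat_def)

lemma slice_Id: "cat.Id (slice_cat C B) E = cat.Id C (fst E)"
  by (simp add: slice_cat_def split: prod.splits)

context absolute_cat begin

text \<open>An object over \<open>B\<close> is a space with a continuous map to \<open>T B\<close>,
  and every such map on a small tame space occurs. Whatever is proved for an arbitrary base
  therefore holds in the slices.\<close>

lemma slice_concrete_cat:
  assumes B: "B \<in> Ob C"
  shows "concrete_cat U (slice_cat C B) d (T B) (\<lambda>E. T (fst E)) (\<lambda>E. ap (snd E))"
proof
  show "tame d (T B)" by (rule Ob_tame[OF B])
  show "small (pts B)" by (rule small_U[OF Ob_U[OF B]])
next
  fix E E' assume "E \<in> Ob (slice_cat C B)" "E' \<in> Ob (slice_cat C B)"
  then have o: "fst E \<in> Ob C" "snd E \<in> Hom C (fst E) B" "fst E' \<in> Ob C" "snd E' \<in> Hom C (fst E') B"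
    by (simp_all add: slice_Ob)
  have "f \<in> Hom (slice_cat C B) E E' \<longleftrightarrow> f \<in> Hom C (fst E) (fst E') \<and>
      (\<forall>x\<in>pts (fst E). ap (snd E') (ap f x) = ap (snd E) x)" for f
    unfolding slice_Hom using Comp_eqI[of f "fst E" "fst E'" "snd E'" B "snd E"] o B by blast
  then show "Hom (slice_cat C B) E E' = {f. dom f = pts (fst E) \<and> continuous_map (T (fst E)) (T (fst E')) (ap f) \<and>
      (\<forall>x\<in>pts (fst E). ap (snd E') (ap f x) = ap (snd E) x)}"
    using Hom_eq[OF o(1,3)] by (intro set_eqI) simp
next
  fix E assume "E \<in> Ob (slice_cat C B)"
  then have o: "fst E \<in> Ob C" "snd E \<in> Hom C (fst E) B" by (simp_all add: slice_Ob)
  show "cat.Id (slice_cat C B) E = Some |` pts (fst E)" using Id_eq[OF o(1)] by (simp add: slice_Id)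
  show "tame d (T (fst E))" "pts (fst E) \<in> U" "continuous_map (T (fst E)) (T B) (ap (snd E))"
    using Ob_tame Ob_U Hom_cont[OF o(2,1) B] o by blast+
next
  show "Comp (slice_cat C B) = (\<circ>\<^sub>m)" by (simp add: slice_Comp Comp_eq)
next
  fix Z and p :: "'u \<Rightarrow> 'u" assume Z: "tame d Z" "topspace Z \<in> U" "continuous_map Z (T B) p"
  obtain X where X: "X \<in> Ob C" "T X = Z" using Ob_ex[OF Z(1,2), of "\<lambda>_. ()"] by auto
  have "mk X p \<in> Hom C X B" using Z(3) X by (intro mk_Hom B) auto
  then show "\<exists>E\<in>Ob (slice_cat C B). T (fst E) = Z \<and> (\<forall>x\<in>topspace Z. ap (snd E) x = p x)"
    using X by (intro bexI[of _ "(X, mk X p)"]) (auto simp: slice_Ob ap_mk)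
qed

end

locale slice = absolute_cat U C d T
  for U :: "'u set set" and C :: "('o, 'u \<rightharpoonup> 'u) cat" and d :: bool and T :: "'o \<Rightarrow> 'u topology" +
  fixes B :: 'o
  assumes B: "B \<in> Ob C"
begin

sublocale S: concrete_cat U "slice_cat C B" d "T B" "\<lambda>E. T (fst E)" "\<lambda>E. ap (snd E)"
  by (rule slice_concrete_cat[OF B])

abbreviation cg where "cg \<equiv> const_grp C B"

lemma cg_car: "gcar (cg G) = (prod_obj C (gcar G) B, proj2 C (gcar G) B)"
  by (simp add: const_grp_def Let_def)

lemma cg_point:
  assumes "K \<in> Ob C" "k \<in> pts K" "b \<in> pts B"
  shows "pr K B k b \<in> pts (prod_obj C K B)" "ap (proj1 C K B) (pr K B k b) = k" "ap (proj2 C K B) (pr K B k b) = b"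
  using pr[OF assms(1) B assms(2,3)] by simp_all

text \<open>Over a fixed \<open>b\<close> the operations are those of \<open>G\<close> in the first
  coordinate, so the group laws are inherited fibre by fibre.\<close>

lemma const_grp:
  assumes G: "group_object C G"
  shows "group_object (slice_cat C B) (cg G)"
    and "k \<in> pts (gcar G) \<Longrightarrow> k' \<in> pts (gcar G) \<Longrightarrow> b \<in> pts B \<Longrightarrow>
      S.gm (cg G) (pr (gcar G) B k b) (pr (gcar G) B k' b) = pr (gcar G) B (gm G k k') b"
proof -
  define K where "K = gcar G"
  note gc = group_closed[OF G, folded K_def, simplified] and gl = group_laws[OF G, folded K_def, simplified]
  note K = gc(1)
  have dat: "gmul G \<in> Hom C (prod_obj C K K) K" "gunit G \<in> Hom C (terminal_obj C) K" "ginv G \<in> Hom C K K"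
    using G unfolding group_object_iff group_data_def K_def by blast+
  note KB = prod_Ob[OF K B] and p = proj1_Hom[OF K B] proj2_Hom[OF K B]
  note pt = cg_point[OF K]
  define E where "E = (prod_obj C K B, proj2 C K B)"
  have Ef: "fst E = prod_obj C K B" "snd E = proj2 C K B" by (simp_all add: E_def)
  have E: "E \<in> Ob (slice_cat C B)" by (simp add: slice_Ob Ef KB p)
  define EE where "EE = prod_obj (slice_cat C B) E E"
  have EE: "EE \<in> Ob (slice_cat C B)" unfolding EE_def by (rule S.prod_Ob[OF E E])
  then have oEE: "fst EE \<in> Ob C" "snd EE \<in> Hom C (fst EE) B" by (simp_all add: slice_Ob)
  define p1 where "p1 = proj1 (slice_cat C B) E E"
  define p2 where "p2 = proj2 (slice_cat C B) E E"
  have p12: "p1 \<in> Hom C (fst EE) (prod_obj C K B)" "p2 \<in> Hom C (fst EE) (prod_obj C K B)"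
    using S.proj1_Hom[OF E E] S.proj2_Hom[OF E E] unfolding p1_def p2_def EE_def by (simp_all add: slice_Hom Ef)
  define T0 where "T0 = terminal_obj (slice_cat C B)"
  have T0: "fst T0 \<in> Ob C" "snd T0 \<in> Hom C (fst T0) B"
    using S.terminal_Ob by (simp_all add: slice_Ob T0_def)
  have pp: "proj1 C K B \<odot>\<^bsub>C\<^esub> p1 \<in> Hom C (fst EE) K" "proj1 C K B \<odot>\<^bsub>C\<^esub> p2 \<in> Hom C (fst EE) K"
    by (rule Comp_Hom[OF p12(1) p(1) oEE(1) KB K], rule Comp_Hom[OF p12(2) p(1) oEE(1) KB K])
  note m = op_pairing[OF oEE(1) K K K dat(1) pp]
  have u: "gunit G \<odot>\<^bsub>C\<^esub> to_terminal C (fst T0) \<in> Hom C (fst T0) K"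
    by (rule Comp_Hom[OF to_terminal_Hom[OF T0(1)] dat(2) T0(1) terminal_Ob K])
  have i: "ginv G \<odot>\<^bsub>C\<^esub> proj1 C K B \<in> Hom C (prod_obj C K B) K"
    by (rule Comp_Hom[OF p(1) dat(3) KB K K])
  have ops: "gmul (cg G) = pairing C (fst EE) K B (gmul G \<odot>\<^bsub>C\<^esub> pairing C (fst EE) K K (proj1 C K B \<odot>\<^bsub>C\<^esub> p1) (proj1 C K B \<odot>\<^bsub>C\<^esub> p2)) (snd EE)"
    "gunit (cg G) = pairing C (fst T0) K B (gunit G \<odot>\<^bsub>C\<^esub> to_terminal C (fst T0)) (snd T0)"
    "ginv (cg G) = pairing C (prod_obj C K B) K B (ginv G \<odot>\<^bsub>C\<^esub> proj1 C K B) (proj2 C K B)" "gcar (cg G) = E"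
    by (simp_all add: const_grp_def Let_def K_def E_def EE_def p1_def p2_def T0_def)
  have lift: "pairing C X K B f q \<in> Hom (slice_cat C B) (X, q) E"
    if "X \<in> Ob C" "f \<in> Hom C X K" "q \<in> Hom C X B" for X f q
  proof -
    note h = pairing[OF that(1) K B that(2,3)]
    have "proj2 C K B \<odot>\<^bsub>C\<^esub> pairing C X K B f q = q"
      using Comp_eqI[OF h(1) p(2) that(3) that(1) KB B] h(2) pt(3)
        Hom_in[OF that(2,1) K] Hom_in[OF that(3,1) B] by simp
    then show ?thesis using h(1) by (simp add: slice_Hom Ef)
  qed
  have group_data_S: "S.group_data (cg G)"
    unfolding S.group_data_def ops
    using E lift[OF oEE(1) m(1) oEE(2)] lift[OF T0(1) u T0(2)] lift[OF KB i p(2)]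
    by (simp add: EE_def[symmetric] T0_def[symmetric] E_def[symmetric])
  have gm: "S.gm (cg G) (pr K B k b) (pr K B k' b) = pr K B (gm G k k') b"
    if k: "k \<in> pts K" "k' \<in> pts K" "b \<in> pts B" for k k' b
  proof -
    let ?x = "pr K B k b" and ?y = "pr K B k' b"
    have x: "?x \<in> pts (fst E)" "?y \<in> pts (fst E)" "ap (snd E) ?x = ap (snd E) ?y"
      using pt[OF k(1,3)] pt[OF k(2,3)] by (simp_all add: Ef)
    let ?z = "S.pr E E ?x ?y"
    note z = S.pr[OF E E x, folded EE_def p1_def p2_def]
    have zz: "ap (snd EE) ?z = b" using z(4) pt(3)[OF k(1,3)] by (simp add: Ef)
    have "ap (gmul G \<odot>\<^bsub>C\<^esub> pairing C (fst EE) K K (proj1 C K B \<odot>\<^bsub>C\<^esub> p1) (proj1 C K B \<odot>\<^bsub>C\<^esub> p2)) ?z = gm G k k'"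
      using m(2)[OF z(1)] ap_Comp[OF p12(1) oEE(1) KB z(1)] ap_Comp[OF p12(2) oEE(1) KB z(1)] z(2,3)
        pt[OF k(1,3)] pt[OF k(2,3)] by (simp add: gm_def K_def)
    then show ?thesis
      unfolding S.gm_def ops using ap_pairing[OF oEE(1) K B m(1) oEE(2) z(1)] zz by simp
  qed
  have go: "S.go (cg G) b = pr K B (go G ()) b" if b: "b \<in> pts B" for b
  proof -
    note t = S.tm(1,2)[OF b, folded T0_def]
    have "ap (gunit G \<odot>\<^bsub>C\<^esub> to_terminal C (fst T0)) (S.tm b) = go G ()"
      using ap_Comp[OF to_terminal_Hom[OF T0(1)] T0(1) terminal_Ob t(1)] ap_to_terminal[OF T0(1) t(1)]
      by (simp add: go_def)
    then show ?thesis unfolding S.go_def ops using ap_pairing[OF T0(1) K B u T0(2) t(1)] t(2) by simp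
  qed
  have gi: "S.gi (cg G) (pr K B k b) = pr K B (gi G k) b" if k: "k \<in> pts K" "b \<in> pts B" for k b
    unfolding S.gi_def ops
    using ap_pairing[OF KB K B i p(2) pt(1)[OF k]] ap_Comp[OF p(1) KB K pt(1)[OF k]] pt[OF k] by (simp add: gi_def)
  have pts_E: "\<exists>k b. k \<in> pts K \<and> b \<in> pts B \<and> x = pr K B k b" if "x \<in> pts (fst E)" for x
    using prod_pts[OF K B that[unfolded Ef]] by metis
  have "S.group_points (cg G)"
    unfolding S.group_points_def Let_def ops(4)
  proof (intro conjI ballI impI)
    fix x y z assume "x \<in> pts (fst E)" "y \<in> pts (fst E)" "z \<in> pts (fst E)"
      and e: "ap (snd E) x = ap (snd E) y" "ap (snd E) y = ap (snd E) z"
    then obtain k b k' b' k'' b'' where k: "k \<in> pts K" "b \<in> pts B" "x = pr K B k b" "k' \<in> pts K" "b' \<in> pts B" "y = pr K B k' b'"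
      "k'' \<in> pts K" "b'' \<in> pts B" "z = pr K B k'' b''" using pts_E by metis
    have "b' = b" "b'' = b" using e k pt(3) by (simp_all add: Ef)
    then show "S.gm (cg G) (S.gm (cg G) x y) z = S.gm (cg G) x (S.gm (cg G) y z)"
      using k gm gc(2) gl(1) by simp
  next
    fix x assume "x \<in> pts (fst E)"
    then obtain k b where k: "k \<in> pts K" "b \<in> pts B" "x = pr K B k b" using pts_E by metis
    have e: "ap (snd E) x = b" using k pt(3) by (simp add: Ef)
    show "S.gm (cg G) (S.go (cg G) (ap (snd E) x)) x = x" "S.gm (cg G) x (S.go (cg G) (ap (snd E) x)) = x"
      "S.gm (cg G) (S.gi (cg G) x) x = S.go (cg G) (ap (snd E) x)" "S.gm (cg G) x (S.gi (cg G) x) = S.go (cg G) (ap (snd E) x)"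
      unfolding e using k gm go gi gc(4,6) gl(2-5) by simp_all
  qed
  then show "group_object (slice_cat C B) (cg G)" using group_data_S by (simp add: S.group_object_iff)
  show "k \<in> pts (gcar G) \<Longrightarrow> k' \<in> pts (gcar G) \<Longrightarrow> b \<in> pts B \<Longrightarrow>
      S.gm (cg G) (pr (gcar G) B k b) (pr (gcar G) B k' b) = pr (gcar G) B (gm G k k') b"
    using gm by (simp add: K_def)
qed

lemma lift_Hom:
  assumes "X \<in> Ob C" "K \<in> Ob C" "f \<in> Hom C X K" "q \<in> Hom C X B"
  shows "pairing C X K B f q \<in> Hom (slice_cat C B) (X, q) (prod_obj C K B, proj2 C K B)"
    and "x \<in> pts X \<Longrightarrow> ap (pairing C X K B f q) x = pr K B (ap f x) (ap q x)"
    and "proj1 C K B \<odot>\<^bsub>C\<^esub> pairing C X K B f q = f"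
proof -
  note h = pairing[OF assms(1,2) B assms(3,4)]
  note KB = prod_Ob[OF assms(2) B]
  note i = Hom_in[OF assms(3,1,2)] Hom_in[OF assms(4,1) B]
  have "proj2 C K B \<odot>\<^bsub>C\<^esub> pairing C X K B f q = q"
    using Comp_eqI[OF h(1) proj2_Hom[OF assms(2) B] assms(4,1) KB B] h(2) cg_point(3)[OF assms(2)] i by simp
  then show "pairing C X K B f q \<in> Hom (slice_cat C B) (X, q) (prod_obj C K B, proj2 C K B)"
    using h(1) by (simp add: slice_Hom)
  show "x \<in> pts X \<Longrightarrow> ap (pairing C X K B f q) x = pr K B (ap f x) (ap q x)" by (rule h(2))
  show "proj1 C K B \<odot>\<^bsub>C\<^esub> pairing C X K B f q = f"
    using Comp_eqI[OF h(1) proj1_Hom[OF assms(2) B] assms(3,1) KB assms(2)] h(2) cg_point(2)[OF assms(2)] i by simp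
qed

text \<open>An arrow over \<open>B\<close> into a constant group is determined by its first
  component, and it is a homomorphism iff that component is multiplicative within each fibre. This
  turns the adjunction into a presentation by relations.\<close>

lemma Hom_into_const:
  assumes H: "group_object (slice_cat C B) H" and G: "group_object C G"
  defines "X \<equiv> fst (gcar H)" and "q \<equiv> snd (gcar H)" and "K \<equiv> gcar G"
  shows "f \<in> Hom (Grp (slice_cat C B)) H (cg G) \<longleftrightarrow>
    (\<exists>\<phi>\<in>Hom C X K. f = pairing C X K B \<phi> q \<and>
      (\<forall>x\<in>pts X. \<forall>y\<in>pts X. ap q x = ap q y \<longrightarrow> ap \<phi> (S.gm H x y) = gm G (ap \<phi> x) (ap \<phi> y)))"
proof -
  note cG = const_grp[OF G, folded K_def]
  have E: "gcar H \<in> Ob (slice_cat C B)" by (rule S.group_closed(1)[OF H])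
  then have X: "X \<in> Ob C" and q: "q \<in> Hom C X B" by (simp_all add: slice_Ob X_def q_def)
  have K: "K \<in> Ob C" unfolding K_def by (rule group_closed(1)[OF G])
  note KB = prod_Ob[OF K B]
  have gH: "gcar H = (X, q)" by (simp add: X_def q_def)
  have car: "gcar (cg G) = (prod_obj C K B, proj2 C K B)" by (simp add: cg_car K_def)
  have mult: "f \<in> Hom (Grp (slice_cat C B)) H (cg G) \<longleftrightarrow>
      (\<forall>x\<in>pts X. \<forall>y\<in>pts X. ap q x = ap q y \<longrightarrow> ap \<phi> (S.gm H x y) = gm G (ap \<phi> x) (ap \<phi> y))"
    if \<phi>: "\<phi> \<in> Hom C X K" and f: "f = pairing C X K B \<phi> q" for \<phi> f
  proof -
    note l = lift_Hom[OF X K \<phi> q]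
    have fH: "f \<in> Hom (slice_cat C B) (X, q) (prod_obj C K B, proj2 C K B)" unfolding f by (rule l(1))
    have "ap f (S.gm H x y) = S.gm (cg G) (ap f x) (ap f y) \<longleftrightarrow> ap \<phi> (S.gm H x y) = gm G (ap \<phi> x) (ap \<phi> y)"
      if x: "x \<in> pts X" "y \<in> pts X" "ap q x = ap q y" for x y
    proof -
      have s: "S.gm H x y \<in> pts X" "ap q (S.gm H x y) = ap q x"
        using S.group_closed(2,3)[OF H, of x y] x by (simp_all add: X_def q_def)
      have i: "ap \<phi> x \<in> pts K" "ap \<phi> y \<in> pts K" "ap \<phi> (S.gm H x y) \<in> pts K" "ap q x \<in> pts B"
        using Hom_in[OF \<phi> X K] Hom_in[OF q X B] x s by blast+
      have g: "gm G (ap \<phi> x) (ap \<phi> y) \<in> pts K" using group_closed(2)[OF G] i by (simp add: K_def)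
      have "ap f (S.gm H x y) = pr K B (ap \<phi> (S.gm H x y)) (ap q x)" unfolding f using l(2)[OF s(1)] s(2) by simp
      moreover have "S.gm (cg G) (ap f x) (ap f y) = pr K B (gm G (ap \<phi> x) (ap \<phi> y)) (ap q x)"
        unfolding f using l(2) x cG(2)[OF i(1,2,4)] by simp
      moreover have "pr K B (ap \<phi> (S.gm H x y)) (ap q x) = pr K B (gm G (ap \<phi> x) (ap \<phi> y)) (ap q x) \<longleftrightarrow>
          ap \<phi> (S.gm H x y) = gm G (ap \<phi> x) (ap \<phi> y)"
        using cg_point(2)[OF K i(3,4)] cg_point(2)[OF K g i(4)] by metis
      ultimately show ?thesis by simp
    qed
    then show ?thesis unfolding S.Grp_Hom_iff[OF H cG(1)] gH car using fH by simp
  qed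
  show ?thesis
  proof
    assume f: "f \<in> Hom (Grp (slice_cat C B)) H (cg G)"
    then have "f \<in> Hom (slice_cat C B) (X, q) (prod_obj C K B, proj2 C K B)"
      using S.Grp_Hom_iff[OF H cG(1)] gH car by simp
    then have fC: "f \<in> Hom C X (prod_obj C K B)" and fq: "proj2 C K B \<odot>\<^bsub>C\<^esub> f = q" by (simp_all add: slice_Hom)
    define \<phi> where "\<phi> = proj1 C K B \<odot>\<^bsub>C\<^esub> f"
    have \<phi>: "\<phi> \<in> Hom C X K" unfolding \<phi>_def by (rule Comp_Hom[OF fC proj1_Hom[OF K B] X KB K])
    have "f = pairing C X K B \<phi> q"
    proof (rule Hom_ext[OF fC pairing_Hom[OF X K B \<phi> q] X KB])
      fix x assume x: "x \<in> pts X"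
      obtain k b where k: "k \<in> pts K" "b \<in> pts B" "ap f x = pr K B k b"
        by (rule prod_pts[OF K B Hom_in[OF fC X KB x]])
      have "ap \<phi> x = k" "ap q x = b"
        using ap_Comp[OF fC X KB x, of "proj1 C K B"] ap_Comp[OF fC X KB x, of "proj2 C K B"] k cg_point[OF K k(1,2)]
        by (simp_all add: \<phi>_def fq)
      then show "ap f x = ap (pairing C X K B \<phi> q) x" using lift_Hom(2)[OF X K \<phi> q x] k by simp
    qed
    then show "\<exists>\<phi>\<in>Hom C X K. f = pairing C X K B \<phi> q \<and>
      (\<forall>x\<in>pts X. \<forall>y\<in>pts X. ap q x = ap q y \<longrightarrow> ap \<phi> (S.gm H x y) = gm G (ap \<phi> x) (ap \<phi> y))"
      using \<phi> mult f by blast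
  next
    assume "\<exists>\<phi>\<in>Hom C X K. f = pairing C X K B \<phi> q \<and>
      (\<forall>x\<in>pts X. \<forall>y\<in>pts X. ap q x = ap q y \<longrightarrow> ap \<phi> (S.gm H x y) = gm G (ap \<phi> x) (ap \<phi> y))"
    then show "f \<in> Hom (Grp (slice_cat C B)) H (cg G)" using mult by blast
  qed
qed

lemma FHom_const: "FHom (const_grp_ftor C B) G H g = pairing C (prod_obj C (gcar G) B) (gcar H) B
    (g \<odot>\<^bsub>C\<^esub> proj1 C (gcar G) B) (proj2 C (gcar G) B)"
  by (simp add: const_grp_ftor_def)

lemma FOb_const: "FOb (const_grp_ftor C B) = cg"
  by (simp add: const_grp_ftor_def)

lemma FHom_const_Hom:
  assumes G: "group_object C G" and H: "group_object C H" and g: "g \<in> Hom (Grp C) G H"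
  shows "FHom (const_grp_ftor C B) G H g \<in> Hom (Grp (slice_cat C B)) (cg G) (cg H)"
    and "k \<in> pts (gcar G) \<Longrightarrow> b \<in> pts B \<Longrightarrow>
      ap (FHom (const_grp_ftor C B) G H g) (pr (gcar G) B k b) = pr (gcar H) B (ap g k) b"
proof -
  define K L where "K = gcar G" and "L = gcar H"
  have o: "K \<in> Ob C" "L \<in> Ob C" unfolding K_def L_def by (rule group_closed(1)[OF G], rule group_closed(1)[OF H])
  have g': "g \<in> Hom C K L" and gg: "\<And>x y. x \<in> pts K \<Longrightarrow> y \<in> pts K \<Longrightarrow> ap g (gm G x y) = gm H (ap g x) (ap g y)"
    using g unfolding Grp_Hom_iff[OF G H] K_def L_def by simp_all
  note KB = prod_Ob[OF o(1) B] and p = proj1_Hom[OF o(1) B] proj2_Hom[OF o(1) B]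
  have gp: "g \<odot>\<^bsub>C\<^esub> proj1 C K B \<in> Hom C (prod_obj C K B) L" by (rule Comp_Hom[OF p(1) g' KB o])
  have val: "ap (g \<odot>\<^bsub>C\<^esub> proj1 C K B) (pr K B k b) = ap g k" if "k \<in> pts K" "b \<in> pts B" for k b
    using ap_Comp[OF p(1) KB o(1) cg_point(1)[OF o(1) that]] cg_point(2)[OF o(1) that] by simp
  show "ap (FHom (const_grp_ftor C B) G H g) (pr (gcar G) B k b) = pr (gcar H) B (ap g k) b"
    if "k \<in> pts (gcar G)" "b \<in> pts B"
    using that lift_Hom(2)[OF KB o(2) gp p(2) cg_point(1)[OF o(1)]] val cg_point(3)[OF o(1)]
    by (simp add: FHom_const K_def L_def)
  show "FHom (const_grp_ftor C B) G H g \<in> Hom (Grp (slice_cat C B)) (cg G) (cg H)"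
    unfolding Hom_into_const[OF const_grp(1)[OF G] H] cg_car fst_conv snd_conv FHom_const K_def[symmetric] L_def[symmetric]
  proof (intro bexI[OF _ gp] conjI refl ballI impI)
    fix x y assume x: "x \<in> pts (prod_obj C K B)" and y: "y \<in> pts (prod_obj C K B)"
      and e: "ap (proj2 C K B) x = ap (proj2 C K B) y"
    obtain k b where k: "k \<in> pts K" "b \<in> pts B" "x = pr K B k b" by (rule prod_pts[OF o(1) B x])
    obtain k' b' where k': "k' \<in> pts K" "b' \<in> pts B" "y = pr K B k' b'" by (rule prod_pts[OF o(1) B y])
    have b: "b' = b" using e k k' cg_point(3)[OF o(1)] by simp
    have "S.gm (cg G) x y = pr K B (gm G k k') b"
      using const_grp(2)[OF G, folded K_def, OF k(1) k'(1) k(2)] k k' b by simp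
    moreover have "gm G k k' \<in> pts K" using group_closed(2)[OF G, folded K_def] k k' by simp
    ultimately show "ap (g \<odot>\<^bsub>C\<^esub> proj1 C K B) (S.gm (cg G) x y) = gm H (ap (g \<odot>\<^bsub>C\<^esub> proj1 C K B) x) (ap (g \<odot>\<^bsub>C\<^esub> proj1 C K B) y)"
      using val k k' b gg by simp
  qed
qed

lemma ftor_const: "is_ftor (Grp C) (Grp (slice_cat C B)) (const_grp_ftor C B)"
  unfolding is_ftor_def FOb_const Grp_Ob S.Grp_Ob
proof (intro conjI ballI)
  show "group_object (slice_cat C B) (cg G)" if "G \<in> Ob (Grp C)" for G
    using const_grp(1) that by (simp add: Grp_Ob)
  show "FHom (const_grp_ftor C B) G H g \<in> Hom (Grp (slice_cat C B)) (cg G) (cg H)"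
    if "G \<in> Ob (Grp C)" "H \<in> Ob (Grp C)" "g \<in> Hom (Grp C) G H" for G H g
    using FHom_const_Hom(1) that by (simp add: Grp_Ob)
next
  \<comment> \<open>Arrows out of a constant group are compared on points with given coordinates,
    where the functor acts on the first coordinate only.\<close>
  have ext: "f = f'" if G: "group_object C G" and H: "group_object C H"
    and f: "f \<in> Hom (Grp (slice_cat C B)) (cg G) (cg H)" "f' \<in> Hom (Grp (slice_cat C B)) (cg G) (cg H)"
    and eq: "\<And>k b. k \<in> pts (gcar G) \<Longrightarrow> b \<in> pts B \<Longrightarrow> ap f (pr (gcar G) B k b) = ap f' (pr (gcar G) B k b)" for G H f f'
  proof -
    note o = group_closed(1)[OF G] group_closed(1)[OF H]
    have "f \<in> Hom C (prod_obj C (gcar G) B) (prod_obj C (gcar H) B)" "f' \<in> Hom C (prod_obj C (gcar G) B) (prod_obj C (gcar H) B)"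
      using f by (simp_all add: S.Grp_Hom_iff[OF const_grp(1)[OF G] const_grp(1)[OF H]] cg_car slice_Hom)
    then show "f = f'"
    proof (rule Hom_ext[OF _ _ prod_Ob[OF o(1) B] prod_Ob[OF o(2) B]])
      fix x assume "x \<in> pts (prod_obj C (gcar G) B)"
      then obtain k b where "k \<in> pts (gcar G)" "b \<in> pts B" "x = pr (gcar G) B k b" by (rule prod_pts[OF o(1) B])
      then show "ap f x = ap f' x" using eq by simp
    qed
  qed
  {
    fix G assume "G \<in> Ob (Grp C)"
    then have G: "group_object C G" by (simp add: Grp_Ob)
    note I = category.Id_in_Hom[OF category_Grp \<open>G \<in> Ob (Grp C)\<close>]
    have cG: "cg G \<in> Ob (Grp (slice_cat C B))" using const_grp(1)[OF G] by (simp add: S.Grp_Ob)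
    show "FHom (const_grp_ftor C B) G G (cat.Id (Grp C) G) = cat.Id (Grp (slice_cat C B)) (cg G)"
    proof (rule ext[OF G G FHom_const_Hom(1)[OF G G I] category.Id_in_Hom[OF S.category_Grp cG]])
      fix k b assume k: "k \<in> pts (gcar G)" "b \<in> pts B"
      note o = group_closed(1)[OF G]
      show "ap (FHom (const_grp_ftor C B) G G (cat.Id (Grp C) G)) (pr (gcar G) B k b) =
          ap (cat.Id (Grp (slice_cat C B)) (cg G)) (pr (gcar G) B k b)"
        using FHom_const_Hom(2)[OF G G I k] ap_Id[OF o k(1)] ap_Id[OF prod_Ob[OF o B] cg_point(1)[OF o k]]
        by (simp add: Grp_Id S.Grp_Id slice_Id cg_car)
    qed
  next
    fix G H K g h assume "G \<in> Ob (Grp C)" "H \<in> Ob (Grp C)" "K \<in> Ob (Grp C)"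
      and g: "g \<in> Hom (Grp C) G H" and h: "h \<in> Hom (Grp C) H K"
    then have G: "group_object C G" and H: "group_object C H" and K: "group_object C K" by (simp_all add: Grp_Ob)
    have hg: "h \<odot>\<^bsub>C\<^esub> g \<in> Hom (Grp C) G K"
      using category.Comp_in_Hom[OF category_Grp _ _ _ g h] G H K by (simp add: Grp_Ob Grp_Comp)
    note FG = FHom_const_Hom[OF G H g] and FH = FHom_const_Hom[OF H K h] and FK = FHom_const_Hom[OF G K hg]
    have c: "FHom (const_grp_ftor C B) H K h \<odot>\<^bsub>C\<^esub> FHom (const_grp_ftor C B) G H g \<in> Hom (Grp (slice_cat C B)) (cg G) (cg K)"
      using category.Comp_in_Hom[OF S.category_Grp _ _ _ FG(1) FH(1)] const_grp(1)[OF G] const_grp(1)[OF H] const_grp(1)[OF K]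
      by (simp add: S.Grp_Ob S.Grp_Comp slice_Comp)
    note o = group_closed(1)[OF G] group_closed(1)[OF H]
    have g': "g \<in> Hom C (gcar G) (gcar H)" using g by (simp add: Grp_Hom_iff[OF G H])
    have F': "FHom (const_grp_ftor C B) G H g \<in> Hom C (prod_obj C (gcar G) B) (prod_obj C (gcar H) B)"
      using FG(1) by (simp add: S.Grp_Hom_iff[OF const_grp(1)[OF G] const_grp(1)[OF H]] cg_car slice_Hom)
    show "FHom (const_grp_ftor C B) G K (h \<odot>\<^bsub>Grp C\<^esub> g) =
        FHom (const_grp_ftor C B) H K h \<odot>\<^bsub>Grp (slice_cat C B)\<^esub> FHom (const_grp_ftor C B) G H g"
      unfolding Grp_Comp S.Grp_Comp slice_Comp
    proof (rule ext[OF G K FK(1) c])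
      fix k b assume k: "k \<in> pts (gcar G)" "b \<in> pts B"
      have "ap g k \<in> pts (gcar H)" using Hom_in[OF g' o k(1)] .
      then show "ap (FHom (const_grp_ftor C B) G K (h \<odot>\<^bsub>C\<^esub> g)) (pr (gcar G) B k b) =
          ap (FHom (const_grp_ftor C B) H K h \<odot>\<^bsub>C\<^esub> FHom (const_grp_ftor C B) G H g) (pr (gcar G) B k b)"
        using FK(2)[OF k] ap_Comp[OF g' o k(1)] ap_Comp[OF F' prod_Ob[OF o(1) B] prod_Ob[OF o(2) B] cg_point(1)[OF o(1) k]]
          FG(2)[OF k] FH(2) k by simp
    qed
  }
qed

text \<open>The internal coproduct is the universal group on the total space of \<open>H\<close> in
  which products within a fibre are kept; no relation joins different fibres. The unit has as first
  component the universal map from the total space.\<close>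

lemma universal_group:
  assumes H: "group_object (slice_cat C B) H"
  shows "\<exists>G u. G \<in> Ob (Grp C) \<and> u \<in> Hom (Grp (slice_cat C B)) H (FOb (const_grp_ftor C B) G) \<and>
    (\<forall>K\<in>Ob (Grp C). \<forall>f\<in>Hom (Grp (slice_cat C B)) H (FOb (const_grp_ftor C B) K).
      \<exists>!g. g \<in> Hom (Grp C) G K \<and> FHom (const_grp_ftor C B) G K g \<odot>\<^bsub>Grp (slice_cat C B)\<^esub> u = f) \<and>
    generated_by C G (fst (gcar H)) (proj1 C (gcar G) B \<odot>\<^bsub>C\<^esub> u)"
proof -
  define X q where "X = fst (gcar H)" and "q = snd (gcar H)"
  have "gcar H \<in> Ob (slice_cat C B)" by (rule S.group_closed(1)[OF H])
  then have X: "X \<in> Ob C" and q: "q \<in> Hom C X B" by (simp_all add: slice_Ob X_def q_def)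
  define Rel where "Rel = {(x, y, S.gm H x y) | x y. x \<in> pts X \<and> y \<in> pts X \<and> ap q x = ap q y}"
  have Rel: "Rel \<subseteq> pts X \<times> pts X \<times> pts X"
    using S.group_closed(2)[OF H] by (auto simp: Rel_def X_def q_def)
  have rel_iff: "(\<forall>(x, y, z)\<in>Rel. gm K (ap \<phi> x) (ap \<phi> y) = ap \<phi> z) \<longleftrightarrow>
      (\<forall>x\<in>pts X. \<forall>y\<in>pts X. ap q x = ap q y \<longrightarrow> ap \<phi> (S.gm H x y) = gm K (ap \<phi> x) (ap \<phi> y))" for K \<phi>
    unfolding Rel_def by fastforce
  note into = Hom_into_const[OF H, folded X_def q_def]
  obtain G \<iota> where G: "group_object C G" and \<iota>: "\<iota> \<in> Hom C X (gcar G)"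
    and r: "\<forall>(x, y, z)\<in>Rel. gm G (ap \<iota> x) (ap \<iota> y) = ap \<iota> z" and den: "dense_gen (tg_of G) (ap \<iota> ` pts X)"
    and univ: "\<forall>K \<phi>. group_object C K \<and> \<phi> \<in> Hom C X (gcar K) \<and> (\<forall>(x, y, z)\<in>Rel. gm K (ap \<phi> x) (ap \<phi> y) = ap \<phi> z) \<longrightarrow>
       (\<exists>!\<psi>. \<psi> \<in> Hom (Grp C) G K \<and> \<psi> \<odot>\<^bsub>C\<^esub> \<iota> = \<phi>)"
    by (rule free_group_object[OF X Rel])
  note oG = group_closed(1)[OF G]
  define u where "u = pairing C X (gcar G) B \<iota> q"
  note lu = lift_Hom[OF X oG \<iota> q, folded u_def]
  have u: "u \<in> Hom (Grp (slice_cat C B)) H (cg G)"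
    unfolding into[OF G] using \<iota> r rel_iff u_def by blast
  have uC: "u \<in> Hom C X (prod_obj C (gcar G) B)" unfolding u_def by (rule pairing_Hom[OF X oG B \<iota> q])
  have comp: "FHom (const_grp_ftor C B) G K g \<odot>\<^bsub>C\<^esub> u = pairing C X (gcar K) B (g \<odot>\<^bsub>C\<^esub> \<iota>) q"
    if K: "group_object C K" and g: "g \<in> Hom (Grp C) G K" for K g
  proof -
    note oK = group_closed(1)[OF K] and F = FHom_const_Hom[OF G K g]
    have g': "g \<in> Hom C (gcar G) (gcar K)" using g by (simp add: Grp_Hom_iff[OF G K])
    have gi: "g \<odot>\<^bsub>C\<^esub> \<iota> \<in> Hom C X (gcar K)" by (rule Comp_Hom[OF \<iota> g' X oG oK])
    have F': "FHom (const_grp_ftor C B) G K g \<in> Hom C (prod_obj C (gcar G) B) (prod_obj C (gcar K) B)"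
      using F(1) by (simp add: S.Grp_Hom_iff[OF const_grp(1)[OF G] const_grp(1)[OF K]] cg_car slice_Hom)
    show ?thesis
      using Comp_eqI[OF uC F' pairing_Hom[OF X oK B gi q] X prod_Ob[OF oG B] prod_Ob[OF oK B]]
        lift_Hom(2)[OF X oK gi q] lu(2) F(2)[OF Hom_in[OF \<iota> X oG] Hom_in[OF q X B]] ap_Comp[OF \<iota> X oG] by simp
  qed
  have "\<exists>!g. g \<in> Hom (Grp C) G K \<and> FHom (const_grp_ftor C B) G K g \<odot>\<^bsub>C\<^esub> u = f"
    if "K \<in> Ob (Grp C)" and f: "f \<in> Hom (Grp (slice_cat C B)) H (cg K)" for K f
  proof -
    have K: "group_object C K" using that by (simp add: Grp_Ob)
    note oK = group_closed(1)[OF K]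
    obtain \<phi> where \<phi>: "\<phi> \<in> Hom C X (gcar K)" "f = pairing C X (gcar K) B \<phi> q"
      and m: "\<forall>x\<in>pts X. \<forall>y\<in>pts X. ap q x = ap q y \<longrightarrow> ap \<phi> (S.gm H x y) = gm K (ap \<phi> x) (ap \<phi> y)"
      using f unfolding into[OF K] by blast
    have "\<exists>!\<psi>. \<psi> \<in> Hom (Grp C) G K \<and> \<psi> \<odot>\<^bsub>C\<^esub> \<iota> = \<phi>" using univ K \<phi>(1) m rel_iff by blast
    moreover have "FHom (const_grp_ftor C B) G K g \<odot>\<^bsub>C\<^esub> u = f \<longleftrightarrow> g \<odot>\<^bsub>C\<^esub> \<iota> = \<phi>" if g: "g \<in> Hom (Grp C) G K" for g
    proof -
      have g': "g \<in> Hom C (gcar G) (gcar K)" using g by (simp add: Grp_Hom_iff[OF G K])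
      have gi: "g \<odot>\<^bsub>C\<^esub> \<iota> \<in> Hom C X (gcar K)" by (rule Comp_Hom[OF \<iota> g' X oG oK])
      show ?thesis
        unfolding comp[OF K g] \<phi>(2) using lift_Hom(3)[OF X oK gi q] lift_Hom(3)[OF X oK \<phi>(1) q] by metis
    qed
    ultimately show ?thesis by blast
  qed
  moreover have "generated_by C G X (proj1 C (gcar G) B \<odot>\<^bsub>C\<^esub> u)"
    unfolding lu(3)
  proof (rule dense_generated_by[OF G X \<iota> den])
    fix x assume x: "x \<in> pts X"
    let ?y = "S.gi H x"
    note c = S.group_closed[OF H, folded X_def q_def] and l = S.group_laws[OF H, folded X_def q_def]
    have y: "?y \<in> pts X" "ap q ?y = ap q x" using c(6,7)[OF x] by simp_all
    have b: "ap q x \<in> pts B" by (rule Hom_in[OF q X B x])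
    let ?e = "S.go H (ap q x)"
    have e: "?e \<in> pts X" "ap q ?e = ap q x" using c(4,5)[OF b] by simp_all
    have m: "ap \<iota> (S.gm H x y) = gm G (ap \<iota> x) (ap \<iota> y)" if "x \<in> pts X" "y \<in> pts X" "ap q x = ap q y" for x y
      using r rel_iff that by blast
    note TG = tgroup_of[OF G] and i = Hom_in[OF \<iota> X oG]
    \<comment> \<open>The unit of a fibre is idempotent, so it goes to an idempotent of
      \<open>G\<close>, which can only be the unit. Inverses in the fibres therefore go to inverses,
      and the image of \<open>X\<close> is closed under inverses.\<close>
    have "S.gm H ?e ?e = ?e" using l(2)[OF e(1)] e(2) by simp
    then have "gm G (ap \<iota> ?e) (ap \<iota> ?e) = ap \<iota> ?e" using m[OF e(1) e(1) refl] by simp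
    then have one: "ap \<iota> ?e = go G ()"
      using tgroup_idem[OF TG, of "ap \<iota> ?e"] i[OF e(1)] by (simp add: tg_of_simps)
    have "gm G (ap \<iota> x) (ap \<iota> ?y) = go G ()" using m[OF x y(1)] y(2) l(5)[OF x] one by simp
    then have "ap \<iota> ?y = gi G (ap \<iota> x)"
      using tgroup_inv_unique[OF TG, of "ap \<iota> x" "ap \<iota> ?y"] i[OF x] i[OF y(1)] by (simp add: tg_of_simps)
    then show "\<exists>x'\<in>pts X. ap \<iota> x' = gi G (ap \<iota> x)" using y(1) by blast
  qed
  ultimately show ?thesis
    using G u unfolding FOb_const S.Grp_Comp slice_Comp X_def by (intro exI[of _ G] exI[of _ u]) (simp add: Grp_Ob)
qed

lemma const_left_adjoint:
  "\<exists>L \<eta>. is_left_adjoint (Grp C) (Grp (slice_cat C B)) L (const_grp_ftor C B) \<eta> \<and>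
    (\<forall>H\<in>Ob (Grp (slice_cat C B)).
       generated_by C (FOb L H) (fst (gcar H)) (proj1 C (gcar (FOb L H)) B \<odot>\<^bsub>C\<^esub> \<eta> H))"
  by (rule left_adjoint_of_universal[OF category_Grp S.category_Grp ftor_const])
    (rule universal_group, simp add: S.Grp_Ob)

end

section \<open>Sets and profinite spaces\<close>

lemma (in absolute_cat) Bass_Serre_C: "Bass_Serre C"
  unfolding Bass_Serre_def
proof (intro conjI ballI)
  show "category C" by (rule category_C)
  show "locally_action_Barr_exact C"
    unfolding locally_action_Barr_exact_def using concrete_cat.action_Barr_exact_C[OF slice_concrete_cat] by blast
  show "\<exists>t. is_terminal C t" by (rule terminal_ex)
  show "has_coequalisers C" by (rule has_coequalisers_C)
  show "products_preserve_coequalisers C" by (rule products_preserve_coequalisers_C) simp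
  show "has_coequalisers (Grp C)" by (rule Grp_coequalisers)
  fix B assume "B \<in> Ob C"
  then interpret slice U C d T B by unfold_locales
  show "\<exists>L \<eta>. is_left_adjoint (Grp C) (Grp (slice_cat C B)) L (const_grp_ftor C B) \<eta> \<and>
    (\<forall>H\<in>Ob (Grp (slice_cat C B)).
       generated_by C (FOb L H) (fst (gcar H)) (proj1 C (gcar (FOb L H)) B \<odot>\<^bsub>C\<^esub> \<eta> H))"
    by (rule const_left_adjoint)
qed

lemma Set_absolute_cat:
  assumes U: "set_universe U" shows "absolute_cat U (Set_cat U) True discrete_topology"
proof -
  interpret universe U by unfold_locales (rule U)
  show ?thesis
  proof
    show "tame True (discrete_topology {()})" by (rule tame_singleton)
    show "small (topspace (discrete_topology {()}))" by (rule small_finite) simp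
    show "Comp (Set_cat U) = (\<circ>\<^sub>m)" by (simp add: Set_cat_def)
  next
    fix A A' assume "A \<in> Ob (Set_cat U)" "A' \<in> Ob (Set_cat U)"
    \<comment> \<open>Continuity out of a discrete space only says that the values lie in the
      target, which is the range condition on partial functions.\<close>
    have "ran f \<subseteq> A' \<longleftrightarrow> ap f \<in> A \<rightarrow> A'" if "dom f = A" for f
      using that by (force simp: ran_def dom_def ap_def Pi_def)
    then show "Hom (Set_cat U) A A' = {f. dom f = topspace (discrete_topology A) \<and>
        continuous_map (discrete_topology A) (discrete_topology A') (ap f) \<and>
        (\<forall>x\<in>topspace (discrete_topology A). () = ())}"
      by (auto simp: Set_cat_def continuous_map_from_discrete_topology)
  next
    fix A assume A: "A \<in> Ob (Set_cat U)"
    show "cat.Id (Set_cat U) A = Some |` topspace (discrete_topology A)" by (simp add: Set_cat_def)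
    show "tame True (discrete_topology A)" by (simp add: tame_discrete)
    show "topspace (discrete_topology A) \<in> U" using A by (simp add: Set_cat_def)
    show "continuous_map (discrete_topology A) (discrete_topology {()}) (\<lambda>_. ())" by simp
  next
    fix Z :: "'a topology" and p :: "'a \<Rightarrow> unit" assume "tame True Z" "topspace Z \<in> U"
    then show "\<exists>A\<in>Ob (Set_cat U). discrete_topology A = Z \<and> (\<forall>x\<in>topspace Z. () = p x)"
      unfolding tame_discrete by (intro bexI[of _ "topspace Z"]) (auto simp: Set_cat_def)
  qed
qed

lemma Pro_absolute_cat:
  assumes U: "set_universe U" shows "absolute_cat U (Pro_cat U) False (\<lambda>X. X)"
proof -
  interpret universe U by unfold_locales (rule U)
  show ?thesis
  proof
    show "tame False (discrete_topology {()})" by (rule tame_singleton)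
    show "small (topspace (discrete_topology {()}))" by (rule small_finite) simp
    show "Comp (Pro_cat U) = (\<circ>\<^sub>m)" by (simp add: Pro_cat_def)
    show "Hom (Pro_cat U) X Y = {f. dom f = topspace X \<and> continuous_map X Y (ap f) \<and> (\<forall>x\<in>topspace X. () = ())}" for X Y
      by (simp add: Pro_cat_def ap_def[abs_def])
  qed (auto simp: Pro_cat_def tame_profinite)
qed

theorem proposition5p4:
  fixes U :: "'u set set"
  assumes "set_universe U"
  shows "Bass_Serre (Set_cat U) \<and> Bass_Serre (Pro_cat U)"
  using absolute_cat.Bass_Serre_C[OF Set_absolute_cat[OF assms]] absolute_cat.Bass_Serre_C[OF Pro_absolute_cat[OF assms]] by blast

end
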